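(* For every $\star\in\{D,V,E,F,T\}$ the approximation of the integral of the regularized integrand $\tilde k_{1,\star}$ over the unit cube by means of tensor Gauss quadrature converges exponentially with respect to the number $n$ of Gauss points per dimension: $$\left|E^n[\tilde k_{1,\star}]\right|\le C\,h^{3-2s}\,(2\rho_\star)^{-2n}$$ with $\rho_\star>1/2$, where $C>0$ and $\rho_\star$ are independent of $n$ and of the mesh size $h$. Here $V,E,F,T$ refer to pairs of tetrahedra with a common vertex, a common edge, a common face, and identical tetrahedra, respectively, and $D$ to pairs with positive distance comparable to $h$.
   Context: **Meshes.** $0<s<1$; $\Omega\subset\mathbb R^3$ is a Lipschitz domain with regular partitions $\mathcal T$ into tetrahedra. $\varphi_1,\dots,\varphi_N$ is the nodal basis (one function per inner node) of the continuous piecewise linear functions on $\mathcal T$ vanishing outside $\Omega$. $h_t$ is the diameter of $t$ and $h$ the mean of all $h_t$, $t\in\mathcal T$. Shape regularity: the minimal interior angle of each $t\in\mathcal T$ is larger than $\theta_{\mathcal T}>0$. Quasi-uniformity: there are $c_1,c_2>0$ with $c_1h_{t_1}\le h_{t_2}\le c_2h_{t_1}$ for all $t_1,t_2\in\mathcal T$. **Geometric assumption.** (1) For all $t\in\mathcal T$ there are $c_A>0$ and $x_0\in\bar t$ such that $|x-y|\ge c_A(|x-x_0|+|x_0-y|)$ for all $x\in\Omega\setminus t$, $y\in t$. (2) For all $t_1,t_2\in\mathcal T$ whose intersection consists of a common vertex $p$ there is $c_A>0$ such that $|x-y|\ge c_A(|x-p|+|p-y|)$ for $x\in t_1$, $y\in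 t_2$. (3) For all $t_1,t_2\in\mathcal T$ with exactly one common edge $S=\bar t_1\cap\bar t_2$ there are $c_A>0$ and a point $p\in S$ such that $|x-y|\ge c_A(|x-p|+|p-y|)$ for all $x\in t_1$, $y\in t_2$. (4) The same as (3) for all $t_1,t_2\in\mathcal T$ with exactly one common face $S=\bar t_1\cap\bar t_2$. **Reference map.** For a tetrahedron $t$ with vertices $a_t,b_t,c_t,d_t$: $\chi_t(\tilde x)=M_t\tilde x+a_t$, $M_t=[b_t-a_t,c_t-b_t,d_t-b_t]$, mapping $\tilde t=\{\tilde x\in\mathbb R^3:0\le\tilde x_1\le1,\ 0\le\tilde x_2\le\tilde x_1,\ 0\le\tilde x_3\le\tilde x_1-\tilde x_2\}$ onto $t$. $\lambda_i^t$ is the affine function on $\mathbb R^3$ coinciding with $\varphi_i$ on $t$. For a pair $t_1,t_2$ the vertices are ordered so that common ones come first, in the same order (V: $a_{t_1}=a_{t_2}$; E: also $b_{t_1}=b_{t_2}$; F: also $c_{t_1}=c_{t_2}$; T: all equal). For given indices $i,j$, $$\tilde k_1(\tilde x,\tilde y)=\frac{\prod_{l\in\{i,j\}}[\lambda_l^{t_1}(\chi_{t_1}(\tilde x))-\lambda_l^{t_2}(\chi_{t_2}(\tilde y))]}{|\chi_{t_1}(\tilde x)-\chi_{t_2}(\tilde y)|^{3+2s}}|\det M_{t_1}||\det M_{t_2}|.$$ The integrands below arise by Duffy-type transformations from $$\int_{t_1}\int_{t_2}\frac{[\varphi_i(x)-\varphi_i(y)][\varphi_j(x)-\varphi_j(y)]}{|x-y|^{3+2s}}\,dy\,dx.$$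 **Regularized integrands.** In the cases V, E, F, T the integrand is $\tilde k_{1,\star}(\eta)=\sum_m\tilde k_1(\mathscr D_m(\eta))J_m(\eta)$ with the following $\mathscr D_m=(\mathscr D^1_m,\mathscr D^2_m)$; $\mathscr D^T$ denotes the pair with its two components interchanged. (V, $\eta\in[0,1]^5$) $\mathscr D_1=\big((1,\eta_1\eta_2,\eta_1(1-\eta_2)),(\eta_3,\eta_3\eta_4\eta_5,\eta_3\eta_4(1-\eta_5))\big)$, $\mathscr D_2=\mathscr D_1^T$, $J_1=J_2=\eta_1\eta_3^2\eta_4$. (E, $\eta\in[0,1]^4$) $\mathscr D_1=\big((0,\eta_1,1-\eta_1),(-\eta_2\eta_3\eta_4,\eta_2\eta_3(1-\eta_4),\eta_2(1-\eta_3))\big)$, $\mathscr D_2=\big((0,\eta_3\eta_4,\eta_3(1-\eta_4)),(-\eta_1\eta_2,\eta_1(1-\eta_2),1-\eta_1)\big)$, $\mathscr D_3=\mathscr D_1^T$, $\mathscr D_4=\mathscr D_2^T$; $J_1=J_3=\eta_2^2\eta_3$, $J_2=J_4=\eta_1\eta_3$. (F, $\eta\in[0,1]^3$) $\mathscr D_1=((0,\eta_1,1-\eta_1),(-\eta_1\eta_2\eta_3,0,\eta_1\eta_2(1-\eta_3)))$, $\mathscr D_2=((0,\eta_1\eta_2,\eta_1(1-\eta_2)),(-\eta_1\eta_2\eta_3,0,1-\eta_1\eta_2\eta_3))$, $\mathscr D_3=((0,\eta_1\eta_2,1-\eta_1\eta_2),(-\eta_1\eta_2\eta_3,0,\eta_1(1-\eta_2\eta_3)))$,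 $\mathscr D_4=((0,\eta_1\eta_2\eta_3,\eta_1\eta_2(1-\eta_3)),(-\eta_1,0,1-\eta_1))$, $\mathscr D_5=((0,\eta_1\eta_2\eta_3,\eta_1(1-\eta_2\eta_3)),(-\eta_1\eta_2,0,1-\eta_1\eta_2))$, $\mathscr D_6=((0,\eta_1\eta_2\eta_3,1-\eta_1\eta_2\eta_3),(-\eta_1\eta_2,0,\eta_1(1-\eta_2)))$, $\mathscr D_7=((0,0,1),(-\eta_1\eta_2\eta_3,\eta_1\eta_2(1-\eta_3),\eta_1(1-\eta_2)))$, $\mathscr D_{7+i}=\mathscr D_i^T$ for $i=1,\dots,7$, $\mathscr D_{15}=((-\eta_1\eta_2\eta_3,\eta_1\eta_2(1-\eta_3),1-\eta_1\eta_2),(0,0,\eta_1))$, $\mathscr D_{16}=((0,0,\eta_3),(-\eta_1\eta_2,\eta_1(1-\eta_2),1-\eta_1))$, $\mathscr D_{17}=((-\eta_1\eta_2,\eta_1(1-\eta_2),1-\eta_1),(0,0,\eta_1\eta_3))$; $J_m=\eta_1^2\eta_2$ for $m\le15$, $J_{16}=\eta_1$, $J_{17}=\eta_1^2$. (T, $t_1=t_2$, $\eta\in[0,1]^2$, $m=1,\dots,9$) $\mathscr D_1=((0,\eta_1,-\eta_1),(-\eta_1\eta_2,0,-1))$, $\mathscr D_2=((0,1,0),(-\eta_1\eta_2,0,\eta_1(1-\eta_2)))$, $\mathscr D_3=((0,\eta_1,-1),(-\eta_1\eta_2,0,-\eta_1\eta_2))$, $\mathscr D_4=((0,\eta_1\eta_2,-\eta_1\eta_2),(-\eta_1,0,-1))$,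 $\mathscr D_5=((0,\eta_1\eta_2,\eta_1(1-\eta_2)),(-1,0,0))$, $\mathscr D_6=((0,\eta_1\eta_2,-1),(-\eta_1,0,-\eta_1))$, $\mathscr D_7=((0,0,0),(-\eta_1\eta_2,\eta_1(1-\eta_2),-1))$, $\mathscr D_8=((0,0,-1),(-\eta_1\eta_2,\eta_1(1-\eta_2),-\eta_1))$, $\mathscr D_9=((0,0,\eta_1),(-\eta_2,1-\eta_2,0))$; $J_m=\eta_1$ for $m=1,\dots,9$. (D, $\eta\in[0,1]^6$) Here $d_{t_1,t_2}=\inf_{(x,y)\in t_1\times t_2}|x-y|>0$ and $d_{t_1,t_2}\approx h$, i.e. $c_3h\le d_{t_1,t_2}\le c_4h$ with fixed $c_3,c_4>0$. With $\mathscr D_1=(\eta_1,\eta_1\eta_2,\eta_1\eta_2\eta_3)$, $\mathscr D_2=(\eta_4,\eta_4\eta_5,\eta_4\eta_5\eta_6)$, $J=\eta_1^2\eta_2\eta_4^2\eta_5$, $$\tilde k_{1,D}(\eta)=\frac{\beta_{ij}}{|\chi_{t_2}(\mathscr D_2)-\chi_{t_1}(\mathscr D_1)|^{3+2s}}|\det M_{t_1}||\det M_{t_2}|J,$$ where $\beta_{ij}=-\varphi_i(\chi_{t_1}(\mathscr D_1))\varphi_j(\chi_{t_2}(\mathscr D_2))$ if $t_1\subset\mathrm{supp}\,\varphi_i$, $t_2\subset\mathrm{supp}\,\varphi_j$, and $\beta_{ij}=-\varphi_j(\chi_{t_1}(\mathscr D_1))\varphi_i(\chi_{t_2}(\mathscr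 D_2))$ if $t_2\subset\mathrm{supp}\,\varphi_i$, $t_1\subset\mathrm{supp}\,\varphi_j$. **Quadrature error.** For $g:[0,1]^k\to\mathbb C$, $E^n[g]=|I[g]-Q^n[g]|$, where $I[g]=\int_{[0,1]^k}g$ and $Q^n[g]$ is the tensor Gauss quadrature with $n$ points in each of the $k$ dimensions.
   Formalization: In case D the second component of the Duffy points is η1η2(1−η3), resp. η4η5(1−η6), times η1, resp. η4 where due: D_1=(η1,η1η2(1−η3),η1η2η3), likewise D_2, so they lie in the reference tetrahedron; x0 and p may depend on x,y and c_A is uniform over meshes. *)

theory Defs
  imports "HOL-Analysis.Analysis" "HOL-Computational_Algebra.Computational_Algebra"
begin

section \<open>Gauss quadrature on the unit cube\<close>

text \<open>Rodrigues' formula for the Legendre polynomial of degree \<open>n\<close> transported to \<open>[0,1]\<close>: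
  \<open>1/n! * d^n/dx^n (x^2 - x)^n\<close>.\<close>

definition shifted_legendre :: "nat \<Rightarrow> real poly" where
  "shifted_legendre n = smult (1 / fact n) ((pderiv ^^ n) ([:0, -1, 1:] ^ n))"

definition gauss_nodes :: "nat \<Rightarrow> real set" where
  "gauss_nodes n = {x. poly (shifted_legendre n) x = 0}"

text \<open>The weight of the node \<open>x\<close> is the integral of the corresponding Lagrange polynomial.\<close>

definition gauss_weight :: "nat \<Rightarrow> real \<Rightarrow> real" where
  "gauss_weight n x = integral {0..1} (\<lambda>u. \<Prod>y\<in>gauss_nodes n - {x}. (u - y) / (x - y))"

definition gauss_quadrature :: "nat \<Rightarrow> (real^'k \<Rightarrow> 'b::banach) \<Rightarrow> 'b" where
  "gauss_quadrature n g =
     (\<Sum>x | \<forall>l. x $ l \<in> gauss_nodes n. (\<Prod>l\<in>UNIV. gauss_weight n (x $ l)) *\<^sub>R g x)"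

definition quadrature_error :: "nat \<Rightarrow> (real^'k \<Rightarrow> 'b::banach) \<Rightarrow> real" where
  "quadrature_error n g = norm (integral (cbox 0 1) g - gauss_quadrature n g)"


section \<open>Domains and meshes\<close>

text \<open>Bounded, open, connected, and near every boundary point \<open>p\<close> the set is the part of space
  lying below the graph of a Lipschitz function \<open>g\<close> over the plane through \<open>p\<close> with
  normal \<open>\<nu>\<close>.\<close>

definition lipschitz_domain :: "(real^3) set \<Rightarrow> bool" where
  "lipschitz_domain \<Omega> \<longleftrightarrow>
     open \<Omega> \<and> connected \<Omega> \<and> bounded \<Omega> \<and> \<Omega> \<noteq> {} \<and>
     (\<forall>p\<in>frontier \<Omega>. \<exists>r>0. \<exists>\<nu>. \<exists>g. \<exists>L. norm \<nu> = 1 \<and> L-lipschitz_on {z. z \<bullet> \<nu> = 0} g \<and>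
        (\<forall>x\<in>ball p r. x \<in> \<Omega> \<longleftrightarrow>
            (x - p) \<bullet> \<nu> < g ((x - p) - ((x - p) \<bullet> \<nu>) *\<^sub>R \<nu>)))"

text \<open>The elements are closed tetrahedra.\<close>

definition tet_mesh :: "(real^3) set \<Rightarrow> (real^3) set set \<Rightarrow> bool" where
  "tet_mesh \<Omega> \<T> \<longleftrightarrow> triangulation \<T> \<and> (\<forall>t\<in>\<T>. 3 simplex t) \<and> \<Union>\<T> = closure \<Omega>"

definition mesh_size :: "(real^3) set set \<Rightarrow> real" where
  "mesh_size \<T> = (\<Sum>t\<in>\<T>. diameter t) / card \<T>"

definition vec_angle :: "real^3 \<Rightarrow> real^3 \<Rightarrow> real" where
  "vec_angle u w = arccos (u \<bullet> w / (norm u * norm w))"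

definition orth_part :: "real^3 \<Rightarrow> real^3 \<Rightarrow> real^3" where
  "orth_part e w = w - ((w \<bullet> e) / (e \<bullet> e)) *\<^sub>R e"

text \<open>The interior angles of a tetrahedron are the angles of its four triangular faces and the six
  dihedral angles between its faces.  A lower bound for only one of the two kinds would still allow
  slivers, respectively needles.  Whenever a 3-simplex is the convex hull of \<open>{p,q,r,s}\<close>, these
  points are its four distinct vertices.\<close>

definition shape_regular :: "real \<Rightarrow> (real^3) set set \<Rightarrow> bool" where
  "shape_regular \<theta> \<T> \<longleftrightarrow>
     (\<forall>t\<in>\<T>. \<forall>p q r s. t = convex hull {p, q, r, s} \<longrightarrow>
        \<theta> < vec_angle (q - p) (r - p) \<and>
        \<theta> < vec_angle (orth_part (q - p) (r - p)) (orth_part (q - p) (s - p)))"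

definition quasi_uniform :: "real \<Rightarrow> real \<Rightarrow> (real^3) set set \<Rightarrow> bool" where
  "quasi_uniform c1 c2 \<T> \<longleftrightarrow>
     (\<forall>t1\<in>\<T>. \<forall>t2\<in>\<T>. c1 * diameter t1 \<le> diameter t2 \<and> diameter t2 \<le> c2 * diameter t1)"

text \<open>The intermediate points \<open>x0\<close> and \<open>p\<close> in the element, edge and face conditions may depend
  on \<open>x\<close> and \<open>y\<close>: a fixed point \<open>p\<close> of a common edge or face \<open>S\<close> is impossible, since one can
  take \<open>x = y\<close> to be another point of \<open>S\<close>.\<close>

definition geometric_assumption :: "real \<Rightarrow> (real^3) set \<Rightarrow> (real^3) set set \<Rightarrow> bool" where
  "geometric_assumption cA \<Omega> \<T> \<longleftrightarrow>
     (\<forall>t\<in>\<T>. \<forall>x\<in>\<Omega> - t. \<forall>y\<in>t. \<exists>x0\<in>t.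
        cA * (norm (x - x0) + norm (x0 - y)) \<le> norm (x - y)) \<and>
     (\<forall>t1\<in>\<T>. \<forall>t2\<in>\<T>. \<forall>p. t1 \<inter> t2 = {p} \<longrightarrow>
        (\<forall>x\<in>t1. \<forall>y\<in>t2. cA * (norm (x - p) + norm (p - y)) \<le> norm (x - y))) \<and>
     (\<forall>t1\<in>\<T>. \<forall>t2\<in>\<T>. \<forall>S. t1 \<inter> t2 = S \<and> S edge_of t1 \<and> S edge_of t2 \<longrightarrow>
        (\<forall>x\<in>t1. \<forall>y\<in>t2. \<exists>p\<in>S. cA * (norm (x - p) + norm (p - y)) \<le> norm (x - y))) \<and>
     (\<forall>t1\<in>\<T>. \<forall>t2\<in>\<T>. \<forall>S. t1 \<inter> t2 = S \<and> S facet_of t1 \<and> S facet_of t2 \<longrightarrow>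
        (\<forall>x\<in>t1. \<forall>y\<in>t2. \<exists>p\<in>S. cA * (norm (x - p) + norm (p - y)) \<le> norm (x - y)))"


section \<open>Piecewise linear functions\<close>

definition affine_fun :: "(real^3 \<Rightarrow> real) \<Rightarrow> bool" where
  "affine_fun f \<longleftrightarrow> (\<exists>a b. \<forall>x. f x = a \<bullet> x + b)"

definition fe_space :: "(real^3) set \<Rightarrow> (real^3) set set \<Rightarrow> (real^3 \<Rightarrow> real) set" where
  "fe_space \<Omega> \<T> = {u. continuous_on UNIV u \<and> (\<forall>x. x \<notin> \<Omega> \<longrightarrow> u x = 0) \<and>
     (\<forall>t\<in>\<T>. \<exists>f. affine_fun f \<and> (\<forall>x\<in>t. u x = f x))}"

definition inner_nodes :: "(real^3) set \<Rightarrow> (real^3) set set \<Rightarrow> (real^3) set" where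
  "inner_nodes \<Omega> \<T> = {p \<in> \<Omega>. \<exists>t\<in>\<T>. p extreme_point_of t}"

definition nodal_basis ::
  "(real^3) set \<Rightarrow> (real^3) set set \<Rightarrow> nat \<Rightarrow> (nat \<Rightarrow> real^3 \<Rightarrow> real) \<Rightarrow> bool" where
  "nodal_basis \<Omega> \<T> N \<phi> \<longleftrightarrow>
     (\<exists>p. bij_betw p {1..N} (inner_nodes \<Omega> \<T>) \<and>
        (\<forall>i\<in>{1..N}. \<phi> i \<in> fe_space \<Omega> \<T> \<and>
           (\<forall>l\<in>{1..N}. \<phi> i (p l) = (if l = i then 1 else 0))))"

definition support :: "(real^3 \<Rightarrow> real) \<Rightarrow> (real^3) set" where
  "support f = closure {x. f x \<noteq> 0}"


section \<open>Reference map\<close>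

text \<open>The ordered vertices \<open>(a, b, c, d)\<close> of a tetrahedron.\<close>

type_synonym verts = "(real^3) \<times> (real^3) \<times> (real^3) \<times> (real^3)"

fun tet :: "verts \<Rightarrow> (real^3) set" where
  "tet (a, b, c, d) = convex hull {a, b, c, d}"

text \<open>The columns of the matrix are \<open>b - a\<close>, \<open>c - b\<close>, \<open>d - b\<close>.\<close>

fun ref_mat :: "verts \<Rightarrow> real^3^3" where
  "ref_mat (a, b, c, d) = transpose (vector [b - a, c - b, d - b])"

definition ref_map :: "verts \<Rightarrow> real^3 \<Rightarrow> real^3" where
  "ref_map v x = ref_mat v *v x + fst v"

definition affine_ext :: "(real^3 \<Rightarrow> real) \<Rightarrow> (real^3) set \<Rightarrow> real^3 \<Rightarrow> real" where
  "affine_ext f t = (THE g. affine_fun g \<and> (\<forall>x\<in>t. g x = f x))"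

text \<open>Here \<open>f\<close> and \<open>g\<close> stand for the basis functions with indices \<open>i\<close> and \<open>j\<close>; for
  \<open>i = j\<close> the numerator is a square.\<close>

definition kernel1 :: "real \<Rightarrow> (real^3 \<Rightarrow> real) \<Rightarrow> (real^3 \<Rightarrow> real) \<Rightarrow> verts \<Rightarrow> verts \<Rightarrow>
    (real^3) \<times> (real^3) \<Rightarrow> real" where
  "kernel1 s f g v w D =
     (case D of (x, y) \<Rightarrow>
       (affine_ext f (tet v) (ref_map v x) - affine_ext f (tet w) (ref_map w y)) *
       (affine_ext g (tet v) (ref_map v x) - affine_ext g (tet w) (ref_map w y)) /
       norm (ref_map v x - ref_map w y) powr (3 + 2 * s) *
       \<bar>det (ref_mat v)\<bar> * \<bar>det (ref_mat w)\<bar>)"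


section \<open>Regularizing transformations\<close>

text \<open>Each list contains the pairs \<open>(\<D>\<^sub>m \<eta>, J\<^sub>m \<eta>)\<close>.  In the types \<open>real^k\<close> with a numeral
  \<open>k\<close> the index \<open>k\<close> denotes the same component as the index 0, so the components are
  exactly \<open>\<eta>$1, \<dots>, \<eta>$k\<close>.\<close>

type_synonym duffy = "((real^3) \<times> (real^3)) \<times> real"

definition vec3 :: "real \<Rightarrow> real \<Rightarrow> real \<Rightarrow> real^3" where
  "vec3 x y z = vector [x, y, z]"

definition duffy_V :: "real^5 \<Rightarrow> duffy list" where
  "duffy_V \<eta> =
    (let e1 = \<eta>$1; e2 = \<eta>$2; e3 = \<eta>$3; e4 = \<eta>$4; e5 = \<eta>$5;
         D1 = (vec3 1 (e1*e2) (e1*(1-e2)), vec3 e3 (e3*e4*e5) (e3*e4*(1-e5)))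
     in map (\<lambda>D. (D, e1 * e3^2 * e4)) [D1, prod.swap D1])"

definition duffy_E :: "real^4 \<Rightarrow> duffy list" where
  "duffy_E \<eta> =
    (let e1 = \<eta>$1; e2 = \<eta>$2; e3 = \<eta>$3; e4 = \<eta>$4;
         D1 = (vec3 0 e1 (1-e1), vec3 (-e2*e3*e4) (e2*e3*(1-e4)) (e2*(1-e3)));
         D2 = (vec3 0 (e3*e4) (e3*(1-e4)), vec3 (-e1*e2) (e1*(1-e2)) (1-e1));
         J1 = e2^2 * e3;
         J2 = e1 * e3
     in [(D1, J1), (D2, J2), (prod.swap D1, J1), (prod.swap D2, J2)])"

definition duffy_F :: "real^3 \<Rightarrow> duffy list" where
  "duffy_F \<eta> =
    (let e1 = \<eta>$1; e2 = \<eta>$2; e3 = \<eta>$3;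
         Ds = [(vec3 0 e1 (1-e1),                 vec3 (-e1*e2*e3) 0 (e1*e2*(1-e3))),
               (vec3 0 (e1*e2) (e1*(1-e2)),       vec3 (-e1*e2*e3) 0 (1-e1*e2*e3)),
               (vec3 0 (e1*e2) (1-e1*e2),         vec3 (-e1*e2*e3) 0 (e1*(1-e2*e3))),
               (vec3 0 (e1*e2*e3) (e1*e2*(1-e3)), vec3 (-e1) 0 (1-e1)),
               (vec3 0 (e1*e2*e3) (e1*(1-e2*e3)), vec3 (-e1*e2) 0 (1-e1*e2)),
               (vec3 0 (e1*e2*e3) (1-e1*e2*e3),   vec3 (-e1*e2) 0 (e1*(1-e2))),
               (vec3 0 0 1,                       vec3 (-e1*e2*e3) (e1*e2*(1-e3)) (e1*(1-e2)))];
         D15 = (vec3 (-e1*e2*e3) (e1*e2*(1-e3)) (1-e1*e2), vec3 0 0 e1);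
         D16 = (vec3 0 0 e3, vec3 (-e1*e2) (e1*(1-e2)) (1-e1));
         D17 = (vec3 (-e1*e2) (e1*(1-e2)) (1-e1), vec3 0 0 (e1*e3))
     in map (\<lambda>D. (D, e1^2 * e2)) (Ds @ map prod.swap Ds @ [D15])
        @ [(D16, e1), (D17, e1^2)])"

definition duffy_T :: "real^2 \<Rightarrow> duffy list" where
  "duffy_T \<eta> =
    (let e1 = \<eta>$1; e2 = \<eta>$2
     in map (\<lambda>D. (D, e1))
         [(vec3 0 e1 (-e1),             vec3 (-e1*e2) 0 (-1)),
          (vec3 0 1 0,                  vec3 (-e1*e2) 0 (e1*(1-e2))),
          (vec3 0 e1 (-1),              vec3 (-e1*e2) 0 (-e1*e2)),
          (vec3 0 (e1*e2) (-e1*e2),     vec3 (-e1) 0 (-1)),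
          (vec3 0 (e1*e2) (e1*(1-e2)),  vec3 (-1) 0 0),
          (vec3 0 (e1*e2) (-1),         vec3 (-e1) 0 (-e1)),
          (vec3 0 0 0,                  vec3 (-e1*e2) (e1*(1-e2)) (-1)),
          (vec3 0 0 (-1),               vec3 (-e1*e2) (e1*(1-e2)) (-e1)),
          (vec3 0 0 e1,                 vec3 (-e2) (1-e2) 0)])"

definition regularized :: "real \<Rightarrow> (real^3 \<Rightarrow> real) \<Rightarrow> (real^3 \<Rightarrow> real) \<Rightarrow> verts \<Rightarrow> verts \<Rightarrow>
    (real^'k \<Rightarrow> duffy list) \<Rightarrow> real^'k \<Rightarrow> real" where
  "regularized s f g v w Ds \<eta> = (\<Sum>(D, J)\<leftarrow>Ds \<eta>. kernel1 s f g v w D * J)"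

text \<open>Pairs with positive distance.  The map
  \<open>(\<eta>\<^sub>1, \<eta>\<^sub>2, \<eta>\<^sub>3) \<mapsto> (\<eta>\<^sub>1, \<eta>\<^sub>1\<eta>\<^sub>2, \<eta>\<^sub>1\<eta>\<^sub>2\<eta>\<^sub>3)\<close> parametrizes the simplex
  \<open>0 \<le> x\<^sub>3 \<le> x\<^sub>2 \<le> x\<^sub>1 \<le> 1\<close>.  Its second component is reduced by \<open>x\<^sub>3\<close> here, which
  carries that simplex to the reference tetrahedron
  \<open>0 \<le> x\<^sub>1 \<le> 1, 0 \<le> x\<^sub>2 \<le> x\<^sub>1, 0 \<le> x\<^sub>3 \<le> x\<^sub>1 - x\<^sub>2\<close> of \<open>ref_map\<close> and does not change
  the Jacobian \<open>\<eta>\<^sub>1\<^sup>2\<eta>\<^sub>2\<close>.  Without it the points would leave the two tetrahedra.\<close>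

definition duffy_tet :: "real \<Rightarrow> real \<Rightarrow> real \<Rightarrow> real^3" where
  "duffy_tet e1 e2 e3 = vec3 e1 (e1*e2*(1-e3)) (e1*e2*e3)"

definition beta :: "(real^3 \<Rightarrow> real) \<Rightarrow> (real^3 \<Rightarrow> real) \<Rightarrow> verts \<Rightarrow> verts \<Rightarrow>
    real^3 \<Rightarrow> real^3 \<Rightarrow> real" where
  "beta f g v w x y =
    (if tet v \<subseteq> support f \<and> tet w \<subseteq> support g then - f x * g y
     else if tet w \<subseteq> support f \<and> tet v \<subseteq> support g then - g x * f y
     else undefined)"

definition regularized_D :: "real \<Rightarrow> (real^3 \<Rightarrow> real) \<Rightarrow> (real^3 \<Rightarrow> real) \<Rightarrow> verts \<Rightarrow> verts \<Rightarrow>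
    real^6 \<Rightarrow> real" where
  "regularized_D s f g v w \<eta> =
    (let x = ref_map v (duffy_tet (\<eta>$1) (\<eta>$2) (\<eta>$3));
         y = ref_map w (duffy_tet (\<eta>$4) (\<eta>$5) (\<eta>$6));
         J = (\<eta>$1)^2 * \<eta>$2 * (\<eta>$4)^2 * \<eta>$5
     in beta f g v w x y / norm (y - x) powr (3 + 2 * s) *
        \<bar>det (ref_mat v)\<bar> * \<bar>det (ref_mat w)\<bar> * J)"


section \<open>Pairs of tetrahedra\<close>

datatype pair_kind = Distant | Common_Vertex | Common_Edge | Common_Face | Identical

text \<open>The vertices are ordered such that the common ones come first, in the same order.\<close>

fun ordered_pair :: "pair_kind \<Rightarrow> verts \<Rightarrow> verts \<Rightarrow> bool" where
  "ordered_pair Distant v w \<longleftrightarrow> setdist (tet v) (tet w) > 0"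
| "ordered_pair Common_Vertex (a, b, c, d) (a', b', c', d') \<longleftrightarrow>
     a = a' \<and> tet (a, b, c, d) \<inter> tet (a', b', c', d') = {a}"
| "ordered_pair Common_Edge (a, b, c, d) (a', b', c', d') \<longleftrightarrow>
     a = a' \<and> b = b' \<and> tet (a, b, c, d) \<inter> tet (a', b', c', d') = convex hull {a, b}"
| "ordered_pair Common_Face (a, b, c, d) (a', b', c', d') \<longleftrightarrow>
     a = a' \<and> b = b' \<and> c = c' \<and>
     tet (a, b, c, d) \<inter> tet (a', b', c', d') = convex hull {a, b, c}"
| "ordered_pair Identical v w \<longleftrightarrow> v = w"

text \<open>The additional requirements on distant pairs: the distance is comparable to the mesh size
  \<open>h\<close>, and one of the two cases in the definition of \<open>beta\<close> applies.\<close>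

definition distant_cond :: "real \<Rightarrow> real \<Rightarrow> real \<Rightarrow> (real^3 \<Rightarrow> real) \<Rightarrow> (real^3 \<Rightarrow> real) \<Rightarrow>
    verts \<Rightarrow> verts \<Rightarrow> bool" where
  "distant_cond c3 c4 h f g v w \<longleftrightarrow>
     c3 * h \<le> setdist (tet v) (tet w) \<and> setdist (tet v) (tet w) \<le> c4 * h \<and>
     (tet v \<subseteq> support f \<and> tet w \<subseteq> support g \<or> tet w \<subseteq> support f \<and> tet v \<subseteq> support g)"

definition pair_error :: "pair_kind \<Rightarrow> real \<Rightarrow> (real^3 \<Rightarrow> real) \<Rightarrow> (real^3 \<Rightarrow> real) \<Rightarrow>
    verts \<Rightarrow> verts \<Rightarrow> nat \<Rightarrow> real" where
  "pair_error k s f g v w n =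
    (case k of
       Distant \<Rightarrow> quadrature_error n (regularized_D s f g v w)
     | Common_Vertex \<Rightarrow> quadrature_error n (regularized s f g v w duffy_V)
     | Common_Edge \<Rightarrow> quadrature_error n (regularized s f g v w duffy_E)
     | Common_Face \<Rightarrow> quadrature_error n (regularized s f g v w duffy_F)
     | Identical \<Rightarrow> quadrature_error n (regularized s f g v w duffy_T))"

end

(*
  Every integrand is a finite sum of terms P q^(-a) with a = (3 + 2s)/2, where P and the squared distance
  q of the two image points are polynomials in eta on the unit cube. Shape regularity bounds the heights
  of a tetrahedron from below, and together with the geometric assumption this gives
  m h^2 <= q <= M h^2 with m, M > 0 independent of the mesh, while P = O(h^6). Since
  1 - q / (2 M h^2) lies in an interval [0, r] with r < 1, the truncated binomial series of
  q^(-a) = (2 M h^2)^(-a) (1 - (1 - q / (2 M h^2)))^(-a) approximates each term by polynomials with an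
  error that decays geometrically in the degree. Tensor Gauss quadrature with n points is exact for degree
  2n - 1 in each variable and has nonnegative weights with sum 1, so its error is at most twice the
  uniform error of the approximation.
*)
theory Submission
  imports Defs
begin

no_notation fps_nth (infixl \<open>$\<close> 75)

section \<open>Gauss quadrature in one dimension\<close>

text \<open>The constants do not depend on the mesh because of the order of choice: the
  approximation lemma fixes its constant and its rate before q, P and h are known, from m, M, a
  degree bound and the exponent alone. If r < 1 is the rate per degree, degree 2n - 1 gives r^(2n)
  up to a factor, so \<rho> = 1/(2r) exceeds 1/2. The obstacle is the lower bound for q when the
  elements touch. The transformed arguments always keep some combination of barycentric coordinates
  at least 1, and heights turn this into a length. A height is at least sin(\<theta>)^4 times the
  diameter: two factors compare edges, one leads from an edge to the distance from a line, one from
  there to the height. The angle bounds are one-sided, so the last two steps need a non-obtuse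
  angle, which has to be found. The geometric assumption then replaces the segment between two
  elements by a detour through a common point, and each leg is measured in the coordinates of a
  single element.\<close>

lemma Rolle_finite_roots:
  fixes p :: "real poly"
  assumes "finite S" "card S = Suc m" "\<And>x. x \<in> S \<Longrightarrow> poly p x = 0"
  shows "\<exists>S'. finite S' \<and> card S' = m \<and> (\<forall>x\<in>S'. poly (pderiv p) x = 0 \<and> Min S < x \<and> x < Max S)"
  using assms
proof (induction m arbitrary: S)
  case 0
  then show ?case by (intro exI[of _ "{}"]) auto
next
  case (Suc m)
  \<comment> \<open>The zeros supplied for \<open>S1\<close> lie below \<open>Max S1\<close>, so the
    one found between \<open>Max S1\<close> and \<open>Max S\<close> is automatically new.\<close>
  define S1 where "S1 = S - {Max S}"
  have ne: "S \<noteq> {}" using Suc.prems by auto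
  have mem: "Max S \<in> S" using Suc.prems ne by simp
  have c1: "finite S1" "card S1 = Suc m" using Suc.prems mem by (auto simp: S1_def)
  have ne1: "S1 \<noteq> {}" using c1 by auto
  obtain S' where S': "finite S'" "card S' = m"
    "\<forall>x\<in>S'. poly (pderiv p) x = 0 \<and> Min S1 < x \<and> x < Max S1"
    using Suc.IH[OF c1] Suc.prems(3) by (auto simp: S1_def)
  have mem1: "Max S1 \<in> S1" using c1 ne1 by simp
  have lt: "Max S1 < Max S"
    using mem1 Suc.prems(1) Max_ge[of S "Max S1"] by (auto simp: S1_def order_less_le)
  have minle: "Min S \<le> Min S1"
    using Suc.prems(1) ne1 by (intro Min_antimono) (auto simp: S1_def)
  have minmax: "Min S1 \<le> Max S1" using c1 ne1 by simp
  have "poly p (Max S1) = poly p (Max S)"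
    using Suc.prems(3) mem mem1 by (simp add: S1_def)
  moreover have "continuous_on {Max S1..Max S} (poly p)"
    by (intro continuous_at_imp_continuous_on ballI poly_isCont)
  ultimately obtain z where z: "Max S1 < z" "z < Max S" "(poly p has_real_derivative 0) (at z)"
    using Rolle[OF lt, of "poly p"] by auto
  have "poly (pderiv p) z = 0"
    using DERIV_unique[OF z(3) poly_DERIV] by simp
  moreover have "z \<notin> S'" using S' z by force
  ultimately show ?case
    using S' z lt minle minmax
    by (intro exI[of _ "insert z S'"]) (use order_le_less_trans order_less_trans in \<open>force\<close>)
qed

section \<open>Zeros of the Legendre polynomials\<close>

lemma power_dvd_pderiv:
  fixes p f :: "'a::idom poly"
  assumes "p ^ Suc m dvd f"
  shows "p ^ m dvd pderiv f"
proof -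
  obtain g where "f = p ^ Suc m * g" using assms by (elim dvdE)
  then have "pderiv f = p ^ m * (p * pderiv g + g * smult (of_nat (Suc m)) (pderiv p))"
    by (simp add: pderiv_mult pderiv_power_Suc algebra_simps del: of_nat_Suc power_Suc)
       (simp add: algebra_simps)
  then show ?thesis by simp
qed

lemma power_dvd_higher_pderiv:
  fixes p f :: "'a::idom poly"
  assumes "p ^ n dvd f" "k \<le> n"
  shows "p ^ (n - k) dvd (pderiv ^^ k) f"
  using assms(2)
proof (induction k)
  case 0
  then show ?case using assms by simp
next
  case (Suc k)
  then show ?case by (auto intro!: power_dvd_pderiv simp: Suc_diff_Suc)
qed

text \<open>The polynomial of Rodrigues' formula before differentiation; zeros and boundary values
  of its lower derivatives are needed as well.\<close>

definition legendre_base :: "nat \<Rightarrow> real poly" where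
  "legendre_base n = [:0, -1, 1:] ^ n"

text \<open>Each differentiation costs at most one factor x^2 - x, so for k < n one factor is left.
  This removes the boundary terms in the orthogonality proof and supplies two extra zeros for
  Rolle's theorem.\<close>

lemma higher_pderiv_legendre_base_endpoints:
  assumes "k < n"
  shows "poly ((pderiv ^^ k) (legendre_base n)) 0 = 0" "poly ((pderiv ^^ k) (legendre_base n)) 1 = 0"
proof -
  let ?b = "[:0, -1, 1:] :: real poly"
  have "?b dvd ?b ^ (n - k)" using assms by (simp add: dvd_power)
  moreover have "?b ^ (n - k) dvd (pderiv ^^ k) (legendre_base n)"
    using assms by (intro power_dvd_higher_pderiv) (auto simp: legendre_base_def)
  ultimately obtain g where "(pderiv ^^ k) (legendre_base n) = ?b * g" by (meson dvdE dvd_trans)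
  then show "poly ((pderiv ^^ k) (legendre_base n)) 0 = 0"
    "poly ((pderiv ^^ k) (legendre_base n)) 1 = 0" by auto
qed

text \<open>For k < n the two endpoints join the k interior zeros, and Rolle's theorem on these k +
  2 points yields k + 1 interior zeros of the next derivative.\<close>

lemma higher_pderiv_legendre_base_roots:
  "k \<le> n \<Longrightarrow> \<exists>S. finite S \<and> card S = k \<and>
     (\<forall>x\<in>S. poly ((pderiv ^^ k) (legendre_base n)) x = 0 \<and> 0 < x \<and> x < 1)"
proof (induction k)
  case 0
  show ?case by (intro exI[of _ "{}"]) auto
next
  case (Suc k)
  then obtain S where S: "finite S" "card S = k"
    "\<forall>x\<in>S. poly ((pderiv ^^ k) (legendre_base n)) x = 0 \<and> 0 < x \<and> x < 1" by auto
  let ?S = "insert 0 (insert 1 S)"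
  have card: "card ?S = Suc (Suc k)" using S by (auto simp: card_insert_if)
  have "Min ?S = 0" "Max ?S = 1" using S by (intro Min_eqI Max_eqI; force)+
  moreover have "\<exists>S'. finite S' \<and> card S' = Suc k \<and>
     (\<forall>x\<in>S'. poly (pderiv ((pderiv ^^ k) (legendre_base n))) x = 0 \<and> Min ?S < x \<and> x < Max ?S)"
    using S card higher_pderiv_legendre_base_endpoints[of k n] Suc.prems
    by (intro Rolle_finite_roots) auto
  ultimately show ?case by simp
qed

lemma degree_higher_pderiv:
  fixes p :: "'a::{comm_semiring_1,semiring_no_zero_divisors,semiring_char_0} poly"
  shows "degree ((pderiv ^^ k) p) = degree p - k"
  by (induction k) (auto simp: degree_pderiv)

lemma degree_shifted_legendre: "degree (shifted_legendre n) = n"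
proof -
  have "degree ([:0, -1, 1:] ^ n :: real poly) = 2 * n" by (simp add: degree_power_eq)
  then show ?thesis by (simp add: shifted_legendre_def degree_higher_pderiv)
qed

lemma shifted_legendre_nonzero: "shifted_legendre n \<noteq> 0"
proof (cases "n = 0")
  case True
  then show ?thesis by (simp add: shifted_legendre_def)
next
  case False
  then show ?thesis using degree_shifted_legendre[of n] by auto
qed

text \<open>Repeated use of Rolle's theorem yields n distinct zeros in the open interval, and degree
  n allows no more, so these are all.\<close>

lemma gauss_nodes:
  shows finite_gauss_nodes: "finite (gauss_nodes n)"
    and card_gauss_nodes: "card (gauss_nodes n) = n"
    and gauss_nodes_bounds: "x \<in> gauss_nodes n \<Longrightarrow> 0 < x \<and> x < 1"
proof -
  show fin: "finite (gauss_nodes n)"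
    using poly_roots_finite[OF shifted_legendre_nonzero] by (simp add: gauss_nodes_def)
  obtain S where S: "finite S" "card S = n"
     "\<forall>x\<in>S. poly ((pderiv ^^ n) (legendre_base n)) x = 0 \<and> 0 < x \<and> x < 1"
    using higher_pderiv_legendre_base_roots[of n n] by auto
  have sub: "S \<subseteq> gauss_nodes n"
    using S(3) by (auto simp: gauss_nodes_def shifted_legendre_def legendre_base_def)
  have le: "card (gauss_nodes n) \<le> n"
    using card_poly_roots_bound[OF shifted_legendre_nonzero, of n]
    by (simp add: gauss_nodes_def degree_shifted_legendre)
  have eq: "S = gauss_nodes n"
    using card_seteq[OF fin sub] S(2) le by simp
  show "card (gauss_nodes n) = n" using S eq by simp
  show "0 < x \<and> x < 1" if "x \<in> gauss_nodes n" using that S eq by auto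
qed

section \<open>Orthogonality of the Legendre polynomials\<close>

lemma poly_integrable_on [simp]: "poly p integrable_on {a..b::real}"
  by (intro integrable_continuous_interval continuous_intros)

lemma poly_by_parts:
  fixes p q :: "real poly"
  assumes "a \<le> b" "poly p a = 0" "poly p b = 0"
  shows "integral {a..b} (poly (pderiv p * q)) = - integral {a..b} (poly (p * pderiv q))"
proof -
  have "((\<lambda>x. poly (pderiv (p * q)) x) has_integral (poly (p * q) b - poly (p * q) a)) {a..b}"
    by (intro fundamental_theorem_of_calculus assms)
       (metis DERIV_subset has_real_derivative_iff_has_vector_derivative poly_DERIV subset_UNIV)
  then have "integral {a..b} (\<lambda>x. poly (pderiv p * q) x + poly (p * pderiv q) x) = 0"
    using assms by (intro integral_unique) (simp add: pderiv_mult algebra_simps)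
  moreover have "integral {a..b} (\<lambda>x. poly (pderiv p * q) x + poly (p * pderiv q) x)
     = integral {a..b} (poly (pderiv p * q)) + integral {a..b} (poly (p * pderiv q))"
    by (intro Henstock_Kurzweil_Integration.integral_add poly_integrable_on)
  ultimately show ?thesis by simp
qed

text \<open>Integrating by parts n times moves all derivatives onto \<open>q\<close>, whose n-th
  derivative is zero. Only derivatives of \<open>legendre_base n\<close> of order below n are
  evaluated at the endpoints, so no boundary term survives.\<close>

lemma shifted_legendre_orthogonal:
  assumes "degree q < n"
  shows "integral {0..1} (poly (shifted_legendre n * q)) = 0"
proof -
  have step: "k \<le> n \<Longrightarrow> integral {0..1} (poly ((pderiv ^^ n) (legendre_base n) * q)) =
     (-1) ^ k * integral {0..1} (poly ((pderiv ^^ (n - k)) (legendre_base n) * (pderiv ^^ k) q))" for k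
  proof (induction k)
    case (Suc k)
    have "integral {0..1} (poly (pderiv ((pderiv ^^ (n - Suc k)) (legendre_base n)) * (pderiv ^^ k) q))
      = - integral {0..1} (poly ((pderiv ^^ (n - Suc k)) (legendre_base n) * pderiv ((pderiv ^^ k) q)))"
      using Suc.prems by (intro poly_by_parts higher_pderiv_legendre_base_endpoints) auto
    moreover have "pderiv ((pderiv ^^ (n - Suc k)) (legendre_base n)) = (pderiv ^^ (n - k)) (legendre_base n)"
      using Suc.prems by (simp flip: funpow.simps(2) o_apply[of pderiv] add: Suc_diff_Suc del: funpow.simps)
    ultimately have "integral {0..1} (poly ((pderiv ^^ (n - k)) (legendre_base n) * (pderiv ^^ k) q))
      = - integral {0..1} (poly ((pderiv ^^ (n - Suc k)) (legendre_base n) * (pderiv ^^ Suc k) q))"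
      by simp
    then show ?case using Suc by (simp only: Suc_leD power_Suc)
  qed simp
  have "degree ((pderiv ^^ (n - 1)) q) = 0" using assms by (simp add: degree_higher_pderiv)
  then have "pderiv ((pderiv ^^ (n - 1)) q) = 0" by (simp add: pderiv_eq_0_iff)
  then have "(pderiv ^^ n) q = 0" using assms
    by (metis Suc_diff_1 funpow.simps(2) less_nat_zero_code neq0_conv o_apply)
  then have "integral {0..1} (poly ((pderiv ^^ n) (legendre_base n) * q)) = 0"
    using step[of n] by (simp add: poly_0[abs_def])
  moreover have "poly (shifted_legendre n * q) =
      (\<lambda>x. (1 / fact n) * poly ((pderiv ^^ n) (legendre_base n) * q) x)"
    by (auto simp: shifted_legendre_def legendre_base_def)
  ultimately show ?thesis by (simp only: integral_mult_right mult_zero_right)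
qed

section \<open>Lagrange interpolation at the nodes; exactness and positivity of Gauss
  quadrature\<close>

definition node_poly :: "nat \<Rightarrow> real \<Rightarrow> real poly" where
  "node_poly n x = (\<Prod>y\<in>gauss_nodes n - {x}. smult (1 / (x - y)) [:- y, 1:])"

lemma poly_node_poly: "poly (node_poly n x) u = (\<Prod>y\<in>gauss_nodes n - {x}. (u - y) / (x - y))"
  by (simp add: node_poly_def poly_prod diff_divide_distrib)

lemma node_poly_node:
  assumes "x \<in> gauss_nodes n" "z \<in> gauss_nodes n"
  shows "poly (node_poly n x) z = (if z = x then 1 else 0)"
  using assms finite_gauss_nodes[of n] by (auto simp: poly_node_poly)

lemma degree_node_poly:
  assumes "x \<in> gauss_nodes n"
  shows "degree (node_poly n x) \<le> n - 1"
proof -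
  have "degree (node_poly n x) \<le> (\<Sum>y\<in>gauss_nodes n - {x}. degree (smult (1 / (x - y)) [:- y, 1:]))"
    unfolding node_poly_def by (rule degree_prod_sum_le[unfolded o_def]) (simp add: finite_gauss_nodes)
  also have "\<dots> \<le> (\<Sum>y\<in>gauss_nodes n - {x}. 1)" by (intro sum_mono) auto
  also have "\<dots> = n - 1" using assms by (simp add: card_gauss_nodes finite_gauss_nodes)
  finally show ?thesis .
qed

lemma gauss_weight_eq: "gauss_weight n x = integral {0..1} (poly (node_poly n x))"
  by (simp add: gauss_weight_def poly_node_poly[abs_def])

text \<open>Otherwise the difference would be a nonzero polynomial of degree below n with n
  zeros.\<close>

lemma lagrange_interpolation:
  assumes "degree r < n"
  shows "r = (\<Sum>x\<in>gauss_nodes n. smult (poly r x) (node_poly n x))" (is "r = ?s")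
proof (rule ccontr)
  assume ne: "r \<noteq> ?s"
  have "degree ?s \<le> n - 1"
    by (intro degree_sum_le finite_gauss_nodes) (meson degree_node_poly degree_smult_le le_trans)
  then have "degree (r - ?s) < n" using assms degree_diff_le[of r "n - 1" ?s] by linarith
  moreover have "poly (r - ?s) z = 0" if "z \<in> gauss_nodes n" for z
    using that finite_gauss_nodes[of n] by (simp add: poly_sum node_poly_node if_distrib cong: if_cong)
  then have "gauss_nodes n \<subseteq> {z. poly (r - ?s) z = 0}" by blast
  then have "n \<le> degree (r - ?s)"
    using card_mono[of "{z. poly (r - ?s) z = 0}" "gauss_nodes n"] card_poly_roots_bound[of "r - ?s"]
      poly_roots_finite[of "r - ?s"] ne card_gauss_nodes[of n] by auto
  ultimately show False by simp
qed

text \<open>Division by the Legendre polynomial leaves a quotient and a remainder of degree below n.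
  The multiple of the Legendre polynomial has integral zero by orthogonality and vanishes at the
  nodes; the remainder is its own interpolant.\<close>

lemma gauss_exact:
  assumes "degree f \<le> 2 * n - 1" "n \<ge> 1"
  shows "integral {0..1} (poly f) = (\<Sum>x\<in>gauss_nodes n. gauss_weight n x * poly f x)"
proof -
  let ?P = "shifted_legendre n"
  define q r where "q = f div ?P" and "r = f mod ?P"
  have f: "f = ?P * q + r" by (simp add: q_def r_def)
  have r: "degree r < n"
    using degree_mod_less_degree[of ?P f] degree_mod_less'[of ?P f] assms degree_shifted_legendre[of n]
      shifted_legendre_nonzero[of n] by (cases "r = 0") (auto simp: r_def)
  have q: "degree q < n"
  proof (cases "q = 0")
    case False
    then have "n + degree q = degree (f - r)"
      using shifted_legendre_nonzero by (simp add: f degree_mult_eq degree_shifted_legendre)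
    also have "\<dots> \<le> 2 * n - 1" using assms r by (intro degree_diff_le) auto
    finally show ?thesis using assms by linarith
  qed (use assms in simp)
  have on_nodes: "poly f x = poly r x" if "x \<in> gauss_nodes n" for x
    using that by (simp add: f gauss_nodes_def)
  have "integral {0..1} (poly f) = integral {0..1} (\<lambda>x. poly (?P * q) x + poly r x)"
    by (subst f) (simp add: poly_add[abs_def])
  also have "\<dots> = integral {0..1} (poly (?P * q)) + integral {0..1} (poly r)"
    by (intro Henstock_Kurzweil_Integration.integral_add poly_integrable_on)
  also have "\<dots> = integral {0..1} (poly r)" by (simp only: shifted_legendre_orthogonal[OF q])
  also have "poly r = (\<lambda>u. \<Sum>x\<in>gauss_nodes n. poly r x * poly (node_poly n x) u)"
    by (subst lagrange_interpolation[OF r]) (auto simp: poly_sum)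
  also have "integral {0..1} \<dots> = (\<Sum>x\<in>gauss_nodes n. poly r x * gauss_weight n x)"
    by (subst integral_sum)
       (auto simp: finite_gauss_nodes gauss_weight_eq intro!: integrable_continuous_interval continuous_intros)
  finally show ?thesis using on_nodes by (simp add: mult.commute)
qed

text \<open>The square of a Lagrange polynomial has degree at most 2n - 2, so quadrature is exact
  for it, and the sum reduces to the single weight of \<open>x\<close>.\<close>

lemma gauss_weight_nonneg:
  assumes "x \<in> gauss_nodes n"
  shows "gauss_weight n x \<ge> 0"
proof -
  have n: "n \<ge> 1" using assms card_gauss_nodes[of n] finite_gauss_nodes[of n] by (cases n) auto
  have "degree (node_poly n x ^ 2) \<le> 2 * (n - 1)"
    using degree_power_le[of "node_poly n x" 2] degree_node_poly[OF assms] by linarith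
  then have "integral {0..1} (poly (node_poly n x ^ 2)) =
      (\<Sum>z\<in>gauss_nodes n. gauss_weight n z * poly (node_poly n x ^ 2) z)"
    by (intro gauss_exact n) linarith
  also have "\<dots> = gauss_weight n x"
    using assms finite_gauss_nodes[of n] by (simp add: node_poly_node if_distrib if_distribR cong: if_cong)
  finally have "gauss_weight n x = integral {0..1} (poly (node_poly n x ^ 2))" by simp
  moreover have "integral {0..1} (poly (node_poly n x ^ 2)) \<ge> 0"
    by (intro integral_nonneg) auto
  ultimately show ?thesis by simp
qed

lemma sum_gauss_weight:
  assumes "n \<ge> 1"
  shows "(\<Sum>x\<in>gauss_nodes n. gauss_weight n x) = 1"
proof -
  have "integral {0..1} (poly (1 :: real poly)) = (1 :: real)" by (simp add: poly_1[abs_def])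
  then show ?thesis using gauss_exact[of 1 n] assms by simp
qed

section \<open>Tensor polynomials and tensor quadrature\<close>

text \<open>\<open>d\<close> bounds the degree in each variable separately, the notion that fits
  tensor quadrature. Being generated by monomials and sums, it reduces additive statements to
  monomials.\<close>

inductive tensor_poly :: "nat \<Rightarrow> (real^'k \<Rightarrow> real) \<Rightarrow> bool" for d where
  monom: "(\<And>l. a l \<le> d) \<Longrightarrow> tensor_poly d (\<lambda>x. c * (\<Prod>l\<in>UNIV. (x $ l) ^ a l))"
| add: "tensor_poly d f \<Longrightarrow> tensor_poly d g \<Longrightarrow> tensor_poly d (\<lambda>x. f x + g x)"

lemma tensor_poly_mono:
  assumes "tensor_poly d f" "d \<le> e"
  shows "tensor_poly e f"
  using assms(1)
proof induction
  case (monom a c)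
  then show ?case using assms(2) by (intro tensor_poly.monom) (meson le_trans)
qed (intro tensor_poly.add)

lemma tensor_poly_mult:
  assumes "tensor_poly d f" "tensor_poly e g"
  shows "tensor_poly (d + e) (\<lambda>x. f x * g x)"
  using assms(1)
proof induction
  case (monom a c)
  show ?case using assms(2)
  proof induction
    case (monom b c')
    have "tensor_poly (d + e) (\<lambda>x::real^'a. (c * c') * (\<Prod>l\<in>UNIV. (x $ l) ^ (a l + b l)))"
      using monom \<open>\<And>l. a l \<le> d\<close> by (intro tensor_poly.monom add_mono) auto
    then show ?case by (simp add: power_add prod.distrib mult_ac)
  next
    case (add f g)
    then show ?case using tensor_poly.add by (simp add: distrib_left)
  qed
next
  case (add f g)
  then show ?case using tensor_poly.add by (simp add: distrib_right)
qed

lemma tensor_poly_const [intro]: "tensor_poly d (\<lambda>x. c)"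
  using tensor_poly.monom[of "\<lambda>_. 0" d c] by simp

lemma tensor_poly_coord: "1 \<le> d \<Longrightarrow> tensor_poly d (\<lambda>x. x $ l)"
  using tensor_poly.monom[of "\<lambda>j. if j = l then 1 else 0" d 1]
  by (simp add: if_distrib[of "\<lambda>k. _ ^ k"] cong: if_cong)

lemma tensor_poly_cmult: "tensor_poly d f \<Longrightarrow> tensor_poly d (\<lambda>x. c * f x)"
  using tensor_poly_mult[OF tensor_poly_const[of 0 c]] by simp

lemma tensor_poly_minus: "tensor_poly d f \<Longrightarrow> tensor_poly d (\<lambda>x. - f x)"
  using tensor_poly_cmult[of d f "-1"] by simp

lemma tensor_poly_diff: "tensor_poly d f \<Longrightarrow> tensor_poly d g \<Longrightarrow> tensor_poly d (\<lambda>x. f x - g x)"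
  using tensor_poly.add[OF _ tensor_poly_minus] by fastforce

lemma tensor_poly_sum:
  assumes "\<And>i. i \<in> I \<Longrightarrow> tensor_poly d (f i)"
  shows "tensor_poly d (\<lambda>x. \<Sum>i\<in>I. f i x)"
  using assms by (induction I rule: infinite_finite_induct) (auto intro: tensor_poly.add)

lemma tensor_poly_power:
  assumes "tensor_poly d f"
  shows "tensor_poly (d * j) (\<lambda>x. f x ^ j)"
proof (induction j)
  case (Suc j)
  then show ?case using tensor_poly_mult[OF assms] by simp
qed auto

lemma continuous_on_tensor_poly: "tensor_poly d f \<Longrightarrow> continuous_on S f"
  by (induction rule: tensor_poly.induct) (auto intro!: continuous_intros)

section \<open>Integration and quadrature over the unit cube\<close>

lemma cbox_01_iff: "x \<in> cbox 0 (1 :: real^'k) \<longleftrightarrow> (\<forall>l. 0 \<le> x $ l \<and> x $ l \<le> 1)"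
  by (simp add: mem_box_cart)

lemma integral_unit_cube_prod:
  fixes f :: "'k::finite \<Rightarrow> real \<Rightarrow> real"
  assumes cont: "\<And>l. continuous_on {0..1} (f l)"
  shows "integral (cbox 0 1) (\<lambda>x::real^'k. \<Prod>l\<in>UNIV. f l (x $ l)) = (\<Prod>l\<in>UNIV. integral {0..1} (f l))"
proof -
  let ?F = "\<lambda>x::real^'k. \<Prod>l\<in>UNIV. f l (x $ l)"
  define h where "h l u = indicator {0..1} u *\<^sub>R f l u" for l u
  have inth: "integrable lborel (h l)" for l
    unfolding h_def by (rule borel_integrable_compact) (auto simp: cont)
  have "continuous_on (cbox 0 1) ?F"
    by (intro continuous_on_prod continuous_on_compose2[OF cont] continuous_intros)
       (auto simp: cbox_01_iff)
  then have int: "integrable lborel (\<lambda>x. indicator (cbox 0 1) x *\<^sub>R ?F x)"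
    by (intro borel_integrable_compact) auto
  \<comment> \<open>The extension by zero is still a product of one-variable functions: outside the
    cube at least one factor vanishes.\<close>
  have ind: "indicator (cbox 0 1) x *\<^sub>R ?F x = (\<Prod>l\<in>UNIV. h l (x $ l))" for x :: "real^'k"
  proof (cases "x \<in> cbox 0 1")
    case True
    then show ?thesis by (simp add: h_def cbox_01_iff)
  next
    case False
    then obtain l where "x $ l \<notin> {0..1}" by (auto simp: cbox_01_iff)
    then have "h l (x $ l) = 0" by (simp add: h_def)
    then have "(\<Prod>l\<in>UNIV. h l (x $ l)) = 0" by (intro prod_zero) auto
    then show ?thesis using False by simp
  qed
  have int_h: "(\<integral>u. h l u \<partial>lborel) = integral {0..1} (f l)" for l
    using set_borel_integral_eq_integral(2)[of "{0..1}" "f l"] inth[of l]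
    by (simp add: set_integrable_def set_lebesgue_integral_def h_def[abs_def])
  \<comment> \<open>Lebesgue measure is the image of a product measure indexed by
    \<open>Basis\<close>; \<open>ix\<close> recovers the coordinate from a basis vector, so that
    products over coordinates become products over \<open>Basis\<close>.\<close>
  define ix where "ix b = (THE l. axis l 1 = b)" for b :: "real^'k"
  have ix: "ix (axis l 1) = l" for l by (auto simp: ix_def axis_eq_axis)
  have Basis: "(Basis :: (real^'k) set) = (\<lambda>l. axis l 1) ` UNIV"
    by (auto simp: Basis_vec_def)
  have inj: "inj (\<lambda>l. axis l 1 :: real^'k)" by (auto simp: inj_on_def axis_eq_axis)
  have reindex: "(\<Prod>l\<in>UNIV. g l (axis l 1)) = (\<Prod>b\<in>Basis. g (ix b) b)"
    for g :: "'k \<Rightarrow> real^'k \<Rightarrow> real"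
    unfolding Basis by (simp add: prod.reindex[OF inj] ix)
  have basis: "(\<Prod>l\<in>UNIV. h l (x $ l)) = (\<Prod>b\<in>Basis. h (ix b) (x \<bullet> b))" for x :: "real^'k"
    using reindex[of "\<lambda>l b. h l (x \<bullet> b)"] by (simp add: inner_axis)
  interpret product_sigma_finite "\<lambda>_::real^'k. lborel :: real measure" ..
  have "integral (cbox 0 1) ?F = (\<integral>x. indicator (cbox 0 1) x *\<^sub>R ?F x \<partial>lborel)"
    using set_borel_integral_eq_integral(2)[of "cbox 0 1" ?F] int
    by (simp add: set_integrable_def set_lebesgue_integral_def)
  also have "\<dots> = (\<integral>x. (\<Prod>b\<in>Basis. h (ix b) (x \<bullet> b)) \<partial>(lborel :: (real^'k) measure))"
    unfolding ind basis ..
  also have "\<dots> = (\<integral>y. (\<Prod>b\<in>Basis. h (ix b) ((\<Sum>b\<in>Basis. y b *\<^sub>R b) \<bullet> b))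
      \<partial>(\<Pi>\<^sub>M b\<in>(Basis :: (real^'k) set). lborel))"
    by (subst lborel_eq, subst integral_distr) (use inth[THEN borel_measurable_integrable] in measurable)
  also have "\<dots> = (\<integral>y. (\<Prod>b\<in>Basis. h (ix b) (y b)) \<partial>(\<Pi>\<^sub>M b\<in>(Basis :: (real^'k) set). lborel))"
    by (intro Bochner_Integration.integral_cong prod.cong) auto
  also have "\<dots> = (\<Prod>b\<in>(Basis :: (real^'k) set). \<integral>u. h (ix b) u \<partial>lborel)"
    by (rule product_integral_prod) (auto intro: inth)
  also have "\<dots> = (\<Prod>l\<in>UNIV. \<integral>u. h l u \<partial>lborel)"
    using reindex[of "\<lambda>l _. \<integral>u. h l u \<partial>lborel"] by simp
  also have "\<dots> = (\<Prod>l\<in>UNIV. integral {0..1} (f l))"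
    by (simp only: int_h)
  finally show ?thesis .
qed

lemma sum_grid_prod:
  "(\<Sum>x | \<forall>l. x $ l \<in> gauss_nodes n. \<Prod>l\<in>UNIV. w l (x $ l)) =
     (\<Prod>l\<in>(UNIV::'k::finite set). \<Sum>u\<in>gauss_nodes n. (w l u :: real))"
proof -
  let ?G = "{x::real^'k. \<forall>l. x $ l \<in> gauss_nodes n}"
  have bij: "bij_betw vec_lambda (PiE UNIV (\<lambda>_::'k. gauss_nodes n)) ?G"
    by (rule bij_betwI[where g = vec_nth]) (auto simp: PiE_def Pi_def)
  have "(\<Sum>x\<in>?G. \<Prod>l\<in>UNIV. w l (x $ l)) =
      (\<Sum>g\<in>PiE UNIV (\<lambda>_::'k. gauss_nodes n). \<Prod>l\<in>UNIV. w l (g l))"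
    using sum.reindex_bij_betw[OF bij, of "\<lambda>x. \<Prod>l\<in>UNIV. w l (x $ l)"] by simp
  also have "\<dots> = (\<Prod>l\<in>UNIV. \<Sum>u\<in>gauss_nodes n. w l u)"
    by (rule prod_sum_PiE[symmetric]) (auto simp: finite_gauss_nodes)
  finally show "(\<Sum>x\<in>?G. \<Prod>l\<in>UNIV. w l (x $ l)) = (\<Prod>l\<in>UNIV. \<Sum>u\<in>gauss_nodes n. w l u)" .
qed

lemma gauss_quadrature_add:
  "gauss_quadrature n (\<lambda>x. f x + g x) = gauss_quadrature n f + gauss_quadrature n g"
  by (simp add: gauss_quadrature_def scaleR_add_right sum.distrib)

text \<open>On a monomial the integral and the quadrature sum both factor into one-dimensional ones,
  and both are additive.\<close>

lemma gauss_quadrature_exact: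
  fixes f :: "real^'k \<Rightarrow> real"
  assumes "tensor_poly (2 * n - 1) f" "n \<ge> 1"
  shows "gauss_quadrature n f = integral (cbox 0 1) f"
  using assms(1)
proof induction
  case (monom a c)
  have mono: "(\<Sum>u\<in>gauss_nodes n. gauss_weight n u * u ^ a l) = integral {0..1} (\<lambda>u. u ^ a l)" for l
    using gauss_exact[of "Polynomial.monom 1 (a l)" n] monom assms(2)
    by (simp add: degree_monom_eq poly_monom[abs_def])
  have "gauss_quadrature n (\<lambda>x::real^'k. c * (\<Prod>l\<in>UNIV. (x $ l) ^ a l)) =
      c * (\<Sum>x | \<forall>l. (x::real^'k) $ l \<in> gauss_nodes n. \<Prod>l\<in>UNIV. gauss_weight n (x $ l) * (x $ l) ^ a l)"
    by (simp add: gauss_quadrature_def sum_distrib_left prod.distrib mult_ac)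
  also have "\<dots> = c * (\<Prod>l\<in>UNIV. integral {0..1} (\<lambda>u. u ^ a l))"
    by (subst sum_grid_prod) (simp add: mono)
  also have "\<dots> = c * integral (cbox 0 1) (\<lambda>x::real^'k. \<Prod>l\<in>UNIV. (x $ l) ^ a l)"
    by (subst integral_unit_cube_prod) (auto intro!: continuous_intros)
  finally show ?case by simp
next
  case (add f g)
  then show ?case
    by (auto simp: gauss_quadrature_add intro!: integrable_continuous continuous_on_tensor_poly
        Henstock_Kurzweil_Integration.integral_add[symmetric])
qed

lemma quadrature_error_le:
  fixes g :: "real^'k \<Rightarrow> real"
  assumes cont: "continuous_on (cbox 0 1) g" and n: "n \<ge> 1"
    and p: "tensor_poly (2 * n - 1) p" and le: "\<And>x. x \<in> cbox 0 1 \<Longrightarrow> \<bar>g x - p x\<bar> \<le> e"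
  shows "\<bar>quadrature_error n g\<bar> \<le> 2 * e"
proof -
  let ?G = "{x::real^'k. \<forall>l. x $ l \<in> gauss_nodes n}"
  let ?W = "\<lambda>x::real^'k. \<Prod>l\<in>UNIV. gauss_weight n (x $ l)"
  have contp: "continuous_on (cbox 0 1) p" using p by (rule continuous_on_tensor_poly)
  have "e \<ge> 0" using le[of 0] by (auto simp: cbox_01_iff)
  have "norm (integral (cbox 0 1) (\<lambda>x. g x - p x)) \<le> e * measure lborel (cbox 0 (1::real^'k))"
    using le \<open>e \<ge> 0\<close> by (intro has_integral_bound[of e "\<lambda>x. g x - p x"] integrable_integral
      integrable_continuous continuous_intros cont contp) auto
  moreover have "measure lborel (cbox 0 (1::real^'k)) = 1"
    using cbox_01_iff[of "0::real^'k"] by (auto simp: content_cbox_if_cart)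
  moreover have "integral (cbox 0 1) (\<lambda>x. g x - p x) = integral (cbox 0 1) g - integral (cbox 0 1) p"
    by (intro Henstock_Kurzweil_Integration.integral_diff integrable_continuous cont contp)
  ultimately have 1: "\<bar>integral (cbox 0 1) g - integral (cbox 0 1) p\<bar> \<le> e" by simp
  have "gauss_quadrature n g - gauss_quadrature n p = (\<Sum>x\<in>?G. ?W x * (g x - p x))"
    by (simp add: gauss_quadrature_def sum_subtractf right_diff_distrib)
  also have "\<bar>\<dots>\<bar> \<le> (\<Sum>x\<in>?G. ?W x * e)"
  proof (rule order_trans[OF sum_abs sum_mono])
    fix x assume x: "x \<in> ?G"
    then have "0 \<le> ?W x" by (intro prod_nonneg) (auto simp: gauss_weight_nonneg)
    moreover have "x \<in> cbox 0 1" using x by (auto simp: cbox_01_iff intro!: less_imp_le gauss_nodes_bounds[THEN conjunct1] gauss_nodes_bounds[THEN conjunct2])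
    ultimately show "\<bar>?W x * (g x - p x)\<bar> \<le> ?W x * e"
      using le by (simp add: abs_mult mult_left_mono)
  qed
  \<comment> \<open>The tensor weights sum to a product of one-dimensional weight sums, each equal
    to 1.\<close>
  also have "\<dots> = e"
    using sum_grid_prod[where w = "\<lambda>_::'k. gauss_weight n" and n = n] n
    by (simp add: sum_gauss_weight flip: sum_distrib_right)
  finally have 2: "\<bar>gauss_quadrature n g - gauss_quadrature n p\<bar> \<le> e" .
  show ?thesis using 1 2 gauss_quadrature_exact[OF p n] by (simp add: quadrature_error_def)
qed

section \<open>Polynomial approximation of negative powers\<close>

text \<open>The series converges at a point \<open>r'\<close> strictly between \<open>r\<close> and
  1, so the terms \<open>c j * r' ^ j\<close> are bounded. On [0, r] it is therefore dominated by a
  geometric series of ratio \<open>r / r'\<close>, uniformly in t.\<close>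

lemma binomial_series_truncation:
  fixes r \<alpha> :: real
  assumes "0 < r" "r < 1"
  obtains C \<rho> c where "C > 0" "0 < \<rho>" "\<rho> < 1"
    "\<And>J t. 0 \<le> t \<Longrightarrow> t \<le> r \<Longrightarrow> \<bar>(1 - t) powr \<alpha> - (\<Sum>j<J. c j * t ^ j)\<bar> \<le> C * \<rho> ^ J"
proof -
  define r' where "r' = (1 + r) / 2"
  have r': "r < r'" "r' < 1" "0 < r'" using assms by (auto simp: r'_def)
  define c where "c j = (\<alpha> gchoose j) * (- 1) ^ j" for j
  have sums: "(\<lambda>j. c j * t ^ j) sums (1 - t) powr \<alpha>" if "0 \<le> t" "t < 1" for t
    using gen_binomial_real[of "- t" \<alpha>] that
    by (simp add: c_def mult.assoc flip: power_mult_distrib)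
  have "Bseq (\<lambda>j. c j * r' ^ j)"
    using sums[of r'] r' by (intro convergent_imp_Bseq convergentI[of _ 0] summable_LIMSEQ_zero)
      (auto intro: sums_summable)
  then obtain K where K: "K > 0" "\<And>j. \<bar>c j * r' ^ j\<bar> \<le> K"
    unfolding Bseq_def by auto
  define \<rho> where "\<rho> = r / r'"
  have \<rho>: "0 < \<rho>" "\<rho> < 1" using assms r' by (auto simp: \<rho>_def)
  have "\<bar>(1 - t) powr \<alpha> - (\<Sum>j<J. c j * t ^ j)\<bar> \<le> K / (1 - \<rho>) * \<rho> ^ J" if t: "0 \<le> t" "t \<le> r" for t J
  proof -
    have coeff_bound: "\<bar>c j * t ^ j\<bar> \<le> K * \<rho> ^ j" for j
    proof -
      have "\<bar>c j * t ^ j\<bar> \<le> \<bar>c j\<bar> * r ^ j"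
        using t by (simp add: abs_mult mult_left_mono power_mono)
      also have "\<dots> = \<bar>c j * r' ^ j\<bar> * \<rho> ^ j"
        using r' by (simp add: abs_mult \<rho>_def power_divide)
      also have "\<dots> \<le> K * \<rho> ^ j" using K(2) \<rho> by (intro mult_right_mono) auto
      finally show ?thesis .
    qed
    have s: "(\<lambda>j. c j * t ^ j) sums (1 - t) powr \<alpha>" using t assms by (intro sums) auto
    then have "(\<lambda>j. c (j + J) * t ^ (j + J)) sums ((1 - t) powr \<alpha> - (\<Sum>j<J. c j * t ^ j))"
      by (subst sums_iff_shift) auto
    moreover have "(\<lambda>j. K * \<rho> ^ J * \<rho> ^ j) sums (K * \<rho> ^ J * (1 / (1 - \<rho>)))"
      using \<rho> by (intro sums_mult geometric_sums) auto
    moreover have "norm (c (j + J) * t ^ (j + J)) \<le> K * \<rho> ^ J * \<rho> ^ j" for j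
      using coeff_bound[of "j + J"] by (simp add: power_add mult_ac)
    ultimately show ?thesis
      using norm_sums_le[of "\<lambda>j. c (j + J) * t ^ (j + J)" _ "\<lambda>j. K * \<rho> ^ J * \<rho> ^ j"]
      by (simp add: mult_ac)
  qed
  then show thesis using K \<rho> by (intro that[of "K / (1 - \<rho>)" \<rho> c]) auto
qed

text \<open>The constants come before \<open>q\<close>, \<open>P\<close>, \<open>h\<close>,
  \<open>B\<close> and \<open>N\<close>. Scaling \<open>q\<close> by h^2 reduces every case to one
  fixed interval for the binomial series.\<close>

lemma approx_negative_powr:
  fixes m M \<alpha> :: real and d :: nat
  assumes "0 < m" "m \<le> M"
  obtains C \<rho> where "C > 0" "0 < \<rho>" "\<rho> < 1"
    "\<And>(q :: real^'k \<Rightarrow> real) P h B N.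
       h > 0 \<Longrightarrow> tensor_poly d q \<Longrightarrow> tensor_poly d P \<Longrightarrow>
       (\<And>x. x \<in> cbox 0 1 \<Longrightarrow> m * h\<^sup>2 \<le> q x \<and> q x \<le> M * h\<^sup>2 \<and> \<bar>P x\<bar> \<le> B) \<Longrightarrow>
       \<exists>p. tensor_poly N p \<and>
         (\<forall>x\<in>cbox 0 1. \<bar>P x * q x powr (- \<alpha>) - p x\<bar> \<le> C * B * (h\<^sup>2) powr (- \<alpha>) * \<rho> ^ N)"
proof -
  \<comment> \<open>The factor 2 keeps \<open>r\<close> positive even if
    \<open>m = M\<close>.\<close>
  define r where "r = 1 - m / (2 * M)"
  have r: "0 < r" "r < 1" using assms by (auto simp: r_def field_simps)
  obtain C0 \<rho>0 c where c: "C0 > 0" "0 < \<rho>0" "\<rho>0 < 1"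
    "\<And>J t. 0 \<le> t \<Longrightarrow> t \<le> r \<Longrightarrow> \<bar>(1 - t) powr (- \<alpha>) - (\<Sum>j<J. c j * t ^ j)\<bar> \<le> C0 * \<rho>0 ^ J"
    using binomial_series_truncation[OF r, of "- \<alpha>"] by blast
  \<comment> \<open>The successor avoids a zero root index and a zero divisor when
    \<open>d = 0\<close>. One more power of \<open>t\<close> costs at most \<open>D\<close> degrees,
    so the rate per degree is the \<open>D\<close>-th root of the rate per term.\<close>
  define D where "D = Suc d"
  define \<rho> where "\<rho> = root D \<rho>0"
  have \<rho>: "0 < \<rho>" "\<rho> < 1" "\<rho> ^ D = \<rho>0"
    using c real_root_pow_pos2[of D \<rho>0] by (auto simp: \<rho>_def D_def simp del: real_root_pow_pos2 power_Suc)
  \<comment> \<open>The denominator pays for the degree spent on \<open>P\<close> and for rounding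
    \<open>(N - d) / D\<close> down to a number of terms.\<close>
  define C where "C = (2 * M) powr (- \<alpha>) * C0 / \<rho> ^ (d + D)"
  have "\<exists>p. tensor_poly N p \<and>
         (\<forall>x\<in>cbox 0 1. \<bar>P x * q x powr (- \<alpha>) - p x\<bar> \<le> C * B * (h\<^sup>2) powr (- \<alpha>) * \<rho> ^ N)"
    if h: "h > 0" and q: "tensor_poly d q" and P: "tensor_poly d P"
      and bd: "\<And>x. x \<in> cbox 0 1 \<Longrightarrow> m * h\<^sup>2 \<le> q x \<and> q x \<le> M * h\<^sup>2 \<and> \<bar>P x\<bar> \<le> B"
    for q P :: "real^'k \<Rightarrow> real" and h B :: real and N :: nat
  proof -
    define s where "s = 2 * M * h\<^sup>2"
    have s: "s > 0" using assms h by (simp add: s_def)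
    define t where "t x = 1 - q x / s" for x
    define J where "J = (N - d) div D"
    define p where "p x = s powr (- \<alpha>) * (P x * (\<Sum>j<J. c j * t x ^ j))" for x
    have t_poly: "tensor_poly D t"
      unfolding t_def[abs_def] using tensor_poly_cmult[OF q, of "1 / s"]
      by (intro tensor_poly_diff) (auto simp: D_def intro: tensor_poly_mono)
    have p_poly: "tensor_poly N p"
    \<comment> \<open>This case includes \<open>N < d\<close>, where the subtraction truncates;
      \<open>p\<close> is then the zero function.\<close>
    proof (cases "J = 0")
      case True
      then show ?thesis by (simp add: p_def[abs_def] tensor_poly_const)
    next
      case False
      have "N \<ge> d" using False by (cases "N \<ge> d") (auto simp: J_def)
      then have "d + D * J \<le> N"
        using div_times_less_eq_dividend[of "N - d" D] unfolding J_def mult.commute[of D] by linarith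
      moreover have "tensor_poly (d + D * J) p"
        unfolding p_def[abs_def]
        by (intro tensor_poly_cmult tensor_poly_mult P tensor_poly_sum
            tensor_poly_mono[OF tensor_poly_power[OF t_poly]]) auto
      ultimately show ?thesis by (rule tensor_poly_mono[rotated])
    qed
    have JN: "\<rho>0 ^ J \<le> \<rho> ^ N / \<rho> ^ (d + D)"
    proof -
      have "N - d = D * J + (N - d) mod D" by (simp add: J_def)
      moreover have "(N - d) mod D < D" by (simp add: D_def)
      ultimately have "N \<le> D * J + (d + D)" by linarith
      then have "\<rho> ^ (D * J + (d + D)) \<le> \<rho> ^ N" using \<rho> by (intro power_decreasing) auto
      then have "\<rho>0 ^ J * \<rho> ^ (d + D) \<le> \<rho> ^ N"
        by (simp add: power_add power_mult \<rho>(3))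
      then show ?thesis using \<rho> by (simp add: field_simps)
    qed
    have "\<bar>P x * q x powr (- \<alpha>) - p x\<bar> \<le> C * B * (h\<^sup>2) powr (- \<alpha>) * \<rho> ^ N" if x: "x \<in> cbox 0 1" for x
    proof -
      have tx: "0 \<le> t x" "t x \<le> r"
      proof -
        have "0 \<le> M * h\<^sup>2" using assms by simp
        then have "q x \<le> s" using bd[OF x] unfolding s_def by linarith
        then show "0 \<le> t x" using s by (simp add: t_def)
        have "m / (2 * M) = m * h\<^sup>2 / s" using h by (simp add: s_def)
        also have "\<dots> \<le> q x / s" using bd[OF x] s by (intro divide_right_mono) auto
        finally show "t x \<le> r" by (simp add: t_def r_def)
      qed
      have q_eq: "q x = s * (1 - t x)" using s by (simp add: t_def)
      have "q x powr (- \<alpha>) = s powr (- \<alpha>) * (1 - t x) powr (- \<alpha>)"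
        unfolding q_eq by (rule powr_mult)
      then have "P x * q x powr (- \<alpha>) - p x =
          s powr (- \<alpha>) * (P x * ((1 - t x) powr (- \<alpha>) - (\<Sum>j<J. c j * t x ^ j)))"
        by (simp add: p_def algebra_simps)
      then have "\<bar>P x * q x powr (- \<alpha>) - p x\<bar> =
          s powr (- \<alpha>) * (\<bar>P x\<bar> * \<bar>(1 - t x) powr (- \<alpha>) - (\<Sum>j<J. c j * t x ^ j)\<bar>)"
        by (simp add: abs_mult)
      also have "\<dots> \<le> s powr (- \<alpha>) * (B * (C0 * (\<rho> ^ N / \<rho> ^ (d + D))))"
        using bd[OF x] order_trans[OF c(4)[OF tx] mult_left_mono[OF JN]] c(1)
        by (intro mult_left_mono mult_mono) auto
      also have "\<dots> = C * B * (h\<^sup>2) powr (- \<alpha>) * \<rho> ^ N"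
        using assms h by (simp add: C_def s_def powr_mult)
      finally show ?thesis .
    qed
    then show ?thesis using p_poly by blast
  qed
  moreover have "C > 0" using assms c \<rho> by (simp add: C_def)
  ultimately show thesis using that[of C \<rho>] \<rho> by blast
qed

section \<open>Heights of shape regular tetrahedra\<close>

text \<open>Cosine decreases on [0, pi], so a lower bound for the angle is an upper bound for the
  inner product. For a zero vector the quotient is 0 by convention and the inequality is
  trivial.\<close>

lemma vec_angle_greater:
  assumes "\<theta> > 0" "\<theta> < vec_angle u w"
  shows "\<theta> < pi" "u \<bullet> w \<le> cos \<theta> * (norm u * norm w)"
proof -
  let ?z = "u \<bullet> w / (norm u * norm w)"
  have "\<bar>?z\<bar> \<le> 1"
    using Cauchy_Schwarz_ineq2[of u w] 
    by (cases "u = 0 \<or> w = 0") (auto simp: abs_divide abs_mult divide_le_eq_1 zero_less_mult_iff)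
  then have z: "- 1 \<le> ?z" "?z \<le> 1" by linarith+
  then have "arccos ?z \<le> pi" by (rule arccos_ubound)
  then show "\<theta> < pi" using assms(2) by (simp add: vec_angle_def)
  have "cos (arccos ?z) \<le> cos \<theta>"
    using assms \<open>arccos ?z \<le> pi\<close> by (intro cos_monotone_0_pi_le) (auto simp: vec_angle_def)
  then have "?z \<le> cos \<theta>" using z by (simp add: cos_arccos)
  then show "u \<bullet> w \<le> cos \<theta> * (norm u * norm w)"
    by (cases "norm u * norm w = 0") (auto simp: pos_divide_le_eq)
qed

definition regular_vertices :: "real \<Rightarrow> (real^3) set \<Rightarrow> bool" where
  "regular_vertices \<kappa> V \<longleftrightarrow> card V = 4 \<and> (\<forall>p q r s. V = {p, q, r, s} \<longrightarrow>
     (q - p) \<bullet> (r - p) \<le> \<kappa> * (norm (q - p) * norm (r - p)) \<and>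
     orth_part (q - p) (r - p) \<bullet> orth_part (q - p) (s - p)
       \<le> \<kappa> * (norm (orth_part (q - p) (r - p)) * norm (orth_part (q - p) (s - p))))"

lemma orth_part_orthogonal: "u \<noteq> 0 \<Longrightarrow> u \<bullet> orth_part u w = 0"
  by (simp add: orth_part_def inner_diff_right inner_commute)

text \<open>Pythagoras: removing the component along \<open>u\<close> leaves the sine part. The
  inner product is bounded from above only, and its sign is what permits squaring.\<close>

lemma norm_orth_part_acute:
  assumes "u \<noteq> 0" "0 \<le> u \<bullet> w" "u \<bullet> w \<le> \<kappa> * (norm u * norm w)"
  shows "(1 - \<kappa>\<^sup>2) * (norm w)\<^sup>2 \<le> (norm (orth_part u w))\<^sup>2"
proof -
  have "(u \<bullet> w)\<^sup>2 \<le> \<kappa>\<^sup>2 * ((norm u)\<^sup>2 * (norm w)\<^sup>2)"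
    using power_mono[OF assms(3) assms(2), of 2] by (simp add: power_mult_distrib)
  then have "(u \<bullet> w)\<^sup>2 / (u \<bullet> u) \<le> \<kappa>\<^sup>2 * (norm w)\<^sup>2"
    using assms(1) by (simp add: field_simps power2_norm_eq_inner)
  moreover have "(norm (orth_part u w))\<^sup>2 = (norm w)\<^sup>2 - (u \<bullet> w)\<^sup>2 / (u \<bullet> u)"
  proof -
    define t where "t = (u \<bullet> w) / (u \<bullet> u)"
    have t: "u \<bullet> w = t * (u \<bullet> u)" using assms(1) by (simp add: t_def)
    have "(u \<bullet> w)\<^sup>2 / (u \<bullet> u) = t * (u \<bullet> w)" by (simp add: t_def power2_eq_square)
    moreover have orth: "orth_part u w = w - t *\<^sub>R u" by (simp add: orth_part_def t_def inner_commute)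
    ultimately show ?thesis
      unfolding power2_norm_eq_inner orth
      by (simp add: inner_diff_left inner_diff_right inner_commute[of w u] t)
  qed
  ultimately show ?thesis by (simp add: algebra_simps)
qed

text \<open>\<sigma> stands for sin(\<theta>) when \<kappa> is cos(\<theta>).\<close>

context
  fixes \<kappa> \<sigma> :: real and V :: "(real^3) set"
  assumes \<sigma>: "\<sigma> = sqrt (1 - \<kappa>\<^sup>2)" "\<kappa>\<^sup>2 \<le> 1"
    and reg: "regular_vertices \<kappa> V"
begin

lemma \<sigma>_bounds: "0 \<le> \<sigma>" "\<sigma> \<le> 1" "\<sigma>\<^sup>2 = 1 - \<kappa>\<^sup>2"
  using \<sigma> by auto

lemma obtain_fourth:
  assumes "{p, q, r} \<subseteq> V" "p \<noteq> q" "p \<noteq> r" "q \<noteq> r"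
  obtains s where "V = {p, q, r, s}"
proof -
  have "card V = 4" using reg by (simp add: regular_vertices_def)
  then have "card (V - {p, q, r}) = 1"
    using assms by (subst card_Diff_subset) auto
  then obtain s where "V - {p, q, r} = {s}" by (auto simp: card_1_singleton_iff)
  then have "V = {p, q, r, s}" using assms by blast
  then show thesis by (rule that)
qed

lemma distinct4:
  assumes "V = {p, q, r, s}"
  shows "p \<noteq> q" "p \<noteq> r" "p \<noteq> s" "q \<noteq> r" "q \<noteq> s" "r \<noteq> s"
proof -
  have "card {p, q, r, s} = 4" using reg assms by (simp add: regular_vertices_def)
  then show "p \<noteq> q" "p \<noteq> r" "p \<noteq> s" "q \<noteq> r" "q \<noteq> s" "r \<noteq> s"
    by (auto simp: card_insert_if split: if_splits)
qed

lemma face_angle: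
  assumes "{p, q, r} \<subseteq> V" "p \<noteq> q" "p \<noteq> r" "q \<noteq> r"
  shows "(q - p) \<bullet> (r - p) \<le> \<kappa> * (norm (q - p) * norm (r - p))"
  using obtain_fourth[OF assms] reg unfolding regular_vertices_def by metis

text \<open>By the law of cosines the square of the right side is at least (|r - p| - \<kappa> |q -
  p|)^2 + (1 - \<kappa>^2) |q - p|^2.\<close>

lemma adjacent_edges_le:
  assumes "{p, q, r} \<subseteq> V" "p \<noteq> q" "p \<noteq> r" "q \<noteq> r"
  shows "\<sigma> * norm (q - p) \<le> norm (q - r)"
proof -
  have "(norm (q - r))\<^sup>2 = (norm (q - p))\<^sup>2 + (norm (r - p))\<^sup>2 - 2 * ((q - p) \<bullet> (r - p))"
    by (simp add: power2_norm_eq_inner inner_diff_left inner_diff_right inner_commute)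
  moreover have "0 \<le> (norm (r - p) - \<kappa> * norm (q - p))\<^sup>2" by simp
  ultimately have "(\<sigma> * norm (q - p))\<^sup>2 \<le> (norm (q - r))\<^sup>2"
    using face_angle[OF assms] unfolding power_mult_distrib \<sigma>_bounds(3)
    by (simp add: power2_eq_square algebra_simps)
  then show ?thesis by (rule power2_le_imp_le) simp
qed

text \<open>Two edges are linked by a third one that meets both; each passage to an adjacent edge
  costs a factor \<sigma>.\<close>

lemma edges_comparable:
  assumes "{a, b, x, y} \<subseteq> V" "a \<noteq> b"
  shows "\<sigma>\<^sup>2 * norm (x - y) \<le> norm (a - b)"
proof -
  have le1: "\<sigma> * N \<le> N" if "N \<ge> 0" for N using \<sigma>_bounds that by (simp add: mult_left_le_one_le)
  have adj: "\<sigma> * norm (c - e) \<le> norm (c - d)" if "{c, d, e} \<subseteq> V" "c \<noteq> d" for c d e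
  proof (cases "e = c \<or> e = d")
    case True
    then show ?thesis using le1 by auto
  next
    case False
    then show ?thesis using adjacent_edges_le[of e c d] that by auto
  qed
  have "\<sigma> * norm (x - y) \<le> norm (a - x)" if "a \<noteq> x"
    using adj[of x a y] that assms by (auto simp: norm_minus_commute)
  moreover have "\<sigma> * norm (a - x) \<le> norm (a - b)" using adj[of a b x] assms by auto
  moreover have "\<sigma> * norm (a - y) \<le> norm (a - b)" using adj[of a b y] assms by auto
  moreover have "\<sigma> * (\<sigma> * norm (x - y)) \<le> \<sigma> * norm (x - y)" by (simp add: le1 \<sigma>_bounds)
  ultimately show ?thesis
    using \<sigma>_bounds(1) mult_left_mono[of "\<sigma> * norm (x - y)" "norm (a - x)" \<sigma>]
    by (cases "a = x") (auto simp: power2_eq_square mult.assoc)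
qed

text \<open>In the triangle with vertices \<open>p\<close>, \<open>q\<close>, \<open>s\<close> the
  angle at \<open>p\<close> or the one at \<open>q\<close> is not obtuse, since the two inner
  products add up to |q - p|^2. The orthogonal part is the same from either endpoint; the minimum
  reflects that the suitable endpoint is not known.\<close>

lemma distance_to_edge_line:
  assumes V: "V = {p, q, r, s}"
  shows "\<sigma> * min (norm (s - p)) (norm (s - q)) \<le> norm (orth_part (q - p) (s - p))"
proof -
  note d = distinct4[OF V]
  have key: "\<sigma> * norm (s' - p') \<le> norm (orth_part (q' - p') (s' - p'))"
    if "{p', q', s'} \<subseteq> V" "p' \<noteq> q'" "p' \<noteq> s'" "q' \<noteq> s'" "0 \<le> (q' - p') \<bullet> (s' - p')" for p' q' s'
  proof (rule power2_le_imp_le)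
    show "(\<sigma> * norm (s' - p'))\<^sup>2 \<le> (norm (orth_part (q' - p') (s' - p')))\<^sup>2"
      unfolding power_mult_distrib \<sigma>_bounds(3)
      by (rule norm_orth_part_acute) (use that face_angle in auto)
  qed simp
  show ?thesis
  proof (cases "0 \<le> (q - p) \<bullet> (s - p)")
    case True
    then have "\<sigma> * norm (s - p) \<le> norm (orth_part (q - p) (s - p))" using d V by (intro key) auto
    moreover have "\<sigma> * min (norm (s - p)) (norm (s - q)) \<le> \<sigma> * norm (s - p)"
      using \<sigma>_bounds by (intro mult_left_mono) auto
    ultimately show ?thesis by linarith
  next
    case False
    have "(p - q) \<bullet> (s - q) = (q - p) \<bullet> (q - p) - (q - p) \<bullet> (s - p)"
      by (simp add: inner_diff_left inner_diff_right inner_commute)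
    then have "0 \<le> (p - q) \<bullet> (s - q)" using False inner_ge_zero[of "q - p"] by linarith
    then have "\<sigma> * norm (s - q) \<le> norm (orth_part (p - q) (s - q))" using d V by (intro key) auto
    moreover have "orth_part (p - q) (s - q) = orth_part (q - p) (s - p)"
    proof -
      define u where "u = q - p"
      define w where "w = s - p"
      have "u \<bullet> u \<noteq> 0" using d by (simp add: u_def)
      moreover have eqs: "p - q = - u" "s - q = w - u" "q - p = u" "s - p = w"
        by (auto simp: u_def w_def)
      ultimately show ?thesis unfolding eqs orth_part_def
        by (simp add: inner_diff_left diff_divide_distrib algebra_simps)
    qed
    moreover have "\<sigma> * min (norm (s - p)) (norm (s - q)) \<le> \<sigma> * norm (s - q)"
      using \<sigma>_bounds by (intro mult_left_mono) auto
    ultimately show ?thesis by simp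
  qed
qed

text \<open>The condition on \<open>b\<close> puts the foot of the perpendicular on the side of
  \<open>r\<close> of the line through \<open>p\<close> and \<open>q\<close>, so the dihedral angle
  there is not obtuse. Hence the height is at least \<sigma> times the distance from
  \<open>s\<close> to that line, which is at least \<sigma> times an edge, and edges compare up to
  \<sigma>^2.\<close>

lemma height_ge_acute:
  assumes V: "V = {p, q, r, s}" and xy: "{x, y} \<subseteq> V"
    and s: "s = p + a *\<^sub>R (q - p) + b *\<^sub>R (r - p) + n" and b: "b \<ge> 0"
    and n: "(q - p) \<bullet> n = 0" "(r - p) \<bullet> n = 0"
  shows "\<sigma> ^ 4 * norm (x - y) \<le> norm n"
proof -
  note d = distinct4[OF V]
  define u where "u = q - p"
  define w where "w = orth_part u (r - p)"
  define v where "v = orth_part u (s - p)"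
  have u: "u \<noteq> 0" using d by (simp add: u_def)
  have sp: "s - p = a *\<^sub>R u + b *\<^sub>R (r - p) + n" unfolding u_def using s by (simp add: algebra_simps)
  have nu: "n \<bullet> u = 0" using n by (simp add: u_def inner_commute)
  have "(s - p) \<bullet> u / (u \<bullet> u) = a + b * ((r - p) \<bullet> u / (u \<bullet> u))"
    using u nu by (simp add: sp inner_add_left add_divide_distrib)
  then have v_eq: "v = b *\<^sub>R w + n"
    unfolding v_def w_def orth_part_def by (simp only: sp) (simp add: algebra_simps)
  have uw: "u \<bullet> w = 0" using orth_part_orthogonal[OF u] by (simp add: w_def)
  have wn: "w \<bullet> n = 0" using n by (simp add: w_def orth_part_def inner_diff_left u_def)
  have "\<sigma>\<^sup>2 * (norm v)\<^sup>2 \<le> (norm n)\<^sup>2"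
  proof (cases "w = 0")
    case True
    then show ?thesis using v_eq by (simp add: \<sigma>_bounds mult_left_le_one_le \<sigma>)
  next
    case False
    have "w \<bullet> v = b * (w \<bullet> w)" by (simp add: v_eq inner_add_right wn)
    then have "0 \<le> w \<bullet> v" using b by simp
    moreover have "w \<bullet> v \<le> \<kappa> * (norm w * norm v)"
      using reg V unfolding regular_vertices_def w_def v_def u_def by blast
    moreover have "orth_part w v = n"
      using False by (simp add: orth_part_def v_eq inner_add_left wn inner_commute[of n w])
    ultimately show ?thesis
      using norm_orth_part_acute[OF False, of v \<kappa>] by (simp add: \<sigma>_bounds)
  qed
  then have "\<sigma> * norm v \<le> norm n"
    by (intro power2_le_imp_le[of "\<sigma> * norm v"]) (simp_all add: power_mult_distrib)
  moreover have "\<sigma> * (\<sigma> * (\<sigma>\<^sup>2 * norm (x - y))) \<le> \<sigma> * norm v"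
  proof (intro mult_left_mono \<sigma>_bounds)
    have "\<sigma>\<^sup>2 * norm (x - y) \<le> min (norm (s - p)) (norm (s - q))"
      using edges_comparable[of s p x y] edges_comparable[of s q x y] d V xy by auto
    then have "\<sigma> * (\<sigma>\<^sup>2 * norm (x - y)) \<le> \<sigma> * min (norm (s - p)) (norm (s - q))"
      by (intro mult_left_mono \<sigma>_bounds)
    also have "\<dots> \<le> norm v" using distance_to_edge_line[OF V] by (simp add: v_def u_def)
    finally show "\<sigma> * (\<sigma>\<^sup>2 * norm (x - y)) \<le> norm v" .
  qed
  moreover have "\<sigma> * (\<sigma> * (\<sigma>\<^sup>2 * norm (x - y))) = \<sigma> ^ 4 * norm (x - y)"
    by (simp add: power_def numeral_eq_Suc)
  ultimately show ?thesis by linarith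
qed

text \<open>The foot of the perpendicular from \<open>s\<close> lies on the inner side of at least one of the three
  edges of the opposite face, so that the dihedral angle at this edge is not obtuse.\<close>

lemma height_ge:
  assumes V: "V = {p, q, r, s}" and xy: "{x, y} \<subseteq> V"
  shows "\<sigma> ^ 4 * norm (x - y) \<le> norm (s - p - a *\<^sub>R (q - p) - b *\<^sub>R (r - p))"
proof -
  obtain v n where v: "v \<in> span {q - p, r - p}" "\<And>w. w \<in> span {q - p, r - p} \<Longrightarrow> orthogonal n w"
     "s - p = v + n"
    using orthogonal_subspace_decomp_exists[of "{q - p, r - p}" "s - p"] by metis
  have n: "(q - p) \<bullet> n = 0" "(r - p) \<bullet> n = 0"
    using v(2)[of "q - p"] v(2)[of "r - p"] by (auto simp: span_base orthogonal_def inner_commute)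
  obtain a' b' where ab: "v = a' *\<^sub>R (q - p) + b' *\<^sub>R (r - p)"
    using v(1) by (auto simp: span_insert span_singleton algebra_simps)
  have s: "s = p + a' *\<^sub>R (q - p) + b' *\<^sub>R (r - p) + n" using v(3) ab by (simp add: algebra_simps)
  have "norm n \<le> norm (s - p - a *\<^sub>R (q - p) - b *\<^sub>R (r - p))"
  proof -
    define w where "w = (a' - a) *\<^sub>R (q - p) + (b' - b) *\<^sub>R (r - p)"
    have eq: "s - p - a *\<^sub>R (q - p) - b *\<^sub>R (r - p) = w + n" using s by (simp add: w_def algebra_simps)
    have "w \<bullet> n = 0" by (simp add: w_def inner_add_left n)
    then have "(norm (w + n))\<^sup>2 = (norm w)\<^sup>2 + (norm n)\<^sup>2"
      by (simp add: power2_norm_eq_inner inner_add_left inner_add_right inner_commute)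
    then have "(norm n)\<^sup>2 \<le> (norm (w + n))\<^sup>2" by simp
    then show ?thesis unfolding eq by (rule power2_le_imp_le) simp
  qed
  moreover have "\<sigma> ^ 4 * norm (x - y) \<le> norm n"
  proof -
    \<comment> \<open>These are the barycentric coordinates of the foot at \<open>r\<close>,
      \<open>q\<close> and \<open>p\<close>. They sum to 1, so one is nonnegative, and relabelling
      makes it the coefficient \<open>b\<close> of the acute case.\<close>
    consider "b' \<ge> 0" | "a' \<ge> 0" | "1 - a' - b' \<ge> 0" by linarith
    then show ?thesis
    proof cases
      case 1
      then show ?thesis using height_ge_acute[OF V xy s _ n] by simp
    next
      case 2
      have "s = p + b' *\<^sub>R (r - p) + a' *\<^sub>R (q - p) + n" using s by (simp add: algebra_simps)
      then show ?thesis using 2 height_ge_acute[of p r q s x y b' a' n] V xy n by auto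
    next
      case 3
      have "s = q + b' *\<^sub>R (r - q) + (1 - a' - b') *\<^sub>R (p - q) + n"
        using s by (simp add: algebra_simps)
      moreover have "(r - q) \<bullet> n = 0" "(p - q) \<bullet> n = 0" using n by (auto simp: inner_diff_left)
      ultimately show ?thesis using 3 height_ge_acute[of q r p s x y b' "1 - a' - b'" n] V xy by auto
    qed
  qed
  ultimately show ?thesis by linarith
qed

text \<open>Coefficients with sum zero describe a difference of two points. Divided by
  \<open>d\<close>, it becomes a vector from the plane of \<open>p\<close>, \<open>q\<close>,
  \<open>r\<close> to \<open>s\<close>.\<close>

lemma barycentric_height:
  assumes V: "V = {p, q, r, s}" and xy: "{x, y} \<subseteq> V" and sum: "a + b + c + d = 0"
  shows "\<sigma> ^ 4 * norm (x - y) * \<bar>d\<bar> \<le> norm (a *\<^sub>R p + b *\<^sub>R q + c *\<^sub>R r + d *\<^sub>R s)"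
proof (cases "d = 0")
  case False
  have a: "a = - b - c - d" using sum by simp
  have "a *\<^sub>R p + b *\<^sub>R q + c *\<^sub>R r + d *\<^sub>R s = d *\<^sub>R (s - p - (- b / d) *\<^sub>R (q - p) - (- c / d) *\<^sub>R (r - p))"
    unfolding a using False by (simp add: algebra_simps)
  then have "norm (a *\<^sub>R p + b *\<^sub>R q + c *\<^sub>R r + d *\<^sub>R s) =
      \<bar>d\<bar> * norm (s - p - (- b / d) *\<^sub>R (q - p) - (- c / d) *\<^sub>R (r - p))" by simp
  moreover have "\<bar>d\<bar> * (\<sigma> ^ 4 * norm (x - y)) \<le>
      \<bar>d\<bar> * norm (s - p - (- b / d) *\<^sub>R (q - p) - (- c / d) *\<^sub>R (r - p))"
    by (intro mult_left_mono height_ge[OF V xy]) simp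
  ultimately show ?thesis by (simp add: mult_ac)
qed simp

end

section \<open>Mesh elements and nodal functions\<close>

text \<open>The four affinely independent points behind \<open>3 simplex\<close> are extreme in the
  hull, hence lie among the given points, which number at most four.\<close>

lemma simplex_vertices:
  fixes a b c d :: "real^3"
  assumes "3 simplex (convex hull {a, b, c, d})"
  shows "card {a, b, c, d} = 4" "\<not> affine_dependent {a, b, c, d}"
proof -
  obtain C where C: "\<not> affine_dependent C" "int (card C) = 3 + 1"
    "convex hull {a, b, c, d} = convex hull C"
    using assms unfolding simplex_def by blast
  have "C \<subseteq> {a, b, c, d}"
    using C(3) extreme_point_of_convex_hull_affine_independent[OF C(1)]
      extreme_point_of_convex_hull[of _ "{a, b, c, d}"] by auto
  moreover have "card {a, b, c, d} \<le> 4"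
    using card_insert_le_m1[of 4 "{b, c, d}" a] card_insert_le_m1[of 3 "{c, d}" b] card_insert_le_m1[of 2 "{d}" c]
    by auto
  ultimately have "C = {a, b, c, d}" using C(2) by (intro card_seteq) auto
  then show "card {a, b, c, d} = 4" "\<not> affine_dependent {a, b, c, d}" using C by auto
qed

lemma shape_regular_imp_regular_vertices:
  assumes "0 < \<theta>" "shape_regular \<theta> \<T>" "convex hull {a, b, c, d} \<in> \<T>" "card {a, b, c, d} = 4"
  shows "\<theta> < pi" "regular_vertices (cos \<theta>) {a, b, c, d}"
proof -
  have ang: "\<theta> < vec_angle (q - p) (r - p)"
      "\<theta> < vec_angle (orth_part (q - p) (r - p)) (orth_part (q - p) (s - p))"
    if "{a, b, c, d} = {p, q, r, s}" for p q r s
    using assms(2,3) unfolding shape_regular_def that by blast+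
  show "\<theta> < pi" using ang(1)[OF refl] vec_angle_greater(1) assms(1) by blast
  show "regular_vertices (cos \<theta>) {a, b, c, d}"
    unfolding regular_vertices_def
    by (intro conjI allI impI assms(4) vec_angle_greater(2)[OF assms(1)] ang)
qed

lemma diameter_attained:
  fixes V :: "(real^3) set"
  assumes "finite V" "V \<noteq> {}"
  obtains x y where "x \<in> V" "y \<in> V" "diameter (convex hull V) \<le> norm (x - y)"
proof -
  obtain x y where xy: "x \<in> V" "y \<in> V"
    "\<And>u w. u \<in> convex hull V \<Longrightarrow> w \<in> convex hull V \<Longrightarrow> norm (u - w) \<le> norm (x - y)"
    using simplex_extremal_le[OF assms] by blast
  moreover have "diameter (convex hull V) \<le> norm (x - y)"
    using xy by (intro diameter_le) auto
  ultimately show thesis using that by blast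
qed

lemma diff_le_diameter:
  fixes V :: "(real^3) set"
  assumes "finite V" "x \<in> convex hull V" "y \<in> convex hull V"
  shows "norm (x - y) \<le> diameter (convex hull V)"
  using diameter_bounded_bound[of "convex hull V" x y] assms
  by (simp add: dist_norm bounded_convex_hull finite_imp_bounded)

text \<open>The factor \<sigma>^4 of the height estimate with \<sigma> = sin(\<theta>).\<close>

definition height_const :: "real \<Rightarrow> real" where
  "height_const \<theta> = sin \<theta> ^ 4"

lemma barycentric_bound:
  assumes \<theta>: "0 < \<theta>" "\<theta> < pi" and reg: "regular_vertices (cos \<theta>) {p1, p2, p3, p4}"
    and sum: "b1 + b2 + b3 + b4 = 0"
    and N: "N = norm (b1 *\<^sub>R p1 + b2 *\<^sub>R p2 + b3 *\<^sub>R p3 + b4 *\<^sub>R p4)"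
    and h: "h = height_const \<theta> * diameter (convex hull {p1, p2, p3, p4})"
  shows "h * \<bar>b1\<bar> \<le> N" "h * \<bar>b2\<bar> \<le> N" "h * \<bar>b3\<bar> \<le> N" "h * \<bar>b4\<bar> \<le> N"
proof -
  let ?V = "{p1, p2, p3, p4}"
  have sin: "sin \<theta> = sqrt (1 - (cos \<theta>)\<^sup>2)" using \<theta> by (intro sin_cos_sqrt sin_ge_zero) auto
  have cos: "(cos \<theta>)\<^sup>2 \<le> 1" by (simp add: abs_square_le_1)
  obtain x y where xy: "x \<in> ?V" "y \<in> ?V" "diameter (convex hull ?V) \<le> norm (x - y)"
    using diameter_attained[of ?V] by auto
  have le: "h * t \<le> sin \<theta> ^ 4 * norm (x - y) * t" if "t \<ge> 0" for t
    using xy(3) that unfolding h height_const_def by (intro mult_right_mono mult_left_mono) auto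
  note bh = barycentric_height[OF sin cos reg]
  have sub: "{x, y} \<subseteq> ?V" using xy by auto
  show "h * \<bar>b4\<bar> \<le> N"
    using le[of "\<bar>b4\<bar>"] bh[of p1 p2 p3 p4 x y b1 b2 b3 b4] sub sum N by simp
  show "h * \<bar>b3\<bar> \<le> N"
    using le[of "\<bar>b3\<bar>"] bh[of p1 p2 p4 p3 x y b1 b2 b4 b3] sub sum N by (simp add: insert_commute add_ac)
  show "h * \<bar>b2\<bar> \<le> N"
    using le[of "\<bar>b2\<bar>"] bh[of p1 p4 p3 p2 x y b1 b4 b3 b2] sub sum N by (simp add: insert_commute add_ac)
  show "h * \<bar>b1\<bar> \<le> N"
    using le[of "\<bar>b1\<bar>"] bh[of p4 p2 p3 p1 x y b4 b2 b3 b1] sub sum N by (simp add: insert_commute add_ac)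
qed

section \<open>The reference map in barycentric coordinates\<close>

lemma ref_map_eq:
  "ref_map (a, b, c, d) x =
     (1 - x$1) *\<^sub>R a + (x$1 - x$2 - x$3) *\<^sub>R b + (x$2) *\<^sub>R c + (x$3) *\<^sub>R d"
  by (simp add: ref_map_def vec_eq_iff matrix_vector_mult_def transpose_def sum_3 algebra_simps)

text \<open>These inequalities say that the four coefficients in \<open>ref_map_eq\<close> are
  nonnegative.\<close>

definition ref_tet :: "(real^3) set" where
  "ref_tet = {x. x$1 \<le> 1 \<and> 0 \<le> x$2 \<and> 0 \<le> x$3 \<and> x$2 + x$3 \<le> x$1}"

lemma ref_map_in_tet:
  assumes "x \<in> ref_tet"
  shows "ref_map v x \<in> tet v"
proof -
  obtain a b c d where v: "v = (a, b, c, d)" by (cases v)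
  define w where "w i = [1 - x$1, x$1 - x$2 - x$3, x$2, x$3] ! i" for i
  define y where "y i = [a, b, c, d] ! i" for i
  have "(\<Sum>i\<in>{0,1,2,3::nat}. w i *\<^sub>R y i) \<in> convex hull {a, b, c, d}"
    using assms by (intro convex_sum) (auto simp: w_def y_def ref_tet_def intro: hull_inc)
  then show ?thesis by (simp add: v ref_map_eq w_def y_def add_ac)
qed

text \<open>One diameter for each column of the matrix. Negative coordinates are allowed, because
  the transformations for edges, faces and identical elements leave the reference
  tetrahedron.\<close>

lemma norm_ref_map_diff_le:
  assumes "\<And>i. abs (x $ i) \<le> 1"
  shows "norm (ref_map v x - fst v) \<le> 3 * diameter (tet v)"
proof -
  obtain a b c d where v: "v = (a, b, c, d)" by (cases v)
  have e: "norm (b - a) \<le> diameter (tet v)" "norm (c - b) \<le> diameter (tet v)" "norm (d - b) \<le> diameter (tet v)"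
    unfolding v tet.simps by (intro diff_le_diameter; auto intro: hull_inc)+
  have "ref_map v x - fst v = (x$1) *\<^sub>R (b - a) + (x$2) *\<^sub>R (c - b) + (x$3) *\<^sub>R (d - b)"
    by (simp add: v ref_map_eq algebra_simps)
  moreover have scaled: "norm (x$i *\<^sub>R u) \<le> diameter (tet v)" if "norm u \<le> diameter (tet v)" for i u
    using mult_mono[OF assms[of i] that] by simp
  ultimately have "norm (ref_map v x - fst v) \<le> diameter (tet v) + diameter (tet v) + diameter (tet v)"
    by (simp only:) (intro norm_triangle_mono scaled e)
  then show ?thesis by simp
qed

lemma abs_det_ref_mat_le: "\<bar>det (ref_mat v)\<bar> \<le> 6 * diameter (tet v) ^ 3"
proof -
  obtain a b c d where v: "v = (a, b, c, d)" by (cases v)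
  define h where "h = diameter (tet v)"
  have e: "norm (b - a) \<le> h" "norm (c - b) \<le> h" "norm (d - b) \<le> h"
    unfolding v h_def tet.simps by (intro diff_le_diameter; auto intro: hull_inc)+
  have "\<bar>ref_mat v $ i $ j\<bar> \<le> h" for i j
    using e component_le_norm_cart[of "b - a" i] component_le_norm_cart[of "c - b" i]
      component_le_norm_cart[of "d - b" i] exhaust_3[of j]
    by (auto simp: v transpose_def)
  then have prod: "\<bar>ref_mat v $ i $ j * ref_mat v $ k $ l * ref_mat v $ m $ n\<bar> \<le> h * h * h" for i j k l m n
    unfolding abs_mult by (intro mult_mono) (auto intro: order_trans[OF abs_ge_zero])
  have six: "\<bar>x1 + x2 + x3 - x4 - x5 - x6\<bar> \<le> 6 * k"
    if "\<bar>x1\<bar> \<le> k" "\<bar>x2\<bar> \<le> k" "\<bar>x3\<bar> \<le> k" "\<bar>x4\<bar> \<le> k" "\<bar>x5\<bar> \<le> k" "\<bar>x6\<bar> \<le> k"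
    for x1 x2 x3 x4 x5 x6 k :: real using that by linarith
  then show ?thesis unfolding det_3 h_def[symmetric] power3_eq_cube by (intro six prod)
qed

lemma affine_fun_eqI:
  assumes "affine_fun f" "affine_fun g" "\<not> affine_dependent V" "card V = 4"
    and eq: "\<And>x. x \<in> V \<Longrightarrow> f x = g x"
  shows "f = g"
proof -
  obtain u t where f: "\<And>x. f x = u \<bullet> x + t" using assms(1) by (auto simp: affine_fun_def)
  obtain u' t' where g: "\<And>x. g x = u' \<bullet> x + t'" using assms(2) by (auto simp: affine_fun_def)
  have "(u - u') \<bullet> x = t' - t" if "x \<in> V" for x
    using eq[OF that] unfolding f g inner_diff_left by linarith
  then have "V \<subseteq> {x. (u - u') \<bullet> x = t' - t}" by blast
  then have "affine hull V \<subseteq> {x. (u - u') \<bullet> x = t' - t}"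
    by (intro hull_minimal affine_hyperplane)
  moreover have "affine hull V = UNIV" using assms(3,4) by (intro affine_independent_span_eq) auto
  ultimately have "(u - u') \<bullet> x = t' - t" for x by blast
  then show ?thesis unfolding f g fun_eq_iff inner_diff_left by (simp add: algebra_simps)
qed

lemma affine_fun_combination:
  assumes "affine_fun f" "a + b + c + d = 1"
  shows "f (a *\<^sub>R p + b *\<^sub>R q + c *\<^sub>R r + d *\<^sub>R s) = a * f p + b * f q + c * f r + d * f s"
proof -
  obtain u t where f: "\<And>x. f x = u \<bullet> x + t" using assms(1) by (auto simp: affine_fun_def)
  have a: "a = 1 - b - c - d" using assms(2) by simp
  show ?thesis by (simp add: f a inner_add_right algebra_simps)
qed

text \<open>The affine function with the vertex values of \<open>f\<close>, pulled back to reference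
  coordinates. It makes sense outside the reference tetrahedron and is visibly a polynomial of
  degree one.\<close>

definition nodal_interp :: "(real^3 \<Rightarrow> real) \<Rightarrow> verts \<Rightarrow> real^3 \<Rightarrow> real" where
  "nodal_interp f v x = (case v of (a, b, c, d) \<Rightarrow>
     (1 - x$1) * f a + (x$1 - x$2 - x$3) * f b + x$2 * f c + x$3 * f d)"

text \<open>The coefficients are bounded by 2, 3, 1 and 1 on the cube of coordinates between -1 and
  1.\<close>

lemma abs_nodal_interp_le:
  assumes "v = (a, b, c, d)" "\<And>p. p \<in> {a, b, c, d} \<Longrightarrow> f p = 0 \<or> f p = 1" "\<And>i. abs (x $ i) \<le> 1"
  shows "\<bar>nodal_interp f v x\<bar> \<le> 7"
proof -
  have "f a = 0 \<or> f a = 1" "f b = 0 \<or> f b = 1" "f c = 0 \<or> f c = 1" "f d = 0 \<or> f d = 1"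
    using assms(2) by auto
  moreover have "\<bar>x $ 1\<bar> \<le> 1" "\<bar>x $ 2\<bar> \<le> 1" "\<bar>x $ 3\<bar> \<le> 1" using assms(3) by auto
  ultimately have "\<bar>(1 - x$1) * f a\<bar> \<le> 2" "\<bar>(x$1 - x$2 - x$3) * f b\<bar> \<le> 3" "\<bar>x$2 * f c\<bar> \<le> 1" "\<bar>x$3 * f d\<bar> \<le> 1"
    by auto
  then show ?thesis unfolding nodal_interp_def assms(1) prod.case by linarith
qed

context
  fixes \<Omega> :: "(real^3) set" and \<T> and f :: "real^3 \<Rightarrow> real" and a b c d :: "real^3" and v :: verts
  assumes mesh: "tet_mesh \<Omega> \<T>" and v: "v = (a, b, c, d)" "tet v \<in> \<T>"
begin

lemma mesh_vertices:
  shows "card {a, b, c, d} = 4" "\<not> affine_dependent {a, b, c, d}"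
  using simplex_vertices[of a b c d] mesh v by (auto simp: tet_mesh_def)

text \<open>The definite description in \<open>affine_ext\<close> is meaningful because four
  affinely independent points determine an affine function.\<close>

lemma fe_affine_on_tet:
  assumes f: "f \<in> fe_space \<Omega> \<T>"
  shows "affine_fun (affine_ext f (tet v))" "\<And>x. x \<in> tet v \<Longrightarrow> affine_ext f (tet v) x = f x"
proof -
  obtain g where g: "affine_fun g" "\<forall>x\<in>tet v. g x = f x"
    using f v by (fastforce simp: fe_space_def)
  have unique: "g' = g" if "affine_fun g' \<and> (\<forall>x\<in>tet v. g' x = f x)" for g'
    using that g mesh_vertices v by (intro affine_fun_eqI[of g' g "{a, b, c, d}"]) (auto simp: hull_inc)
  have "affine_fun (affine_ext f (tet v)) \<and> (\<forall>x\<in>tet v. affine_ext f (tet v) x = f x)"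
    unfolding affine_ext_def by (rule theI[of _ g]) (use g unique in blast)+
  then show "affine_fun (affine_ext f (tet v))" "\<And>x. x \<in> tet v \<Longrightarrow> affine_ext f (tet v) x = f x"
    by auto
qed

lemma affine_ext_ref_map:
  assumes f: "f \<in> fe_space \<Omega> \<T>"
  shows "affine_ext f (tet v) (ref_map v x) = nodal_interp f v x"
proof -
  have "affine_ext f (tet v) p = f p" if "p \<in> {a, b, c, d}" for p
    using that v fe_affine_on_tet(2)[OF f, of p] by (auto simp: hull_inc)
  then show ?thesis
    unfolding v(1) ref_map_eq nodal_interp_def
    by (subst affine_fun_combination) (use fe_affine_on_tet(1)[OF f] v(1) in auto)
qed

lemma fe_ref_map:
  assumes f: "f \<in> fe_space \<Omega> \<T>" and "x \<in> ref_tet"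
  shows "f (ref_map v x) = nodal_interp f v x"
  using affine_ext_ref_map[OF f] fe_affine_on_tet(2)[OF f] ref_map_in_tet[OF assms(2)] by metis

text \<open>A vertex in \<Omega> is an inner node, where the nodal property decides the value;
  elsewhere functions of the space vanish.\<close>

lemma nodal_basis_vertex_values:
  assumes "nodal_basis \<Omega> \<T> N \<phi>" "i \<in> {1..N}"
  shows "\<phi> i \<in> fe_space \<Omega> \<T>" "\<And>p. p \<in> {a, b, c, d} \<Longrightarrow> \<phi> i p = 0 \<or> \<phi> i p = 1"
proof -
  obtain P where P: "bij_betw P {1..N} (inner_nodes \<Omega> \<T>)"
    "\<And>i. i \<in> {1..N} \<Longrightarrow> \<phi> i \<in> fe_space \<Omega> \<T>"
    "\<And>i l. i \<in> {1..N} \<Longrightarrow> l \<in> {1..N} \<Longrightarrow> \<phi> i (P l) = (if l = i then 1 else 0)"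
    using assms(1) unfolding nodal_basis_def by blast
  show fe: "\<phi> i \<in> fe_space \<Omega> \<T>" using P(2) assms(2) .
  fix p assume p: "p \<in> {a, b, c, d}"
  show "\<phi> i p = 0 \<or> \<phi> i p = 1"
  proof (cases "p \<in> \<Omega>")
    case True
    have "p extreme_point_of tet v"
      using extreme_point_of_convex_hull_affine_independent[OF mesh_vertices(2)] p v by simp
    then have "p \<in> inner_nodes \<Omega> \<T>" using True v by (auto simp: inner_nodes_def)
    then have "p \<in> P ` {1..N}" using bij_betw_imp_surj_on[OF P(1)] by simp
    then obtain l where "l \<in> {1..N}" "p = P l" by blast
    then show ?thesis using P(3) assms(2) by auto
  next
    case False
    then show ?thesis using fe by (simp add: fe_space_def)
  qed
qed

lemma diameter_tet_pos: "0 < diameter (tet v)"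
proof -
  have "a \<noteq> b" using mesh_vertices(1) by (auto simp: card_insert_if split: if_splits)
  then have "0 < norm (a - b)" by simp
  also have "\<dots> \<le> diameter (tet v)" unfolding v(1) tet.simps by (intro diff_le_diameter) (auto intro: hull_inc)
  finally show ?thesis .
qed

lemma mesh_size_bounds:
  assumes "quasi_uniform c1 c2 \<T>"
  shows "c1 * diameter (tet v) \<le> mesh_size \<T>" "mesh_size \<T> \<le> c2 * diameter (tet v)"
proof -
  have fin: "finite \<T>" using mesh by (simp add: tet_mesh_def triangulation_def)
  then have card: "real (card \<T>) > 0" using v(2) by (auto simp: card_gt_0_iff)
  have b: "c1 * diameter (tet v) \<le> diameter t" "diameter t \<le> c2 * diameter (tet v)" if "t \<in> \<T>" for t
    using assms that v(2) by (auto simp: quasi_uniform_def)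
  have "card \<T> * (c1 * diameter (tet v)) \<le> (\<Sum>t\<in>\<T>. diameter t)"
    using b by (intro sum_bounded_below) auto
  then show "c1 * diameter (tet v) \<le> mesh_size \<T>" using card by (simp add: mesh_size_def field_simps)
  have "(\<Sum>t\<in>\<T>. diameter t) \<le> card \<T> * (c2 * diameter (tet v))"
    using b by (intro sum_bounded_above) auto
  then show "mesh_size \<T> \<le> c2 * diameter (tet v)" using card by (simp add: mesh_size_def field_simps)
qed

end

section \<open>Separation of the image points\<close>

text \<open>These conditions make the difference of the two image points large: in barycentric coordinates
  some coordinate of a vertex that is not common, or the difference of the two coordinates of a common
  vertex, is bounded below.  In the edge and face cases the points lie in the reference tetrahedron only
  after a shift by the first unit vector; the shift moves both image points by the common edge vector.\<close>

fun admissible :: "pair_kind \<Rightarrow> (real^3) \<times> (real^3) \<Rightarrow> bool" where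
  "admissible Distant (x, y) \<longleftrightarrow> False"
| "admissible Common_Vertex (x, y) \<longleftrightarrow> x \<in> ref_tet \<and> y \<in> ref_tet \<and> 1 \<le> x$1 + y$1"
| "admissible Common_Edge (x, y) \<longleftrightarrow>
     x + vec3 1 0 0 \<in> ref_tet \<and> y + vec3 1 0 0 \<in> ref_tet \<and>
     1 \<le> \<bar>x$1 - y$1\<bar> + (\<bar>x$2\<bar> + \<bar>y$2\<bar>) + (\<bar>x$3\<bar> + \<bar>y$3\<bar>)"
| "admissible Common_Face (x, y) \<longleftrightarrow>
     x + vec3 1 0 0 \<in> ref_tet \<and> y + vec3 1 0 0 \<in> ref_tet \<and>
     1 \<le> \<bar>x$1 - y$1\<bar> + \<bar>x$2 - y$2\<bar> + (\<bar>x$3\<bar> + \<bar>y$3\<bar>)"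
| "admissible Identical (x, y) \<longleftrightarrow> 1 \<le> \<bar>x$1 - y$1\<bar> + \<bar>x$2 - y$2\<bar> + \<bar>x$3 - y$3\<bar>"

lemma ref_map_shift: "ref_map (a, b, c, d) (x + vec3 1 0 0) = ref_map (a, b, c, d) x + (b - a)"
  by (simp add: ref_map_eq vec3_def algebra_simps)

lemma height_const_pos: "0 < \<theta> \<Longrightarrow> \<theta> < pi \<Longrightarrow> 0 < height_const \<theta>"
  unfolding height_const_def by (intro zero_less_power sin_gt_zero)

text \<open>By quasi-uniformity \<open>mesh_size \<T> / c2\<close> is below either diameter, so
  \<open>K\<close> is a lower bound for heights of both elements. The factor \<open>min cA 1\<close>
  pays for the detour; its cap 1 lets the same \<open>K\<close> serve identical elements, where
  there is no detour.\<close>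

context
  fixes \<Omega> :: "(real^3) set" and \<T> and \<theta> c1 c2 cA K :: real and v w :: verts
    and a b c d a' b' c' d' :: "real^3"
  assumes \<theta>: "0 < \<theta>" and cpos: "0 < c2" "0 < cA"
    and mesh: "tet_mesh \<Omega> \<T>" and shape: "shape_regular \<theta> \<T>" and quasi: "quasi_uniform c1 c2 \<T>"
    and geo: "geometric_assumption cA \<Omega> \<T>"
    and v: "v = (a, b, c, d)" "tet v \<in> \<T>" and w: "w = (a', b', c', d')" "tet w \<in> \<T>"
    and K: "K = min cA 1 * height_const \<theta> / c2 * mesh_size \<T>"
begin

lemma regular_v: "\<theta> < pi" "regular_vertices (cos \<theta>) {a, b, c, d}"
  using shape_regular_imp_regular_vertices[OF \<theta> shape, of a b c d] mesh_vertices[OF mesh v] v by auto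

lemma regular_w: "regular_vertices (cos \<theta>) {a', b', c', d'}"
  using shape_regular_imp_regular_vertices[OF \<theta> shape, of a' b' c' d'] mesh_vertices[OF mesh w] w by auto

lemma K_le:
  shows "K \<le> min cA 1 * (height_const \<theta> * diameter (tet v))"
    "K \<le> min cA 1 * (height_const \<theta> * diameter (tet w))" "0 < K"
proof -
  have k: "0 < height_const \<theta>" using \<theta> regular_v by (intro height_const_pos)
  have bd: "mesh_size \<T> / c2 \<le> diameter (tet v)" "mesh_size \<T> / c2 \<le> diameter (tet w)"
    using mesh_size_bounds(2)[OF mesh v quasi] mesh_size_bounds(2)[OF mesh w quasi] cpos
    by (auto simp: field_simps)
  show "K \<le> min cA 1 * (height_const \<theta> * diameter (tet v))"
    "K \<le> min cA 1 * (height_const \<theta> * diameter (tet w))"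
    using mult_left_mono[OF bd(1), of "min cA 1 * height_const \<theta>"]
      mult_left_mono[OF bd(2), of "min cA 1 * height_const \<theta>"] k cpos
    by (auto simp: K mult.assoc)
  have fin: "finite \<T>" using mesh by (simp add: tet_mesh_def triangulation_def)
  have "0 < diameter t" if t: "t \<in> \<T>" for t
  proof -
    have "diameter (tet v) \<le> c2 * diameter t" using quasi v(2) t by (auto simp: quasi_uniform_def)
    then show ?thesis using diameter_tet_pos[OF mesh v] cpos by (smt (verit) zero_less_mult_iff)
  qed
  then have "0 < mesh_size \<T>" using fin v(2)
    unfolding mesh_size_def by (intro divide_pos_pos sum_pos) (auto simp: card_gt_0_iff)
  then show "0 < K" using k cpos by (simp add: K)
qed

lemma barycentric_v:
  assumes "b1 + b2 + b3 + b4 = 0" "N = norm (b1 *\<^sub>R a + b2 *\<^sub>R b + b3 *\<^sub>R c + b4 *\<^sub>R d)"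
  shows "K * \<bar>b1\<bar> \<le> min cA 1 * N" "K * \<bar>b2\<bar> \<le> min cA 1 * N" "K * \<bar>b3\<bar> \<le> min cA 1 * N" "K * \<bar>b4\<bar> \<le> min cA 1 * N"
proof -
  have "K * \<bar>t\<bar> \<le> min cA 1 * N" if "height_const \<theta> * diameter (tet v) * \<bar>t\<bar> \<le> N" for t
  proof -
    have "K * \<bar>t\<bar> \<le> min cA 1 * (height_const \<theta> * diameter (tet v)) * \<bar>t\<bar>"
      by (intro mult_right_mono K_le) simp
    also have "\<dots> = min cA 1 * (height_const \<theta> * diameter (tet v) * \<bar>t\<bar>)" by (simp only: mult.assoc)
    also have "\<dots> \<le> min cA 1 * N" using cpos by (intro mult_left_mono that) auto
    finally show ?thesis .
  qed
  then show "K * \<bar>b1\<bar> \<le> min cA 1 * N" "K * \<bar>b2\<bar> \<le> min cA 1 * N" "K * \<bar>b3\<bar> \<le> min cA 1 * N" "K * \<bar>b4\<bar> \<le> min cA 1 * N"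
    using barycentric_bound[OF \<theta> regular_v assms refl] v(1) by auto
qed

lemma barycentric_w:
  assumes "b1 + b2 + b3 + b4 = 0" "N = norm (b1 *\<^sub>R a' + b2 *\<^sub>R b' + b3 *\<^sub>R c' + b4 *\<^sub>R d')"
  shows "K * \<bar>b1\<bar> \<le> min cA 1 * N" "K * \<bar>b2\<bar> \<le> min cA 1 * N" "K * \<bar>b3\<bar> \<le> min cA 1 * N" "K * \<bar>b4\<bar> \<le> min cA 1 * N"
proof -
  have "K * \<bar>t\<bar> \<le> min cA 1 * N" if "height_const \<theta> * diameter (tet w) * \<bar>t\<bar> \<le> N" for t
  proof -
    have "K * \<bar>t\<bar> \<le> min cA 1 * (height_const \<theta> * diameter (tet w)) * \<bar>t\<bar>"
      by (intro mult_right_mono K_le) simp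
    also have "\<dots> = min cA 1 * (height_const \<theta> * diameter (tet w) * \<bar>t\<bar>)" by (simp only: mult.assoc)
    also have "\<dots> \<le> min cA 1 * N" using cpos by (intro mult_left_mono that) auto
    finally show ?thesis .
  qed
  then show "K * \<bar>b1\<bar> \<le> min cA 1 * N" "K * \<bar>b2\<bar> \<le> min cA 1 * N" "K * \<bar>b3\<bar> \<le> min cA 1 * N" "K * \<bar>b4\<bar> \<le> min cA 1 * N"
    using barycentric_bound[OF \<theta> regular_v(1) regular_w assms refl] w(1) by auto
qed

text \<open>\<open>p\<close> has the same barycentric coordinates in both tetrahedra. The hypothesis
  \<open>le\<close> bounds the two legs to \<open>p\<close> by the distance of the image points, and
  each leg dominates every coordinate difference within its own element.\<close>

lemma via_common_point:
  assumes p: "p = p1 *\<^sub>R a + p2 *\<^sub>R b + p3 *\<^sub>R c + p4 *\<^sub>R d"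
      "p = p1 *\<^sub>R a' + p2 *\<^sub>R b' + p3 *\<^sub>R c' + p4 *\<^sub>R d'" "p1 + p2 + p3 + p4 = 1"
    and le: "cA * (norm (ref_map v x - p) + norm (p - ref_map w y)) \<le> norm (ref_map v x - ref_map w y)"
      (is "_ \<le> ?L")
  shows "K * (\<bar>1 - x$1 - p1\<bar> + \<bar>1 - y$1 - p1\<bar>) \<le> ?L"
    "K * (\<bar>x$1 - x$2 - x$3 - p2\<bar> + \<bar>y$1 - y$2 - y$3 - p2\<bar>) \<le> ?L"
    "K * (\<bar>x$2 - p3\<bar> + \<bar>y$2 - p3\<bar>) \<le> ?L" "K * (\<bar>x$3 - p4\<bar> + \<bar>y$3 - p4\<bar>) \<le> ?L"
proof -
  have "min cA 1 * (norm (ref_map v x - p) + norm (p - ref_map w y)) \<le>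
      cA * (norm (ref_map v x - p) + norm (p - ref_map w y))" by (intro mult_right_mono) auto
  then have L: "min cA 1 * norm (ref_map v x - p) + min cA 1 * norm (ref_map w y - p) \<le> ?L"
    using le by (simp add: distrib_left norm_minus_commute[of p])
  have X: "norm (ref_map v x - p) = norm ((1 - x$1 - p1) *\<^sub>R a + (x$1 - x$2 - x$3 - p2) *\<^sub>R b +
      (x$2 - p3) *\<^sub>R c + (x$3 - p4) *\<^sub>R d)"
    unfolding v(1) ref_map_eq p(1) by (simp add: algebra_simps)
  have Y: "norm (ref_map w y - p) = norm ((1 - y$1 - p1) *\<^sub>R a' + (y$1 - y$2 - y$3 - p2) *\<^sub>R b' +
      (y$2 - p3) *\<^sub>R c' + (y$3 - p4) *\<^sub>R d')"
    unfolding w(1) ref_map_eq p(2) by (simp add: algebra_simps)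
  have sums: "(1 - x$1 - p1) + (x$1 - x$2 - x$3 - p2) + (x$2 - p3) + (x$3 - p4) = 0"
    "(1 - y$1 - p1) + (y$1 - y$2 - y$3 - p2) + (y$2 - p3) + (y$3 - p4) = 0" using p(3) by auto
  note bv = barycentric_v[OF sums(1) X] and bw = barycentric_w[OF sums(2) Y]
  show "K * (\<bar>1 - x$1 - p1\<bar> + \<bar>1 - y$1 - p1\<bar>) \<le> ?L"
    using bv(1) bw(1) L unfolding distrib_left by linarith
  show "K * (\<bar>x$1 - x$2 - x$3 - p2\<bar> + \<bar>y$1 - y$2 - y$3 - p2\<bar>) \<le> ?L"
    using bv(2) bw(2) L unfolding distrib_left by linarith
  show "K * (\<bar>x$2 - p3\<bar> + \<bar>y$2 - p3\<bar>) \<le> ?L"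
    using bv(3) bw(3) L unfolding distrib_left by linarith
  show "K * (\<bar>x$3 - p4\<bar> + \<bar>y$3 - p4\<bar>) \<le> ?L"
    using bv(4) bw(4) L unfolding distrib_left by linarith
qed

lemmas geo_vertex = geo[unfolded geometric_assumption_def, THEN conjunct2, THEN conjunct1, rule_format]
lemmas geo_edge = geo[unfolded geometric_assumption_def, THEN conjunct2, THEN conjunct2, THEN conjunct1, rule_format]
lemmas geo_face = geo[unfolded geometric_assumption_def, THEN conjunct2, THEN conjunct2, THEN conjunct2, rule_format]

lemma three_terms:
  assumes "1 \<le> t1 + t2 + t3" "K * t1 \<le> L" "K * t2 \<le> L" "K * t3 \<le> L"
  shows "K \<le> 3 * L"
  using mult_left_mono[OF assms(1), of K] assms(2-) K_le(3) by (simp add: distrib_left)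

text \<open>The common vertex has coordinates 1, 0, 0, 0, and the remaining coordinates of the two
  image points add up to \<open>x$1 + y$1\<close>.\<close>

lemma separation_vertex:
  assumes "ordered_pair Common_Vertex v w" "admissible Common_Vertex (x, y)"
  shows "K \<le> 3 * norm (ref_map v x - ref_map w y)" (is "_ \<le> 3 * ?L")
proof -
  have aa: "a' = a" and int: "tet v \<inter> tet w = {a}" using assms(1) v(1) w(1) by auto
  have x: "x \<in> ref_tet" "y \<in> ref_tet" "1 \<le> x$1 + y$1" using assms(2) by auto
  have le: "cA * (norm (ref_map v x - a) + norm (a - ref_map w y)) \<le> ?L"
    by (intro geo_vertex[OF v(2) w(2) int] ref_map_in_tet x)
  have p: "a = 1 *\<^sub>R a + 0 *\<^sub>R b + 0 *\<^sub>R c + 0 *\<^sub>R d" "a = 1 *\<^sub>R a' + 0 *\<^sub>R b' + 0 *\<^sub>R c' + 0 *\<^sub>R d'"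
    "1 + 0 + 0 + 0 = (1::real)" using aa by auto
  have "K * (\<bar>x$1 - x$2 - x$3\<bar> + \<bar>y$1 - y$2 - y$3\<bar>) \<le> ?L" "K * (\<bar>x$2\<bar> + \<bar>y$2\<bar>) \<le> ?L"
    "K * (\<bar>x$3\<bar> + \<bar>y$3\<bar>) \<le> ?L"
    using via_common_point[OF p le] by simp_all
  moreover have "1 \<le> (\<bar>x$1 - x$2 - x$3\<bar> + \<bar>y$1 - y$2 - y$3\<bar>) + (\<bar>x$2\<bar> + \<bar>y$2\<bar>) + (\<bar>x$3\<bar> + \<bar>y$3\<bar>)"
    using x by (simp add: ref_tet_def)
  ultimately show ?thesis using three_terms by blast
qed

text \<open>The position of \<open>p\<close> on the edge is unknown. The triangle inequality
  eliminates its coordinate and leaves the difference of the first coordinates; those at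
  \<open>c\<close> and \<open>d\<close> are controlled individually, because \<open>p\<close> has
  none there.\<close>

lemma separation_edge:
  assumes "ordered_pair Common_Edge v w" "admissible Common_Edge (x, y)"
  shows "K \<le> 3 * norm (ref_map v x - ref_map w y)"
proof -
  have eq: "a' = a" "b' = b" and int: "tet v \<inter> tet w = convex hull {a, b}"
    using assms(1) v(1) w(1) by auto
  define x' y' where "x' = x + vec3 1 0 0" and "y' = y + vec3 1 0 0"
  have x: "x' \<in> ref_tet" "y' \<in> ref_tet"
    "1 \<le> \<bar>x$1 - y$1\<bar> + (\<bar>x$2\<bar> + \<bar>y$2\<bar>) + (\<bar>x$3\<bar> + \<bar>y$3\<bar>)"
    using assms(2) by (auto simp: x'_def y'_def)
  have "a \<noteq> b" using mesh_vertices(1)[OF mesh v] by (auto simp: card_insert_if split: if_splits)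
  then have "convex hull {a, b} edge_of tet v" "convex hull {a, b} edge_of tet w"
    unfolding edge_of_def v(1) w(1) tet.simps
      face_of_convex_hull_affine_independent[OF mesh_vertices(2)[OF mesh v]]
      face_of_convex_hull_affine_independent[OF mesh_vertices(2)[OF mesh w]]
    using eq by (auto simp: aff_dim_convex_hull aff_dim_2 intro!: exI[of _ "{a, b}"])
  then obtain p where p: "p \<in> convex hull {a, b}"
      "cA * (norm (ref_map v x' - p) + norm (p - ref_map w y')) \<le> norm (ref_map v x' - ref_map w y')"
    using geo_edge[OF v(2) w(2) conjI[OF int conjI] ref_map_in_tet[OF x(1), of v] ref_map_in_tet[OF x(2), of w]]
    by blast
  obtain p1 p2 where "p = p1 *\<^sub>R a + p2 *\<^sub>R b" "p1 + p2 = 1"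
    using p(1) by (auto simp: convex_hull_2)
  then have q: "p = p1 *\<^sub>R a + p2 *\<^sub>R b + 0 *\<^sub>R c + 0 *\<^sub>R d" "p = p1 *\<^sub>R a' + p2 *\<^sub>R b' + 0 *\<^sub>R c' + 0 *\<^sub>R d'"
    "p1 + p2 + 0 + 0 = 1" using eq by auto
  have shift: "ref_map v x' - ref_map w y' = ref_map v x - ref_map w y"
    unfolding v(1) w(1) x'_def y'_def ref_map_shift eq by simp
  have L: "K * (\<bar>1 - x'$1 - p1\<bar> + \<bar>1 - y'$1 - p1\<bar>) \<le> norm (ref_map v x - ref_map w y)"
    "K * (\<bar>x'$2\<bar> + \<bar>y'$2\<bar>) \<le> norm (ref_map v x - ref_map w y)"
    "K * (\<bar>x'$3\<bar> + \<bar>y'$3\<bar>) \<le> norm (ref_map v x - ref_map w y)"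
    using via_common_point[OF q p(2)] unfolding shift by simp_all
  have "\<bar>x$1 - y$1\<bar> \<le> \<bar>1 - x'$1 - p1\<bar> + \<bar>1 - y'$1 - p1\<bar>" by (simp add: x'_def y'_def vec3_def)
  then have "K * \<bar>x$1 - y$1\<bar> \<le> norm (ref_map v x - ref_map w y)"
    using L(1) K_le(3) by (meson less_imp_le mult_left_mono order_trans)
  then show ?thesis using three_terms[OF x(3)] L(2,3) by (simp add: x'_def y'_def vec3_def)
qed

text \<open>As for an edge, but the coordinate of \<open>p\<close> at \<open>c\<close> is unknown
  too, so only a difference remains in the second coordinate.\<close>

lemma separation_face:
  assumes "ordered_pair Common_Face v w" "admissible Common_Face (x, y)"
  shows "K \<le> 3 * norm (ref_map v x - ref_map w y)"
proof -
  have eq: "a' = a" "b' = b" "c' = c" and int: "tet v \<inter> tet w = convex hull {a, b, c}"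
    using assms(1) v(1) w(1) by auto
  define x' y' where "x' = x + vec3 1 0 0" and "y' = y + vec3 1 0 0"
  have x: "x' \<in> ref_tet" "y' \<in> ref_tet"
    "1 \<le> \<bar>x$1 - y$1\<bar> + \<bar>x$2 - y$2\<bar> + (\<bar>x$3\<bar> + \<bar>y$3\<bar>)"
    using assms(2) by (auto simp: x'_def y'_def)
  have face: "{a, b, c, d} - {d} = {a, b, c}" "{a', b', c', d'} - {d'} = {a, b, c}"
    using mesh_vertices(1)[OF mesh v] mesh_vertices(1)[OF mesh w] eq
    by (auto simp: card_insert_if split: if_splits)
  have "convex hull {a, b, c} facet_of tet v" "convex hull {a, b, c} facet_of tet w"
    unfolding v(1) w(1) tet.simps
      facet_of_convex_hull_affine_independent[OF mesh_vertices(2)[OF mesh v]]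
      facet_of_convex_hull_affine_independent[OF mesh_vertices(2)[OF mesh w]]
    by (intro conjI exI[of _ d], auto simp: face)[1] (intro conjI exI[of _ d'], auto simp: face)
  then obtain p where p: "p \<in> convex hull {a, b, c}"
      "cA * (norm (ref_map v x' - p) + norm (p - ref_map w y')) \<le> norm (ref_map v x' - ref_map w y')"
    using geo_face[OF v(2) w(2) conjI[OF int conjI] ref_map_in_tet[OF x(1), of v] ref_map_in_tet[OF x(2), of w]]
    by blast
  obtain p1 p2 p3 where "p = p1 *\<^sub>R a + p2 *\<^sub>R b + p3 *\<^sub>R c" "p1 + p2 + p3 = 1"
    using p(1) by (auto simp: convex_hull_3)
  then have q: "p = p1 *\<^sub>R a + p2 *\<^sub>R b + p3 *\<^sub>R c + 0 *\<^sub>R d" "p = p1 *\<^sub>R a' + p2 *\<^sub>R b' + p3 *\<^sub>R c' + 0 *\<^sub>R d'"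
    "p1 + p2 + p3 + 0 = 1" using eq by auto
  have shift: "ref_map v x' - ref_map w y' = ref_map v x - ref_map w y"
    unfolding v(1) w(1) x'_def y'_def ref_map_shift eq by simp
  have L: "K * (\<bar>1 - x'$1 - p1\<bar> + \<bar>1 - y'$1 - p1\<bar>) \<le> norm (ref_map v x - ref_map w y)"
    "K * (\<bar>x'$2 - p3\<bar> + \<bar>y'$2 - p3\<bar>) \<le> norm (ref_map v x - ref_map w y)"
    "K * (\<bar>x'$3\<bar> + \<bar>y'$3\<bar>) \<le> norm (ref_map v x - ref_map w y)"
    using via_common_point[OF q p(2)] unfolding shift by simp_all
  have "\<bar>x$1 - y$1\<bar> \<le> \<bar>1 - x'$1 - p1\<bar> + \<bar>1 - y'$1 - p1\<bar>" "\<bar>x$2 - y$2\<bar> \<le> \<bar>x'$2 - p3\<bar> + \<bar>y'$2 - p3\<bar>"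
    by (simp_all add: x'_def y'_def vec3_def)
  then have "K * \<bar>x$1 - y$1\<bar> \<le> norm (ref_map v x - ref_map w y)" "K * \<bar>x$2 - y$2\<bar> \<le> norm (ref_map v x - ref_map w y)"
    using L(1,2) K_le(3) by (meson less_imp_le mult_left_mono order_trans)+
  then show ?thesis using three_terms[OF x(3)] L(3) by (simp add: x'_def y'_def vec3_def)
qed

text \<open>Both image points use the same vertices, so their difference is itself a combination
  with coefficient sum zero.\<close>

lemma separation_identical:
  assumes "v = w" "admissible Identical (x, y)"
  shows "K \<le> 3 * norm (ref_map v x - ref_map w y)"
proof -
  define N where "N = norm (ref_map v x - ref_map w y)"
  have X: "N = norm ((y$1 - x$1) *\<^sub>R a + ((x$1 - x$2 - x$3) - (y$1 - y$2 - y$3)) *\<^sub>R b +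
      (x$2 - y$2) *\<^sub>R c + (x$3 - y$3) *\<^sub>R d)"
    unfolding N_def assms(1)[symmetric] v(1) ref_map_eq by (simp add: algebra_simps)
  have le: "min cA 1 * N \<le> N" using cpos by (simp add: N_def mult_left_le_one_le)
  have s: "(y$1 - x$1) + ((x$1 - x$2 - x$3) - (y$1 - y$2 - y$3)) + (x$2 - y$2) + (x$3 - y$3) = 0" by simp
  have "K * \<bar>x$1 - y$1\<bar> \<le> N" "K * \<bar>x$2 - y$2\<bar> \<le> N" "K * \<bar>x$3 - y$3\<bar> \<le> N"
    using barycentric_v[OF s X] le by (auto simp: abs_minus_commute)
  then show ?thesis using assms(2) three_terms unfolding N_def[symmetric] by simp
qed

lemma separation:
  assumes "ordered_pair k v w" "admissible k (x, y)"
  shows "K \<le> 3 * norm (ref_map v x - ref_map w y)"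
proof (cases k)
  case Distant
  then show ?thesis using assms by simp
next
  case Common_Vertex
  then show ?thesis using assms separation_vertex by simp
next
  case Common_Edge
  then show ?thesis using assms separation_edge by simp
next
  case Common_Face
  then show ?thesis using assms separation_face by simp
next
  case Identical
  then show ?thesis using assms separation_identical by simp
qed

text \<open>Both maps send the origin to the common first vertex, which serves as intermediate
  point.\<close>

lemma common_vertex_upper:
  assumes "a = a'" "\<And>i. \<bar>x $ i\<bar> \<le> 1" "\<And>i. \<bar>y $ i\<bar> \<le> 1"
  shows "norm (ref_map v x - ref_map w y) \<le> 3 * diameter (tet v) + 3 * diameter (tet w)"
proof -
  have "ref_map v x - ref_map w y = (ref_map v x - fst v) - (ref_map w y - fst w)"
    using assms(1) v w by simp
  then show ?thesis
    using norm_ref_map_diff_le[OF assms(2), of v] norm_ref_map_diff_le[OF assms(3), of w]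
      norm_triangle_ineq4[of "ref_map v x - fst v" "ref_map w y - fst w"] by simp
qed

end

section \<open>The regularizing transformations\<close>

text \<open>The degree is hidden, since only its finiteness matters for the many explicit
  transformations; a common bound is extracted later.\<close>

definition tpoly :: "(real^'k \<Rightarrow> real) \<Rightarrow> bool" where
  "tpoly f \<longleftrightarrow> (\<exists>d. tensor_poly d f)"

lemma tpoly_intros:
  shows "tpoly f \<Longrightarrow> tpoly g \<Longrightarrow> tpoly (\<lambda>x. f x + g x)"
    and "tpoly f \<Longrightarrow> tpoly g \<Longrightarrow> tpoly (\<lambda>x. f x - g x)"
    and "tpoly f \<Longrightarrow> tpoly g \<Longrightarrow> tpoly (\<lambda>x. f x * g x)"
    and "tpoly f \<Longrightarrow> tpoly (\<lambda>x. - f x)"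
    and "tpoly f \<Longrightarrow> tpoly (\<lambda>x. f x ^ j)"
    and "tpoly (\<lambda>x. x $ l)"
    and "tpoly (\<lambda>x. c)"
proof -
  have same: "\<exists>e. tensor_poly e f \<and> tensor_poly e g" if "tpoly f" "tpoly g" for f g :: "real^'k \<Rightarrow> real"
  proof -
    obtain d e where "tensor_poly d f" "tensor_poly e g" using \<open>tpoly f\<close> \<open>tpoly g\<close> by (auto simp: tpoly_def)
    then have "tensor_poly (max d e) f" "tensor_poly (max d e) g" by (auto intro: tensor_poly_mono)
    then show ?thesis by blast
  qed
  show "tpoly f \<Longrightarrow> tpoly g \<Longrightarrow> tpoly (\<lambda>x. f x + g x)" using same[of f g] by (auto simp: tpoly_def intro: tensor_poly.add)
  show "tpoly f \<Longrightarrow> tpoly g \<Longrightarrow> tpoly (\<lambda>x. f x - g x)" using same[of f g] by (auto simp: tpoly_def intro: tensor_poly_diff)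
  show "tpoly f \<Longrightarrow> tpoly g \<Longrightarrow> tpoly (\<lambda>x. f x * g x)" by (auto simp: tpoly_def intro: tensor_poly_mult)
  show "tpoly f \<Longrightarrow> tpoly (\<lambda>x. - f x)" by (auto simp: tpoly_def intro: tensor_poly_minus)
  show "tpoly f \<Longrightarrow> tpoly (\<lambda>x. f x ^ j)" by (auto simp: tpoly_def intro: tensor_poly_power)
  show "tpoly (\<lambda>x. x $ l)" by (auto simp: tpoly_def intro: tensor_poly_coord[of 1])
  show "tpoly (\<lambda>x. c)" by (auto simp: tpoly_def)
qed

lemma ex_common_degree:
  assumes "finite I" "\<And>i. i \<in> I \<Longrightarrow> tpoly (f i)"
  shows "\<exists>d. \<forall>i\<in>I. tensor_poly d (f i)"
proof -
  obtain e where e: "\<And>i. i \<in> I \<Longrightarrow> tensor_poly (e i) (f i)" using assms(2) unfolding tpoly_def by metis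
  have "tensor_poly (\<Sum>i\<in>I. e i) (f i)" if "i \<in> I" for i
    using e[OF that] by (rule tensor_poly_mono) (auto intro: member_le_sum assms(1) that)
  then show ?thesis by blast
qed

text \<open>The interface between the explicit lists and the error bound: polynomial entries,
  boundedness by 1 and separation of the arguments are all that is used of the
  transformations.\<close>

definition regularizing :: "pair_kind \<Rightarrow> nat \<Rightarrow> (real^'k \<Rightarrow> duffy list) \<Rightarrow> bool" where
  "regularizing k L Ds \<longleftrightarrow> (\<forall>\<eta>. length (Ds \<eta>) = L) \<and>
     (\<forall>m<L. (\<forall>i. tpoly (\<lambda>\<eta>. fst (fst (Ds \<eta> ! m)) $ i) \<and> tpoly (\<lambda>\<eta>. snd (fst (Ds \<eta> ! m)) $ i)) \<and>
       tpoly (\<lambda>\<eta>. snd (Ds \<eta> ! m)) \<and>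
       (\<forall>\<eta>\<in>cbox 0 1. admissible k (fst (Ds \<eta> ! m)) \<and>
          (\<forall>i. abs (fst (fst (Ds \<eta> ! m)) $ i) \<le> 1 \<and> abs (snd (fst (Ds \<eta> ! m)) $ i) \<le> 1) \<and>
          abs (snd (Ds \<eta> ! m)) \<le> 1))"

lemma vec3_nth: "vec3 x y z $ 1 = x" "vec3 x y z $ 2 = y" "vec3 x y z $ 3 = z"
  by (simp_all add: vec3_def)

text \<open>Supplies the nonlinear facts for checking the lists; what is left is linear once
  products are treated as atoms.\<close>

lemma mult_unit:
  fixes x y :: real
  assumes "0 \<le> x" "x \<le> 1" "0 \<le> y" "y \<le> 1"
  shows "0 \<le> x * y" "x * y \<le> x" "x * y \<le> y" "x * y \<le> 1"
proof -
  show "0 \<le> x * y" using assms by simp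
  show "x * y \<le> x" using assms by (simp add: mult_left_le)
  show "x * y \<le> y" using assms by (simp add: mult_left_le_one_le)
  then show "x * y \<le> 1" using assms by simp
qed

lemma regularizing_T: "regularizing Identical 9 duffy_T"
proof -
  have b: "0 \<le> \<eta>$1 \<and> \<eta>$1 \<le> 1 \<and> 0 \<le> \<eta>$2 \<and> \<eta>$2 \<le> 1 \<and>
     0 \<le> \<eta>$1 * \<eta>$2 \<and> \<eta>$1 * \<eta>$2 \<le> \<eta>$1 \<and> \<eta>$1 * \<eta>$2 \<le> \<eta>$2" if "\<eta> \<in> cbox 0 1" for \<eta> :: "real^2"
    using that mult_unit[of "\<eta>$1" "\<eta>$2"] by (simp add: cbox_01_iff)
  have poly: "tpoly (\<lambda>\<eta>. fst (fst (duffy_T \<eta> ! m)) $ i)" "tpoly (\<lambda>\<eta>. snd (fst (duffy_T \<eta> ! m)) $ i)"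
     "tpoly (\<lambda>\<eta>. snd (duffy_T \<eta> ! m))" if "m < 9" for m i
    using that exhaust_3[of i]
    by (auto simp: numeral_eq_Suc less_Suc_eq duffy_T_def Let_def vec3_nth intro!: tpoly_intros)
  have bd: "admissible Identical (fst (duffy_T \<eta> ! m)) \<and>
          (\<forall>i. abs (fst (fst (duffy_T \<eta> ! m)) $ i) \<le> 1 \<and> abs (snd (fst (duffy_T \<eta> ! m)) $ i) \<le> 1) \<and>
          abs (snd (duffy_T \<eta> ! m)) \<le> 1" if "m < 9" "\<eta> \<in> cbox 0 1" for m \<eta>
    using that(1) b[OF that(2)]
    by (auto simp: numeral_eq_Suc less_Suc_eq duffy_T_def Let_def vec3_nth forall_3 right_diff_distrib)
  show ?thesis using poly bd by (simp add: regularizing_def duffy_T_def Let_def)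
qed

lemma regularizing_V: "regularizing Common_Vertex 2 duffy_V"
proof -
  have poly: "tpoly (\<lambda>\<eta>. fst (fst (duffy_V \<eta> ! m)) $ i)" "tpoly (\<lambda>\<eta>. snd (fst (duffy_V \<eta> ! m)) $ i)"
     "tpoly (\<lambda>\<eta>. snd (duffy_V \<eta> ! m))" if "m < 2" for m i
    using that exhaust_3[of i]
    by (auto simp: numeral_eq_Suc less_Suc_eq duffy_V_def Let_def vec3_nth intro!: tpoly_intros)
  have bd: "admissible Common_Vertex (fst (duffy_V \<eta> ! m)) \<and>
          (\<forall>i. abs (fst (fst (duffy_V \<eta> ! m)) $ i) \<le> 1 \<and> abs (snd (fst (duffy_V \<eta> ! m)) $ i) \<le> 1) \<and>
          abs (snd (duffy_V \<eta> ! m)) \<le> 1" if "m < 2" "\<eta> \<in> cbox 0 1" for m \<eta>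
  proof -
    have u: "0 \<le> \<eta>$l" "\<eta>$l \<le> 1" for l using that(2) by (auto simp: cbox_01_iff)
    note a = mult_unit[OF u[of 1] u[of 2]] and b = mult_unit[OF u[of 3] u[of 4]]
    note c = mult_unit[OF b(1,4) u[of 5]]
    note j = mult_unit[OF mult_unit(1,4)[OF u[of 1] mult_unit(1,4)[OF u[of 3] u[of 3]]] u[of 4]]
    show ?thesis using that(1) u[of 1] u[of 2] u[of 3] u[of 4] u[of 5] a b c j
      by (auto simp: numeral_eq_Suc less_Suc_eq duffy_V_def Let_def vec3_nth forall_3 ref_tet_def algebra_simps simp del: mult_nonneg_nonneg)
  qed
  show ?thesis using poly bd by (simp add: regularizing_def duffy_V_def Let_def)
qed

lemma regularizing_E: "regularizing Common_Edge 4 duffy_E"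
proof -
  have poly: "tpoly (\<lambda>\<eta>. fst (fst (duffy_E \<eta> ! m)) $ i)" "tpoly (\<lambda>\<eta>. snd (fst (duffy_E \<eta> ! m)) $ i)"
     "tpoly (\<lambda>\<eta>. snd (duffy_E \<eta> ! m))" if "m < 4" for m i
    using that exhaust_3[of i]
    by (auto simp: numeral_eq_Suc less_Suc_eq duffy_E_def Let_def vec3_nth intro!: tpoly_intros)
  have bd: "admissible Common_Edge (fst (duffy_E \<eta> ! m)) \<and>
          (\<forall>i. abs (fst (fst (duffy_E \<eta> ! m)) $ i) \<le> 1 \<and> abs (snd (fst (duffy_E \<eta> ! m)) $ i) \<le> 1) \<and>
          abs (snd (duffy_E \<eta> ! m)) \<le> 1" if "m < 4" "\<eta> \<in> cbox 0 1" for m \<eta>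
  proof -
    have u: "0 \<le> \<eta>$l" "\<eta>$l \<le> 1" for l using that(2) by (auto simp: cbox_01_iff)
    note a = mult_unit[OF u[of 2] u[of 3]] and b = mult_unit[OF u[of 3] u[of 4]] and d = mult_unit[OF u[of 1] u[of 2]]
    note c = mult_unit[OF a(1,4) u[of 4]]
    note j = mult_unit[OF mult_unit(1,4)[OF u[of 2] u[of 2]] u[of 3]] mult_unit[OF u[of 1] u[of 3]]
    show ?thesis using that(1) u[of 1] u[of 2] u[of 3] u[of 4] a b c d j
      by (auto simp: numeral_eq_Suc less_Suc_eq duffy_E_def Let_def vec3_nth forall_3 ref_tet_def algebra_simps simp del: mult_nonneg_nonneg)
  qed
  show ?thesis using poly bd by (simp add: regularizing_def duffy_E_def Let_def)
qed

text \<open>In every pair the first coordinate of one point is zero, and so is the second coordinate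
  of one point, so differences reduce to absolute values; for one of the two points the three
  absolute values sum to exactly 1.\<close>

lemma regularizing_F: "regularizing Common_Face 17 duffy_F"
proof -
  have poly: "tpoly (\<lambda>\<eta>. fst (fst (duffy_F \<eta> ! m)) $ i)" "tpoly (\<lambda>\<eta>. snd (fst (duffy_F \<eta> ! m)) $ i)"
     "tpoly (\<lambda>\<eta>. snd (duffy_F \<eta> ! m))" if "m < 17" for m i
    using that exhaust_3[of i]
    by (auto simp: numeral_eq_Suc less_Suc_eq duffy_F_def Let_def vec3_nth intro!: tpoly_intros)
  have bd: "admissible Common_Face (fst (duffy_F \<eta> ! m)) \<and>
          (\<forall>i. abs (fst (fst (duffy_F \<eta> ! m)) $ i) \<le> 1 \<and> abs (snd (fst (duffy_F \<eta> ! m)) $ i) \<le> 1) \<and>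
          abs (snd (duffy_F \<eta> ! m)) \<le> 1" if "m < 17" "\<eta> \<in> cbox 0 1" for m \<eta>
  proof -
    have u: "0 \<le> \<eta>$l" "\<eta>$l \<le> 1" for l using that(2) by (auto simp: cbox_01_iff)
    note a = mult_unit[OF u[of 1] u[of 2]] and b = mult_unit[OF u[of 1] u[of 3]]
    note c = mult_unit[OF a(1,4) u[of 3]]
    note j = mult_unit[OF mult_unit(1,4)[OF u[of 1] u[of 1]] u[of 2]] mult_unit[OF u[of 1] u[of 1]]
    show ?thesis using that(1) u[of 1] u[of 2] u[of 3] a b c j
      by (auto simp: numeral_eq_Suc less_Suc_eq duffy_F_def Let_def vec3_nth forall_3 ref_tet_def algebra_simps simp del: mult_nonneg_nonneg)
  qed
  show ?thesis using poly bd by (simp add: regularizing_def duffy_F_def Let_def)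
qed

section \<open>Quadrature error bounds\<close>

text \<open>Reduces the error estimate to writing the integrand as \<open>L\<close> terms and
  checking the scaled bounds. The powers of \<open>h\<close> combine to 6 - (3 + 2s).\<close>

lemma quadrature_error_sum_terms:
  fixes s m M B :: real and d L :: nat
  assumes mM: "0 < m" "m \<le> M" "0 \<le> B"
  shows "\<exists>C>0. \<exists>\<rho>>1/2. \<forall>(g :: real^'k \<Rightarrow> real) P q h n. 0 < h \<longrightarrow> 1 \<le> n \<longrightarrow>
       (\<forall>j<L. tensor_poly d (q j) \<and> tensor_poly d (P j)) \<longrightarrow>
       (\<forall>j<L. \<forall>x\<in>cbox 0 1. m * h\<^sup>2 \<le> q j x \<and> q j x \<le> M * h\<^sup>2 \<and> \<bar>P j x\<bar> \<le> B * h ^ 6) \<longrightarrow>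
       (\<forall>x\<in>cbox 0 1. g x = (\<Sum>j<L. P j x * q j x powr (- ((3 + 2 * s) / 2)))) \<longrightarrow>
       \<bar>quadrature_error n g\<bar> \<le> C * h powr (3 - 2 * s) * (2 * \<rho>) powr (- 2 * real n)"
proof -
  define \<alpha> where "\<alpha> = (3 + 2 * s) / 2"
  obtain C0 r where C0: "C0 > 0" "0 < r" "r < 1" and approx:
    "\<And>(q :: real^'k \<Rightarrow> real) P h B N.
       h > 0 \<Longrightarrow> tensor_poly d q \<Longrightarrow> tensor_poly d P \<Longrightarrow>
       (\<And>x. x \<in> cbox 0 1 \<Longrightarrow> m * h\<^sup>2 \<le> q x \<and> q x \<le> M * h\<^sup>2 \<and> \<bar>P x\<bar> \<le> B) \<Longrightarrow>
       \<exists>p. tensor_poly N p \<and>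
         (\<forall>x\<in>cbox 0 1. \<bar>P x * q x powr (- \<alpha>) - p x\<bar> \<le> C0 * B * (h\<^sup>2) powr (- \<alpha>) * r ^ N)"
    using approx_negative_powr[OF mM(1,2), of d \<alpha>, where 'k = 'k] by metis
  \<comment> \<open>Division by \<open>r\<close> turns the power 2n - 1 into 2n; adding 1 keeps
    \<open>C\<close> positive when \<open>L\<close> or \<open>B\<close> is zero.\<close>
  define C where "C = 2 * (real L * (C0 * B / r)) + 1"
  define \<rho> where "\<rho> = 1 / (2 * r)"
  have bound: "\<bar>quadrature_error n g\<bar> \<le> C * h powr (3 - 2 * s) * (2 * \<rho>) powr (- 2 * real n)"
    if h: "0 < h" and n: "1 \<le> n"
      and poly: "\<And>j. j < L \<Longrightarrow> tensor_poly d (q j) \<and> tensor_poly d (P j)"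
      and bd: "\<And>j x. j < L \<Longrightarrow> x \<in> cbox 0 1 \<Longrightarrow>
          m * h\<^sup>2 \<le> q j x \<and> q j x \<le> M * h\<^sup>2 \<and> \<bar>P j x\<bar> \<le> B * h ^ 6"
      and g: "\<And>x. x \<in> cbox 0 1 \<Longrightarrow> g x = (\<Sum>j<L. P j x * q j x powr (- ((3 + 2 * s) / 2)))"
    for g :: "real^'k \<Rightarrow> real" and P q h n
  proof -
    define N where "N = 2 * n - 1"
    define e where "e = C0 * (B * h ^ 6) * (h\<^sup>2) powr (- \<alpha>) * r ^ N"
    have "\<exists>p. tensor_poly N p \<and> (\<forall>x\<in>cbox 0 1. \<bar>P j x * q j x powr (- \<alpha>) - p x\<bar> \<le> e)"
      if "j < L" for j
      unfolding e_def using poly[OF that] bd[OF that] by (intro approx h) auto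
    then obtain p where p: "\<And>j. j < L \<Longrightarrow> tensor_poly N (p j)"
      "\<And>j x. j < L \<Longrightarrow> x \<in> cbox 0 1 \<Longrightarrow> \<bar>P j x * q j x powr (- \<alpha>) - p j x\<bar> \<le> e" by metis
    have qpos: "0 < q j x" if "j < L" "x \<in> cbox 0 1" for j x
    proof -
      have "0 < m * h\<^sup>2" using mM h by simp
      then show ?thesis using bd[OF that] by linarith
    qed
    have "continuous_on (cbox 0 1) (\<lambda>x. \<Sum>j<L. P j x * q j x powr (- \<alpha>))"
      using poly qpos
      by (intro continuous_on_sum continuous_on_mult continuous_on_powr continuous_on_const
          continuous_on_tensor_poly[of d]) (auto simp: less_le)
    then have cont: "continuous_on (cbox 0 1) g"
      by (rule continuous_on_eq) (simp add: g \<alpha>_def)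
    have "\<bar>quadrature_error n g\<bar> \<le> 2 * (real L * e)"
    proof (rule quadrature_error_le[OF cont n])
      show "tensor_poly (2 * n - 1) (\<lambda>x. \<Sum>j<L. p j x)"
        using p(1) by (intro tensor_poly_sum) (auto simp: N_def)
      fix x :: "real^'k" assume x: "x \<in> cbox 0 1"
      have "\<bar>g x - (\<Sum>j<L. p j x)\<bar> = \<bar>\<Sum>j<L. P j x * q j x powr (- \<alpha>) - p j x\<bar>"
        using g[OF x] by (simp add: \<alpha>_def sum_subtractf)
      also have "\<dots> \<le> (\<Sum>j<L. \<bar>P j x * q j x powr (- \<alpha>) - p j x\<bar>)" by (rule sum_abs)
      also have "\<dots> \<le> (\<Sum>j<L. e)" using p(2) x by (intro sum_mono) auto
      finally show "\<bar>g x - (\<Sum>j<L. p j x)\<bar> \<le> real L * e" by simp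
    qed
    also have "e = (C0 * B / r) * h powr (3 - 2 * s) * (2 * \<rho>) powr (- 2 * real n)"
    proof -
      have "h ^ 6 = h powr 6" "h\<^sup>2 = h powr 2" using h by simp_all
      then have "h ^ 6 * (h\<^sup>2) powr (- \<alpha>) = h powr (6 + 2 * (- \<alpha>))"
        by (simp only: powr_powr powr_add)
      also have "6 + 2 * (- \<alpha>) = 3 - 2 * s" by (simp add: \<alpha>_def field_simps)
      finally have "h ^ 6 * (h\<^sup>2) powr (- \<alpha>) = h powr (3 - 2 * s)" .
      moreover have "r ^ N = (2 * \<rho>) powr (- 2 * real n) / r"
      proof -
        have "r ^ N * r = r ^ (2 * n)" using n by (simp add: N_def flip: power_Suc2)
        also have "\<dots> = r powr (2 * real n)" using C0 by (simp flip: powr_realpow)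
        also have "\<dots> = (2 * \<rho>) powr (- 2 * real n)"
          using C0 by (simp add: \<rho>_def powr_divide powr_minus)
        finally show ?thesis using C0 by (simp add: field_simps)
      qed
      ultimately show ?thesis by (simp add: e_def mult_ac)
    qed
    also have "2 * (real L * ((C0 * B / r) * h powr (3 - 2 * s) * (2 * \<rho>) powr (- 2 * real n))) =
        (2 * (real L * (C0 * B / r))) * (h powr (3 - 2 * s) * (2 * \<rho>) powr (- 2 * real n))"
      by (simp only: mult_ac)
    also have "\<dots> \<le> C * (h powr (3 - 2 * s) * (2 * \<rho>) powr (- 2 * real n))"
      by (intro mult_right_mono) (auto simp: C_def)
    finally show ?thesis by (simp only: mult.assoc)
  qed
  have "0 < C" using C0 mM by (auto simp: C_def intro!: add_nonneg_pos)
  moreover have "1 / 2 < \<rho>" using C0 by (simp add: \<rho>_def field_simps)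
  ultimately show ?thesis
  proof (intro exI conjI allI impI)
    fix g :: "real^'k \<Rightarrow> real" and P q and h :: real and n :: nat
    assume "0 < h" "1 \<le> n" "\<forall>j<L. tensor_poly d (q j) \<and> tensor_poly d (P j)"
      "\<forall>j<L. \<forall>x\<in>cbox 0 1. m * h\<^sup>2 \<le> q j x \<and> q j x \<le> M * h\<^sup>2 \<and> \<bar>P j x\<bar> \<le> B * h ^ 6"
      "\<forall>x\<in>cbox 0 1. g x = (\<Sum>j<L. P j x * q j x powr (- ((3 + 2 * s) / 2)))"
    then show "\<bar>quadrature_error n g\<bar> \<le> C * h powr (3 - 2 * s) * (2 * \<rho>) powr (- 2 * real n)"
      by (intro bound[where P = P and q = q]) blast+
  qed
qed

section \<open>Polynomial form and size of the ingredients of the integrands\<close>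

lemma tensor_poly_ref_map:
  assumes "\<And>i. tensor_poly d (\<lambda>\<eta>. X \<eta> $ i)"
  shows "tensor_poly d (\<lambda>\<eta>. nodal_interp f v (X \<eta>))" "tensor_poly d (\<lambda>\<eta>. ref_map v (X \<eta>) $ l)"
proof -
  obtain a b c e where v: "v = (a, b, c, e)" by (cases v)
  have "tensor_poly d (\<lambda>\<eta>. t1 * (1 - X \<eta> $ 1) + t2 * (X \<eta> $ 1 - X \<eta> $ 2 - X \<eta> $ 3) + t3 * X \<eta> $ 2 + t4 * X \<eta> $ 3)"
    for t1 t2 t3 t4 :: real
    by (intro tensor_poly.add tensor_poly_cmult tensor_poly_diff assms tensor_poly_const)
  from this[of "f a" "f b" "f c" "f e"] this[of "a $ l" "b $ l" "c $ l" "e $ l"]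
  show "tensor_poly d (\<lambda>\<eta>. nodal_interp f v (X \<eta>))" "tensor_poly d (\<lambda>\<eta>. ref_map v (X \<eta>) $ l)"
    by (simp_all add: nodal_interp_def v ref_map_eq mult.commute)
qed

lemma tensor_poly_norm_diff:
  assumes "\<And>i. tensor_poly d (\<lambda>\<eta>. X \<eta> $ i)" "\<And>i. tensor_poly d (\<lambda>\<eta>. Y \<eta> $ i)"
  shows "tensor_poly (2 * d) (\<lambda>\<eta>. (norm (ref_map v (X \<eta>) - ref_map w (Y \<eta>)))\<^sup>2)"
proof -
  have "tensor_poly (d * 2) (\<lambda>\<eta>. \<Sum>i\<in>UNIV. (ref_map v (X \<eta>) $ i - ref_map w (Y \<eta>) $ i) ^ 2)"
    by (intro tensor_poly_sum tensor_poly_power tensor_poly_diff tensor_poly_ref_map assms)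
  moreover have "(norm z)\<^sup>2 = (\<Sum>i\<in>UNIV. (z $ i)\<^sup>2)" for z :: "real^3"
    unfolding power2_norm_eq_inner inner_vec_def by (simp add: power2_eq_square)
  ultimately show ?thesis by (simp add: mult.commute)
qed

text \<open>Passes to the squared distance, which is polynomial in the quadrature variables while
  the distance is not.\<close>

lemma norm_powr_eq: "norm x powr t = ((norm x)\<^sup>2) powr (t / 2)"
proof (cases "norm x = 0")
  case False
  then have "(norm x)\<^sup>2 = norm x powr 2" by simp
  then show ?thesis by (simp only: powr_powr) simp
qed simp

lemma diameter_tet_nonneg: "0 \<le> diameter (tet v)"
proof -
  obtain a b c d where "v = (a, b, c, d)" by (cases v)
  then show ?thesis by (simp add: diameter_ge_0 bounded_convex_hull finite_imp_bounded)
qed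

lemma det_product_le:
  assumes "diameter (tet v) \<le> H" "diameter (tet w) \<le> H"
  shows "\<bar>det (ref_mat v)\<bar> * \<bar>det (ref_mat w)\<bar> \<le> 36 * H ^ 6"
proof -
  note d = diameter_tet_nonneg[of v] diameter_tet_nonneg[of w]
  have "\<bar>det (ref_mat v)\<bar> \<le> 6 * H ^ 3" "\<bar>det (ref_mat w)\<bar> \<le> 6 * H ^ 3"
    by (intro order_trans[OF abs_det_ref_mat_le] mult_left_mono power_mono assms d; simp)+
  then have "\<bar>det (ref_mat v)\<bar> * \<bar>det (ref_mat w)\<bar> \<le> (6 * H ^ 3) * (6 * H ^ 3)"
    by (rule mult_mono) (use d order_trans[OF d(1) assms(1)] in simp_all)
  also have "(6 * H ^ 3) * (6 * H ^ 3) = 36 * H ^ 6" by algebra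
  finally show ?thesis .
qed

lemma duffy_tet_in_ref_tet:
  assumes "0 \<le> e1" "e1 \<le> 1" "0 \<le> e2" "e2 \<le> 1" "0 \<le> e3" "e3 \<le> 1"
  shows "duffy_tet e1 e2 e3 \<in> ref_tet"
proof -
  note m = mult_unit[OF assms(1-4)]
  have "0 \<le> e1 * e2 * e3" "e1 * e2 * e3 \<le> e1 * e2" using mult_unit[OF m(1,4) assms(5,6)] by auto
  then show ?thesis using m assms by (simp add: ref_tet_def duffy_tet_def vec3_nth right_diff_distrib)
qed

lemma ref_tet_coord_bounds: "x \<in> ref_tet \<Longrightarrow> abs (x $ i) \<le> 1"
  using exhaust_3[of i] by (auto simp: ref_tet_def)

lemma ordered_pair_first_vertex: "ordered_pair k v w \<Longrightarrow> k \<noteq> Distant \<Longrightarrow> fst v = fst w"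
  by (cases k; cases v; cases w) auto

lemma regularized_eq_sum:
  assumes "length (Ds \<eta>) = L"
  shows "regularized s f g v w Ds \<eta> = (\<Sum>j<L. kernel1 s f g v w (fst (Ds \<eta> ! j)) * snd (Ds \<eta> ! j))"
  using assms by (simp add: regularized_def sum_list_sum_nth case_prod_beta atLeast0LessThan)

text \<open>The squared distance is bounded below by \<open>separation\<close> and above by
  \<open>common_vertex_upper\<close>; the numerator is bounded through the vertex values of the
  nodal functions and \<open>det_product_le\<close>.\<close>

lemma regularized_quadrature_error:
  fixes Ds :: "real^'k \<Rightarrow> duffy list" and \<theta> c1 c2 cA s :: real and \<Omega> :: "(real^3) set"
  assumes reg: "regularizing k L Ds" and pos: "0 < \<theta>" "0 < c1" "0 < c2" "0 < cA"
  shows "\<exists>C>0. \<exists>\<rho>>1/2. \<forall>\<T> N \<phi>.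
     tet_mesh \<Omega> \<T> \<and> shape_regular \<theta> \<T> \<and> quasi_uniform c1 c2 \<T> \<and>
     geometric_assumption cA \<Omega> \<T> \<and> nodal_basis \<Omega> \<T> N \<phi> \<longrightarrow>
     (\<forall>i\<in>{1..N}. \<forall>j\<in>{1..N}. \<forall>v w. tet v \<in> \<T> \<and> tet w \<in> \<T> \<and> ordered_pair k v w \<longrightarrow>
        (\<forall>n\<ge>1. \<bar>quadrature_error n (regularized s (\<phi> i) (\<phi> j) v w Ds)\<bar>
           \<le> C * mesh_size \<T> powr (3 - 2 * s) * (2 * \<rho>) powr (- 2 * real n)))"
proof -
  define X where "X m \<eta> = fst (fst (Ds \<eta> ! m))" for m \<eta>
  define Y where "Y m \<eta> = snd (fst (Ds \<eta> ! m))" for m \<eta>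
  define J where "J m \<eta> = snd (Ds \<eta> ! m)" for m \<eta>
  have len: "\<And>\<eta>. length (Ds \<eta>) = L" using reg by (simp add: regularizing_def)
  have tp: "tpoly (\<lambda>\<eta>. X m \<eta> $ i)" "tpoly (\<lambda>\<eta>. Y m \<eta> $ i)" "tpoly (J m)" if "m < L" for m i
    using reg that by (auto simp: regularizing_def X_def Y_def J_def[abs_def])
  have adm: "admissible k (X m \<eta>, Y m \<eta>)" "abs (X m \<eta> $ i) \<le> 1" "abs (Y m \<eta> $ i) \<le> 1" "abs (J m \<eta>) \<le> 1"
    if "m < L" "\<eta> \<in> cbox 0 1" for m \<eta> i
    using reg that by (auto simp: regularizing_def X_def Y_def J_def)
  have "\<exists>e. \<forall>p\<in>{..<L} \<times> (UNIV :: 3 set). tensor_poly e (\<lambda>\<eta>. X (fst p) \<eta> $ snd p)"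
    by (rule ex_common_degree) (use tp in auto)
  then obtain d1 where d1: "\<And>m i. m < L \<Longrightarrow> tensor_poly d1 (\<lambda>\<eta>. X m \<eta> $ i)" by auto
  have "\<exists>e. \<forall>p\<in>{..<L} \<times> (UNIV :: 3 set). tensor_poly e (\<lambda>\<eta>. Y (fst p) \<eta> $ snd p)"
    by (rule ex_common_degree) (use tp in auto)
  then obtain d2 where d2: "\<And>m i. m < L \<Longrightarrow> tensor_poly d2 (\<lambda>\<eta>. Y m \<eta> $ i)" by auto
  have "\<exists>e. \<forall>m\<in>{..<L}. tensor_poly e (J m)"
    by (rule ex_common_degree) (use tp in auto)
  then obtain d3 where d3: "\<And>m. m < L \<Longrightarrow> tensor_poly d3 (J m)" by auto
  define d where "d = d1 + d2 + d3"
  have tX: "tensor_poly d (\<lambda>\<eta>. X m \<eta> $ i)" if "m < L" for m i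
    using d1[OF that] by (rule tensor_poly_mono) (simp add: d_def)
  have tY: "tensor_poly d (\<lambda>\<eta>. Y m \<eta> $ i)" if "m < L" for m i
    using d2[OF that] by (rule tensor_poly_mono) (simp add: d_def)
  have tJ: "tensor_poly d (J m)" if "m < L" for m
    using d3[OF that] by (rule tensor_poly_mono) (simp add: d_def)
  \<comment> \<open>The constants precede the mesh, whereas \<open>\<theta> < pi\<close> is known
    only once there is an element. Otherwise the value 1 keeps \<open>k0\<close> positive.\<close>
  define k0 where "k0 = min cA 1 * (if \<theta> < pi then height_const \<theta> else 1) / c2"
  have k0: "0 < k0" using pos by (auto simp: k0_def height_const_pos)
  define lb where "lb = (k0 / 3)\<^sup>2"
  \<comment> \<open>Three diameters from each element, each at most \<open>h / c1\<close>; the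
    summand \<open>lb\<close> ensures \<open>lb \<le> ub\<close> without reference to a
    mesh.\<close>
  define ub where "ub = (6 / c1)\<^sup>2 + lb"
  \<comment> \<open>Each factor of the numerator is a difference of two values bounded by 7, and the
    two determinants contribute 36 (h / c1)^6.\<close>
  define B where "B = 14 * 14 * (36 / c1 ^ 6)"
  have bounds: "0 < lb" "lb \<le> ub" "0 \<le> B" using k0 pos by (auto simp: lb_def ub_def B_def)
  \<comment> \<open>\<open>4 * d\<close> covers the degree \<open>2 * d\<close> of the squared
    distance and the degree \<open>3 * d\<close> of the numerator.\<close>
  obtain C \<rho> where C: "0 < C" "1 / 2 < \<rho>" and main:
    "\<forall>(g :: real^'k \<Rightarrow> real) P q h n. 0 < h \<longrightarrow> 1 \<le> n \<longrightarrow>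
       (\<forall>j<L. tensor_poly (4 * d) (q j) \<and> tensor_poly (4 * d) (P j)) \<longrightarrow>
       (\<forall>j<L. \<forall>x\<in>cbox 0 1. lb * h\<^sup>2 \<le> q j x \<and> q j x \<le> ub * h\<^sup>2 \<and> \<bar>P j x\<bar> \<le> B * h ^ 6) \<longrightarrow>
       (\<forall>x\<in>cbox 0 1. g x = (\<Sum>j<L. P j x * q j x powr (- ((3 + 2 * s) / 2)))) \<longrightarrow>
       \<bar>quadrature_error n g\<bar> \<le> C * h powr (3 - 2 * s) * (2 * \<rho>) powr (- 2 * real n)"
    using quadrature_error_sum_terms[OF bounds] by blast
  have "\<bar>quadrature_error n (regularized s (\<phi> i) (\<phi> j) v w Ds)\<bar>
      \<le> C * mesh_size \<T> powr (3 - 2 * s) * (2 * \<rho>) powr (- 2 * real n)"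
    if mesh: "tet_mesh \<Omega> \<T>" and shape: "shape_regular \<theta> \<T>" and quasi: "quasi_uniform c1 c2 \<T>"
      and geo: "geometric_assumption cA \<Omega> \<T>" and basis: "nodal_basis \<Omega> \<T> N \<phi>"
      and ij: "i \<in> {1..N}" "j \<in> {1..N}" and vw: "tet v \<in> \<T>" "tet w \<in> \<T>" "ordered_pair k v w" and n: "n \<ge> 1"
    for \<T> N \<phi> i j v w n
  proof -
    define h where "h = mesh_size \<T>"
    obtain a b c e where v: "v = (a, b, c, e)" by (cases v)
    obtain a' b' c' e' where w: "w = (a', b', c', e')" by (cases w)
    have "\<theta> < pi" using regular_v(1)[OF pos(1,3,4) mesh shape quasi geo v vw(1) w vw(2) refl] .
    then have K: "k0 * h = min cA 1 * height_const \<theta> / c2 * mesh_size \<T>" by (simp add: k0_def h_def)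
    have diam: "diameter (tet v) \<le> h / c1" "diameter (tet w) \<le> h / c1"
      using mesh_size_bounds(1)[OF mesh v vw(1) quasi] mesh_size_bounds(1)[OF mesh w vw(2) quasi] pos
      by (auto simp: h_def field_simps)
    have h: "0 < h" using diameter_tet_pos[OF mesh v vw(1)] diam(1) pos(2)
      by (meson less_le_trans zero_less_divide_iff less_asym)
    define D where "D = \<bar>det (ref_mat v)\<bar> * \<bar>det (ref_mat w)\<bar>"
    have D: "0 \<le> D" "D \<le> 36 / c1 ^ 6 * h ^ 6"
      using det_product_le[OF diam] by (auto simp: D_def power_divide)
    define F where "F f m \<eta> = nodal_interp f v (X m \<eta>) - nodal_interp f w (Y m \<eta>)" for f m \<eta>
    define q where "q m \<eta> = (norm (ref_map v (X m \<eta>) - ref_map w (Y m \<eta>)))\<^sup>2" for m \<eta>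
    define P where "P m \<eta> = D * (F (\<phi> i) m \<eta> * F (\<phi> j) m \<eta> * J m \<eta>)" for m \<eta>
    have fe: "\<phi> i \<in> fe_space \<Omega> \<T>" "\<phi> j \<in> fe_space \<Omega> \<T>"
      using nodal_basis_vertex_values(1)[OF mesh v vw(1) basis] ij by auto
    have F_le: "\<bar>F (\<phi> l) m \<eta>\<bar> \<le> 14" if "m < L" "\<eta> \<in> cbox 0 1" "l \<in> {1..N}" for l m \<eta>
    proof -
      have "\<bar>nodal_interp (\<phi> l) v (X m \<eta>)\<bar> \<le> 7"
        using nodal_basis_vertex_values(2)[OF mesh v vw(1) basis that(3)] adm(2)[OF that(1,2)]
        by (intro abs_nodal_interp_le[OF v]) auto
      moreover have "\<bar>nodal_interp (\<phi> l) w (Y m \<eta>)\<bar> \<le> 7"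
        using nodal_basis_vertex_values(2)[OF mesh w vw(2) basis that(3)] adm(3)[OF that(1,2)]
        by (intro abs_nodal_interp_le[OF w]) auto
      ultimately show ?thesis unfolding F_def by linarith
    qed
    show ?thesis unfolding h_def[symmetric]
    proof (rule main[rule_format, where P = P and q = q, OF h n])
      fix m assume m: "m < L"
      have "tensor_poly (2 * d) (q m)"
        unfolding q_def[abs_def] using tX[OF m] tY[OF m] by (rule tensor_poly_norm_diff)
      moreover have "tensor_poly (d + d + d) (P m)"
        unfolding P_def[abs_def] F_def
        by (intro tensor_poly_cmult tensor_poly_mult tensor_poly_diff tensor_poly_ref_map tX tY tJ m)
      ultimately show "tensor_poly (4 * d) (q m) \<and> tensor_poly (4 * d) (P m)"
        by (auto elim!: tensor_poly_mono)
    next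
      fix m \<eta> assume m: "m < L" and \<eta>: "\<eta> \<in> cbox 0 (1 :: real^'k)"
      let ?N = "norm (ref_map v (X m \<eta>) - ref_map w (Y m \<eta>))"
      have lower: "k0 * h \<le> 3 * ?N"
        using separation[OF pos(1,3,4) mesh shape quasi geo v vw(1) w vw(2) K vw(3) adm(1)[OF m \<eta>]] .
      have "(k0 / 3 * h)\<^sup>2 \<le> ?N\<^sup>2"
        using lower k0 h by (intro power_mono) auto
      then have 1: "lb * h\<^sup>2 \<le> q m \<eta>" unfolding lb_def q_def power_mult_distrib .
      have "k \<noteq> Distant"
      proof
        assume "k = Distant"
        then show False using adm(1)[OF m \<eta>] by (simp only: admissible.simps)
      qed
      then have "a = a'" using ordered_pair_first_vertex[OF vw(3)] v w by simp
      then have "?N \<le> 3 * diameter (tet v) + 3 * diameter (tet w)"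
        using common_vertex_upper[OF pos(1,3,4) mesh shape quasi geo v vw(1) w vw(2) refl]
          adm(2,3)[OF m \<eta>] by blast
      also have "\<dots> \<le> 6 / c1 * h" using diam by simp
      finally have "?N\<^sup>2 \<le> (6 / c1 * h)\<^sup>2" by (intro power_mono) auto
      also have "\<dots> \<le> ub * h\<^sup>2"
        unfolding ub_def power_mult_distrib using \<open>0 < lb\<close> by (intro mult_right_mono) auto
      finally have 2: "q m \<eta> \<le> ub * h\<^sup>2" by (simp add: q_def)
      have "\<bar>F (\<phi> i) m \<eta> * F (\<phi> j) m \<eta> * J m \<eta>\<bar> \<le> 14 * 14 * 1"
        unfolding abs_mult using F_le[OF m \<eta>] adm(4)[OF m \<eta>] ij by (intro mult_mono) auto
      then have "\<bar>P m \<eta>\<bar> \<le> (36 / c1 ^ 6 * h ^ 6) * (14 * 14 * 1)"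
        unfolding P_def abs_mult[of D] using D by (intro mult_mono) auto
      then have 3: "\<bar>P m \<eta>\<bar> \<le> B * h ^ 6" by (simp add: B_def mult_ac)
      show "lb * h\<^sup>2 \<le> q m \<eta> \<and> q m \<eta> \<le> ub * h\<^sup>2 \<and> \<bar>P m \<eta>\<bar> \<le> B * h ^ 6" using 1 2 3 by simp
    next
      fix \<eta> :: "real^'k" assume "\<eta> \<in> cbox 0 1"
      have "kernel1 s (\<phi> i) (\<phi> j) v w (fst (Ds \<eta> ! m)) * snd (Ds \<eta> ! m) =
          P m \<eta> * q m \<eta> powr (- ((3 + 2 * s) / 2))" for m
        unfolding kernel1_def case_prod_beta affine_ext_ref_map[OF mesh v vw(1) fe(1)] affine_ext_ref_map[OF mesh v vw(1) fe(2)]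
          affine_ext_ref_map[OF mesh w vw(2) fe(1)] affine_ext_ref_map[OF mesh w vw(2) fe(2)]
          norm_powr_eq[of _ "3 + 2 * s"] powr_minus_divide P_def F_def D_def q_def X_def Y_def J_def
        by (simp add: mult_ac)
      then show "regularized s (\<phi> i) (\<phi> j) v w Ds \<eta> =
          (\<Sum>m<L. P m \<eta> * q m \<eta> powr (- ((3 + 2 * s) / 2)))"
        by (simp add: regularized_eq_sum[OF len])
    qed
  qed
  then show ?thesis using C by blast
qed

section \<open>Distant pairs\<close>

lemma tensor_poly_duffy_tet: "tensor_poly 3 (\<lambda>\<eta>. duffy_tet (\<eta>$a) (\<eta>$b) (\<eta>$c) $ i)"
proof -
  note coord = tensor_poly_coord[of 1, OF order_refl]
  have three: "3 = 1 + 1 + (1::nat)" by simp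
  have "tensor_poly 3 (\<lambda>\<eta>. \<eta>$a * \<eta>$b * (1 - \<eta>$c))"
    unfolding three by (intro tensor_poly_mult tensor_poly_diff tensor_poly_const coord)
  moreover have "tensor_poly 3 (\<lambda>\<eta>. \<eta>$a * \<eta>$b * \<eta>$c)"
    unfolding three by (intro tensor_poly_mult coord)
  moreover have "tensor_poly 3 (\<lambda>\<eta>. \<eta>$a)" by (rule tensor_poly_coord) simp
  ultimately show ?thesis using exhaust_3[of i] by (auto simp: duffy_tet_def vec3_nth)
qed

text \<open>All points stay in their tetrahedra, so the distance of the elements bounds the
  denominator below directly.\<close>

lemma distant_quadrature_error:
  fixes c1 c2 c3 c4 s :: real and \<Omega> :: "(real^3) set"
  assumes pos: "0 < c1" "0 < c3" "0 < c4"
  shows "\<exists>C>0. \<exists>\<rho>>1/2. \<forall>\<T> N \<phi>.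
     tet_mesh \<Omega> \<T> \<and> quasi_uniform c1 c2 \<T> \<and> nodal_basis \<Omega> \<T> N \<phi> \<longrightarrow>
     (\<forall>i\<in>{1..N}. \<forall>j\<in>{1..N}. \<forall>v w. tet v \<in> \<T> \<and> tet w \<in> \<T> \<and>
        distant_cond c3 c4 (mesh_size \<T>) (\<phi> i) (\<phi> j) v w \<longrightarrow>
        (\<forall>n\<ge>1. \<bar>quadrature_error n (regularized_D s (\<phi> i) (\<phi> j) v w)\<bar>
           \<le> C * mesh_size \<T> powr (3 - 2 * s) * (2 * \<rho>) powr (- 2 * real n)))"
proof -
  define lb where "lb = c3\<^sup>2"
  \<comment> \<open>One diameter in each element plus the distance between the elements.\<close>
  define ub where "ub = (2 / c1 + c4)\<^sup>2 + lb"
  define B where "B = 7 * 7 * (36 / c1 ^ 6)"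
  have bounds: "0 < lb" "lb \<le> ub" "0 \<le> B" using pos by (auto simp: lb_def ub_def B_def)
  \<comment> \<open>The degree 12 is 3 + 3 for the nodal functions plus 6 as a crude bound for the
    Jacobian; the squared distance has degree at most 6.\<close>
  obtain C \<rho> where C: "0 < C" "1 / 2 < \<rho>" and main:
    "\<forall>(g :: real^6 \<Rightarrow> real) P q h n. 0 < h \<longrightarrow> 1 \<le> n \<longrightarrow>
       (\<forall>j<1. tensor_poly 12 (q j) \<and> tensor_poly 12 (P j)) \<longrightarrow>
       (\<forall>j<1. \<forall>x\<in>cbox 0 1. lb * h\<^sup>2 \<le> q j x \<and> q j x \<le> ub * h\<^sup>2 \<and> \<bar>P j x\<bar> \<le> B * h ^ 6) \<longrightarrow>
       (\<forall>x\<in>cbox 0 1. g x = (\<Sum>j<1::nat. P j x * q j x powr (- ((3 + 2 * s) / 2)))) \<longrightarrow>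
       \<bar>quadrature_error n g\<bar> \<le> C * h powr (3 - 2 * s) * (2 * \<rho>) powr (- 2 * real n)"
    using quadrature_error_sum_terms[OF bounds, where L = 1 and d = 12 and s = s and 'k = 6] by blast
  have "\<bar>quadrature_error n (regularized_D s (\<phi> i) (\<phi> j) v w)\<bar>
      \<le> C * mesh_size \<T> powr (3 - 2 * s) * (2 * \<rho>) powr (- 2 * real n)"
    if mesh: "tet_mesh \<Omega> \<T>" and quasi: "quasi_uniform c1 c2 \<T>" and basis: "nodal_basis \<Omega> \<T> N \<phi>"
      and ij: "i \<in> {1..N}" "j \<in> {1..N}" and vw: "tet v \<in> \<T>" "tet w \<in> \<T>"
      and cond: "distant_cond c3 c4 (mesh_size \<T>) (\<phi> i) (\<phi> j) v w" and n: "n \<ge> 1"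
    for \<T> N \<phi> i j v w n
  proof -
    define h where "h = mesh_size \<T>"
    obtain a b c e where v: "v = (a, b, c, e)" by (cases v)
    obtain a' b' c' e' where w: "w = (a', b', c', e')" by (cases w)
    have dist: "c3 * h \<le> setdist (tet v) (tet w)" "setdist (tet v) (tet w) \<le> c4 * h"
      using cond by (auto simp: distant_cond_def h_def)
    have diam: "diameter (tet v) \<le> h / c1" "diameter (tet w) \<le> h / c1"
      using mesh_size_bounds(1)[OF mesh v vw(1) quasi] mesh_size_bounds(1)[OF mesh w vw(2) quasi] pos
      by (auto simp: h_def field_simps)
    have h: "0 < h" using diameter_tet_pos[OF mesh v vw(1)] diam(1) pos(1)
      by (meson less_le_trans zero_less_divide_iff less_asym)
    define D where "D = \<bar>det (ref_mat v)\<bar> * \<bar>det (ref_mat w)\<bar>"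
    have D: "0 \<le> D" "D \<le> 36 / c1 ^ 6 * h ^ 6"
      using det_product_le[OF diam] by (auto simp: D_def power_divide)
    \<comment> \<open>Both defined branches of \<open>beta\<close> have the same form up to
      exchanging the indices, and \<open>distant_cond\<close> excludes the undefined one.\<close>
    obtain i' j' where ij': "i' \<in> {1..N}" "j' \<in> {1..N}"
      and beta: "\<And>x y. beta (\<phi> i) (\<phi> j) v w x y = - \<phi> i' x * \<phi> j' y"
    proof (cases "tet v \<subseteq> support (\<phi> i) \<and> tet w \<subseteq> support (\<phi> j)")
      case True
      then show ?thesis using that[of i j] ij by (simp add: beta_def)
    next
      case False
      then have "beta (\<phi> i) (\<phi> j) v w x y = - \<phi> j x * \<phi> i y" for x y
        unfolding beta_def using cond by (auto simp: distant_cond_def)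
      then show ?thesis using that[of j i] ij by blast
    qed
    define X :: "real^6 \<Rightarrow> real^3" where "X \<eta> = duffy_tet (\<eta>$1) (\<eta>$2) (\<eta>$3)" for \<eta>
    define Y :: "real^6 \<Rightarrow> real^3" where "Y \<eta> = duffy_tet (\<eta>$4) (\<eta>$5) (\<eta>$6)" for \<eta>
    have XY: "X \<eta> \<in> ref_tet" "Y \<eta> \<in> ref_tet" if "\<eta> \<in> cbox 0 1" for \<eta>
      using that by (auto simp: X_def Y_def cbox_01_iff intro!: duffy_tet_in_ref_tet)
    have tX: "tensor_poly 3 (\<lambda>\<eta>. X \<eta> $ l)" and tY: "tensor_poly 3 (\<lambda>\<eta>. Y \<eta> $ l)" for l
      unfolding X_def Y_def by (rule tensor_poly_duffy_tet)+
    define J :: "real^6 \<Rightarrow> real" where "J \<eta> = (\<eta>$1)^2 * \<eta>$2 * ((\<eta>$4)^2 * \<eta>$5)" for \<eta>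
    have tJ: "tensor_poly 6 J"
    proof -
      note coord = tensor_poly_coord[of 1, OF order_refl]
      have "tensor_poly (1 * 2 + 1 + (1 * 2 + 1)) J"
        unfolding J_def[abs_def] by (intro tensor_poly_mult tensor_poly_power coord)
      then show ?thesis by simp
    qed
    have J_le: "\<bar>J \<eta>\<bar> \<le> 1" if "\<eta> \<in> cbox 0 1" for \<eta>
    proof -
      have "\<bar>(\<eta>$1)^2 * \<eta>$2 * ((\<eta>$4)^2 * \<eta>$5)\<bar> \<le> (1^2 * 1) * (1^2 * 1)"
        unfolding abs_mult power_abs
        using that by (intro mult_mono power_mono) (auto simp: cbox_01_iff)
      then show ?thesis by (simp add: J_def)
    qed
    define q where "q m \<eta> = (norm (ref_map v (X \<eta>) - ref_map w (Y \<eta>)))\<^sup>2" for m :: nat and \<eta>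
    define P where "P m \<eta> = (- D) * ((nodal_interp (\<phi> i') v (X \<eta>) * nodal_interp (\<phi> j') w (Y \<eta>)) * J \<eta>)"
      for m :: nat and \<eta>
    have fe: "\<phi> i' \<in> fe_space \<Omega> \<T>" "\<phi> j' \<in> fe_space \<Omega> \<T>"
      using nodal_basis_vertex_values(1)[OF mesh v vw(1) basis] ij' by auto
    show ?thesis unfolding h_def[symmetric]
    proof (rule main[rule_format, where P = P and q = q, OF h n])
      fix m :: nat
      have "tensor_poly (2 * 3) (q m)"
        unfolding q_def[abs_def] using tX tY by (rule tensor_poly_norm_diff)
      moreover have "tensor_poly (3 + 3 + 6) (P m)"
        unfolding P_def[abs_def]
        by (intro tensor_poly_cmult tensor_poly_mult tensor_poly_ref_map tX tY tJ)
      ultimately show "tensor_poly 12 (q m) \<and> tensor_poly 12 (P m)"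
        by (auto elim!: tensor_poly_mono)
    next
      fix m :: nat and \<eta> assume \<eta>: "\<eta> \<in> cbox 0 (1 :: real^6)"
      let ?x = "ref_map v (X \<eta>)" and ?y = "ref_map w (Y \<eta>)"
      have xy: "?x \<in> tet v" "?y \<in> tet w" using XY[OF \<eta>] by (auto intro: ref_map_in_tet)
      have "c3 * h \<le> norm (?x - ?y)"
        using dist(1) setdist_le_dist[OF xy] by (simp add: dist_norm)
      then have "(c3 * h)\<^sup>2 \<le> (norm (?x - ?y))\<^sup>2" using pos h by (intro power_mono) auto
      then have 1: "lb * h\<^sup>2 \<le> q m \<eta>" unfolding lb_def q_def power_mult_distrib .
      have compact: "compact (tet v)" "compact (tet w)"
        by (simp_all add: v w compact_convex_hull finite_imp_compact)
      obtain x0 y0 where xy0: "x0 \<in> tet v" "y0 \<in> tet w" "dist x0 y0 = setdist (tet v) (tet w)"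
        using setdist_compact_closed[OF compact(1) compact_imp_closed[OF compact(2)]] xy by blast
      have "norm (?x - x0) \<le> h / c1" "norm (y0 - ?y) \<le> h / c1"
        using diff_le_diameter[of "{a, b, c, e}" ?x x0] diff_le_diameter[of "{a', b', c', e'}" y0 ?y]
          xy xy0 diam v w by auto
      moreover have "norm (?x - ?y) \<le> norm (?x - x0) + norm (x0 - y0) + norm (y0 - ?y)"
        using norm_triangle_ineq[of "?x - x0" "x0 - ?y"] norm_triangle_ineq[of "x0 - y0" "y0 - ?y"] by simp
      ultimately have "norm (?x - ?y) \<le> (2 / c1 + c4) * h"
        using xy0(3) dist(2) by (simp add: dist_norm distrib_right)
      then have "(norm (?x - ?y))\<^sup>2 \<le> ((2 / c1 + c4) * h)\<^sup>2" by (intro power_mono) auto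
      also have "\<dots> \<le> ub * h\<^sup>2"
        unfolding ub_def power_mult_distrib using \<open>0 < lb\<close> by (intro mult_right_mono) auto
      finally have 2: "q m \<eta> \<le> ub * h\<^sup>2" by (simp add: q_def)
      have "\<bar>nodal_interp (\<phi> i') v (X \<eta>)\<bar> \<le> 7" "\<bar>nodal_interp (\<phi> j') w (Y \<eta>)\<bar> \<le> 7"
        using nodal_basis_vertex_values(2)[OF mesh v vw(1) basis ij'(1)]
          nodal_basis_vertex_values(2)[OF mesh w vw(2) basis ij'(2)] ref_tet_coord_bounds XY[OF \<eta>]
        by (intro abs_nodal_interp_le[OF v] abs_nodal_interp_le[OF w]; blast)+
      then have "\<bar>(nodal_interp (\<phi> i') v (X \<eta>) * nodal_interp (\<phi> j') w (Y \<eta>)) * J \<eta>\<bar> \<le> 7 * 7 * 1"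
        unfolding abs_mult using J_le[OF \<eta>] by (intro mult_mono) auto
      then have "\<bar>P m \<eta>\<bar> \<le> (36 / c1 ^ 6 * h ^ 6) * (7 * 7 * 1)"
        unfolding P_def abs_mult[of "- D"] using D by (intro mult_mono) auto
      then have 3: "\<bar>P m \<eta>\<bar> \<le> B * h ^ 6" by (simp add: B_def mult_ac)
      show "lb * h\<^sup>2 \<le> q m \<eta> \<and> q m \<eta> \<le> ub * h\<^sup>2 \<and> \<bar>P m \<eta>\<bar> \<le> B * h ^ 6" using 1 2 3 by simp
    next
      fix \<eta> :: "real^6" assume \<eta>: "\<eta> \<in> cbox 0 1"
      show "regularized_D s (\<phi> i) (\<phi> j) v w \<eta> =
          (\<Sum>m<1::nat. P m \<eta> * q m \<eta> powr (- ((3 + 2 * s) / 2)))"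
        unfolding regularized_D_def Let_def beta X_def[symmetric] Y_def[symmetric]
          fe_ref_map[OF mesh v vw(1) fe(1) XY(1)[OF \<eta>]] fe_ref_map[OF mesh w vw(2) fe(2) XY(2)[OF \<eta>]]
          norm_minus_commute[of "ref_map w (Y \<eta>)"]
          norm_powr_eq[of _ "3 + 2 * s"] powr_minus_divide P_def D_def q_def J_def
        by (simp add: mult_ac)
    qed
  qed
  then show ?thesis using C by blast
qed

text \<open>The kind \<open>k\<close> is fixed before the constants, so each kind of pair has its
  own \<open>C\<close> and \<rho>.\<close>

theorem theorem4p19:
  fixes k :: pair_kind
    and s \<theta> c1 c2 c3 c4 cA :: real
    and \<Omega> :: "(real^3) set"
  assumes "0 < s" "s < 1"
    and "lipschitz_domain \<Omega>"
    and "\<theta> > 0" "c1 > 0" "c2 > 0" "c3 > 0" "c4 > 0" "cA > 0"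
  shows "\<exists>C>0. \<exists>\<rho>>1/2. \<forall>\<T> N \<phi>.
           tet_mesh \<Omega> \<T> \<and> shape_regular \<theta> \<T> \<and> quasi_uniform c1 c2 \<T> \<and>
           geometric_assumption cA \<Omega> \<T> \<and> nodal_basis \<Omega> \<T> N \<phi> \<longrightarrow>
           (\<forall>i\<in>{1..N}. \<forall>j\<in>{1..N}. \<forall>v w.
              tet v \<in> \<T> \<and> tet w \<in> \<T> \<and> ordered_pair k v w \<and>
              (k = Distant \<longrightarrow> distant_cond c3 c4 (mesh_size \<T>) (\<phi> i) (\<phi> j) v w) \<longrightarrow>
              (\<forall>n\<ge>1. \<bar>pair_error k s (\<phi> i) (\<phi> j) v w n\<bar>
                 \<le> C * mesh_size \<T> powr (3 - 2 * s) * (2 * \<rho>) powr (- 2 * real n)))"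
proof (cases k)
  case Distant
  show ?thesis
    unfolding Distant pair_error_def pair_kind.case
    using distant_quadrature_error[OF assms(5,7,8), where ?c2.0 = c2 and s = s and \<Omega> = \<Omega>]
    by - (elim exE conjE, intro exI conjI, assumption, assumption, blast)
next
  case Common_Vertex
  then show ?thesis
    using regularized_quadrature_error[OF regularizing_V assms(4,5,6,9), where s = s and \<Omega> = \<Omega>] by (simp add: pair_error_def)
next
  case Common_Edge
  then show ?thesis
    using regularized_quadrature_error[OF regularizing_E assms(4,5,6,9), where s = s and \<Omega> = \<Omega>] by (simp add: pair_error_def)
next
  case Common_Face
  then show ?thesis
    using regularized_quadrature_error[OF regularizing_F assms(4,5,6,9), where s = s and \<Omega> = \<Omega>] by (simp add: pair_error_def)
next
  case Identical
  then show ?thesis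
    using regularized_quadrature_error[OF regularizing_T assms(4,5,6,9), where s = s and \<Omega> = \<Omega>] by (simp add: pair_error_def)
qed

end
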